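(* Let $(M,\omega,h)$ be a Hamiltonian system and let $G$ be an Abelian Lie group acting properly on $M$ in a globally Hamiltonian fashion, with invariant momentum map $\mathbf{J}:M\to\mathfrak{g}^*$. Suppose that $h$ is $G$-invariant and that the Hamiltonian system determined by $h$ has a nondegenerate relative equilibrium at $m_e\in M$ with generator $\xi\in\mathfrak{g}$, and set $H:=G_{m_e}$. Then there is a symplectic (sub)manifold $\Sigma$ of $M$ consisting of relative equilibria of $h$ satisfying $m_e\in\Sigma$ and $$\dim\Sigma=2(\dim G-\dim H).$$
   Context: Relative equilibrium with generator $\xi$: $F_t(m_e)=\exp(t\xi)\cdot m_e$, $F_t$ the flow of the Hamiltonian vector field $X_h$; equivalently $D(h-\mathbf{J}^\xi)(m_e)=0$, $\mathbf{J}^\xi=\langle\mathbf{J},\xi\rangle$. $G_{m_e}$ is the isotropy subgroup of $m_e$. Nondegenerate: with $\mu=\mathbf{J}(m_e)$, the bilinear form $D^2(h-\mathbf{J}^\xi)(m_e)$ restricted to $\ker D\mathbf{J}(m_e)$ has kernel exactly $\mathfrak{g}_\mu\cdot m_e=\mathfrak{g}\cdot m_e:=\{\zeta_M(m_e):\zeta\in\mathfrak{g}\}$, the tangent space to the orbit $G\cdot m_e$. *)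

theory Defs
  imports "HOL-Analysis.Analysis"
begin

section \<open>Smooth maps between finite-dimensional normed spaces\<close>

text \<open>Meant for open \<open>S\<close>.  In finite dimensions, continuity of the \<open>k\<close>-th directional
  derivatives is equivalent to continuity of the \<open>k\<close>-th Frechet derivative.\<close>

fun Ck_on :: "nat \<Rightarrow> 'a::real_normed_vector set \<Rightarrow> ('a \<Rightarrow> 'b::real_normed_vector) \<Rightarrow> bool" where
  "Ck_on 0 S f \<longleftrightarrow> continuous_on S f"
| "Ck_on (Suc k) S f \<longleftrightarrow> (\<forall>x\<in>S. f differentiable (at x)) \<and>
     (\<forall>v. Ck_on k S (\<lambda>x. frechet_derivative f (at x) v))"

definition smooth_on :: "'a::real_normed_vector set \<Rightarrow> ('a \<Rightarrow> 'b::real_normed_vector) \<Rightarrow> bool" where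
  "smooth_on S f \<longleftrightarrow> (\<forall>k. Ck_on k S f)"


section \<open>Manifolds\<close>

text \<open>A chart is a pair of a domain \<open>U\<close> and a coordinate map, of which only the restriction to \<open>U\<close>
  matters.  The model space is a real normed space, required below to be finite-dimensional.
  It is not taken from the class \<open>euclidean_space\<close>, whose instances all have positive dimension:
  zero-dimensional manifolds, such as finite groups, are included.\<close>

type_synonym ('m, 'e) chart = "'m set \<times> ('m \<Rightarrow> 'e)"

definition chart_inv :: "('m, 'e) chart \<Rightarrow> 'e \<Rightarrow> 'm" where
  "chart_inv c = inv_into (fst c) (snd c)"

definition is_chart :: "('m::t2_space, 'e::real_normed_vector) chart \<Rightarrow> bool" where
  "is_chart c \<longleftrightarrow> open (fst c) \<and> open (snd c ` fst c) \<and>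
     homeomorphism (fst c) (snd c ` fst c) (snd c) (chart_inv c)"

definition in_charts :: "('m, 'e) chart \<Rightarrow> ('n, 'f) chart \<Rightarrow> ('m \<Rightarrow> 'n) \<Rightarrow> 'e \<Rightarrow> 'f" where
  "in_charts c d f = snd d \<circ> f \<circ> chart_inv c"

definition compatible ::
  "('m, 'e::real_normed_vector) chart \<Rightarrow> ('m, 'e) chart \<Rightarrow> bool" where
  "compatible c d \<longleftrightarrow>
     smooth_on (snd c ` (fst c \<inter> fst d)) (in_charts c d id) \<and>
     smooth_on (snd d ` (fst c \<inter> fst d)) (in_charts d c id)"

text \<open>The manifold is the whole type \<open>'m\<close>, Hausdorff and second countable by its sort.\<close>

definition smooth_manifold ::
  "('m::{t2_space, second_countable_topology}, 'e::real_normed_vector) chart set \<Rightarrow> bool" where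
  "smooth_manifold A \<longleftrightarrow>
     (\<exists>b :: 'e set. finite b \<and> span b = UNIV) \<and>
     (\<forall>c\<in>A. is_chart c) \<and> (\<Union>c\<in>A. fst c) = UNIV \<and>
     (\<forall>c\<in>A. \<forall>d\<in>A. compatible c d)"

definition maximal_atlas ::
  "('m::t2_space, 'e::real_normed_vector) chart set \<Rightarrow> ('m, 'e) chart set" where
  "maximal_atlas A = {c. is_chart c \<and> (\<forall>d\<in>A. compatible c d)}"

definition model_dim :: "('m, 'e::real_normed_vector) chart set \<Rightarrow> nat" where
  "model_dim A = dim (UNIV :: 'e set)"

definition vs_atlas :: "('e, 'e::real_normed_vector) chart set" where
  "vs_atlas = {(UNIV, id)}"

definition prod_atlas ::
  "('m, 'e) chart set \<Rightarrow> ('n, 'f) chart set \<Rightarrow> ('m \<times> 'n, 'e \<times> 'f) chart set" where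
  "prod_atlas A B = {(fst c \<times> fst d, \<lambda>(x, y). (snd c x, snd d y)) | c d. c \<in> A \<and> d \<in> B}"

definition smooth_map ::
  "('m::t2_space, 'e::real_normed_vector) chart set \<Rightarrow>
   ('n::t2_space, 'f::real_normed_vector) chart set \<Rightarrow> ('m \<Rightarrow> 'n) \<Rightarrow> bool" where
  "smooth_map A B f \<longleftrightarrow> continuous_on UNIV f \<and>
     (\<forall>c\<in>A. \<forall>d\<in>B. smooth_on (snd c ` (fst c \<inter> f -` fst d)) (in_charts c d f))"


subsection \<open>Tangent vectors and derivatives\<close>

text \<open>One chart \<open>chart_at A p\<close> is chosen around each point \<open>p\<close>, and the tangent space at \<open>p\<close> is
  identified with the model space by means of it.  Thus a tangent vector at \<open>p\<close> is an element of
  \<open>'e\<close>, and derivatives at \<open>p\<close> are computed in the charts chosen at \<open>p\<close> and at the image of \<open>p\<close>.\<close>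

definition chart_at :: "('m, 'e) chart set \<Rightarrow> 'm \<Rightarrow> ('m, 'e) chart" where
  "chart_at A p = (SOME c. c \<in> A \<and> p \<in> fst c)"

definition has_mderiv ::
  "('m::t2_space, 'e::real_normed_vector) chart set \<Rightarrow>
   ('n::t2_space, 'f::real_normed_vector) chart set \<Rightarrow>
   ('m \<Rightarrow> 'n) \<Rightarrow> ('e \<Rightarrow> 'f) \<Rightarrow> 'm \<Rightarrow> bool" where
  "has_mderiv A B f D p \<longleftrightarrow> isCont f p \<and>
     (in_charts (chart_at A p) (chart_at B (f p)) f has_derivative D) (at (snd (chart_at A p) p))"

definition mderiv ::
  "('m, 'e::real_normed_vector) chart set \<Rightarrow> ('n, 'f::real_normed_vector) chart set \<Rightarrow>
   ('m \<Rightarrow> 'n) \<Rightarrow> 'm \<Rightarrow> 'e \<Rightarrow> 'f" where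
  "mderiv A B f p =
     frechet_derivative (in_charts (chart_at A p) (chart_at B (f p)) f) (at (snd (chart_at A p) p))"

definition has_velocity ::
  "('m::t2_space, 'e::real_normed_vector) chart set \<Rightarrow> (real \<Rightarrow> 'm) \<Rightarrow> 'e \<Rightarrow> real \<Rightarrow> bool"
  where "has_velocity A c v t \<longleftrightarrow> has_mderiv vs_atlas A c (\<lambda>s. s *\<^sub>R v) t"

text \<open>The second derivative in the chart at \<open>p\<close>.  It represents an intrinsic bilinear form on the
  tangent space only if \<open>p\<close> is a critical point of \<open>f\<close>.\<close>

definition hessian ::
  "('m, 'e::real_normed_vector) chart set \<Rightarrow> ('m \<Rightarrow> real) \<Rightarrow> 'm \<Rightarrow> 'e \<Rightarrow> 'e \<Rightarrow> real" where
  "hessian A f p v w =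
     frechet_derivative (\<lambda>x. frechet_derivative (f \<circ> chart_inv (chart_at A p)) (at x) w)
       (at (snd (chart_at A p) p)) v"


subsection \<open>Embedded submanifolds\<close>

definition submanifold ::
  "('m::t2_space, 'e::real_normed_vector) chart set \<Rightarrow> nat \<Rightarrow> 'm set \<Rightarrow> bool" where
  "submanifold A k S \<longleftrightarrow>
     (\<forall>p\<in>S. \<exists>c\<in>maximal_atlas A. p \<in> fst c \<and>
        (\<exists>L. subspace L \<and> dim L = k \<and> snd c ` (fst c \<inter> S) = snd c ` fst c \<inter> L))"

definition submanifold_dim ::
  "('m::t2_space, 'e::real_normed_vector) chart set \<Rightarrow> 'm set \<Rightarrow> nat" where
  "submanifold_dim A S = (THE k. submanifold A k S)"

definition tangent_space ::
  "('m::t2_space, 'e::real_normed_vector) chart set \<Rightarrow> 'm set \<Rightarrow> 'm \<Rightarrow> 'e set" where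
  "tangent_space A S p = {v. \<exists>c. range c \<subseteq> S \<and> c 0 = p \<and> has_velocity A c v 0}"


section \<open>Symplectic manifolds and Hamiltonian systems\<close>

definition form_in_chart ::
  "('m, 'e::real_normed_vector) chart set \<Rightarrow> ('m \<Rightarrow> 'e \<Rightarrow> 'e \<Rightarrow> real) \<Rightarrow> ('m, 'e) chart \<Rightarrow>
   'e \<Rightarrow> 'e \<Rightarrow> 'e \<Rightarrow> real" where
  "form_in_chart A \<omega> c x v w =
     (let p = chart_inv c x;
          T = frechet_derivative (in_charts c (chart_at A p) id) (at x)
      in \<omega> p (T v) (T w))"

definition smooth_two_form ::
  "('m, 'e::real_normed_vector) chart set \<Rightarrow> ('m \<Rightarrow> 'e \<Rightarrow> 'e \<Rightarrow> real) \<Rightarrow> bool" where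
  "smooth_two_form A \<omega> \<longleftrightarrow>
     (\<forall>p. bilinear (\<omega> p) \<and> (\<forall>v. \<omega> p v v = 0)) \<and>
     (\<forall>c\<in>A. \<forall>v w. smooth_on (snd c ` fst c) (\<lambda>x. form_in_chart A \<omega> c x v w))"

text \<open>The exterior derivative evaluated on constant vector fields \<open>u\<close>, \<open>v\<close>, \<open>w\<close> of a chart, whose
  brackets vanish.\<close>

definition closed_two_form ::
  "('m, 'e::real_normed_vector) chart set \<Rightarrow> ('m \<Rightarrow> 'e \<Rightarrow> 'e \<Rightarrow> real) \<Rightarrow> bool" where
  "closed_two_form A \<omega> \<longleftrightarrow>
     (\<forall>c\<in>A. \<forall>x\<in>snd c ` fst c. \<forall>u v w.
        frechet_derivative (\<lambda>y. form_in_chart A \<omega> c y v w) (at x) u +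
        frechet_derivative (\<lambda>y. form_in_chart A \<omega> c y w u) (at x) v +
        frechet_derivative (\<lambda>y. form_in_chart A \<omega> c y u v) (at x) w = 0)"

definition nondegenerate_on :: "'e set \<Rightarrow> ('e \<Rightarrow> 'e::real_vector \<Rightarrow> real) \<Rightarrow> bool" where
  "nondegenerate_on V \<beta> \<longleftrightarrow> (\<forall>v\<in>V. (\<forall>w\<in>V. \<beta> v w = 0) \<longrightarrow> v = 0)"

definition symplectic_manifold ::
  "('m::{t2_space, second_countable_topology}, 'e::real_normed_vector) chart set \<Rightarrow>
   ('m \<Rightarrow> 'e \<Rightarrow> 'e \<Rightarrow> real) \<Rightarrow> bool" where
  "symplectic_manifold A \<omega> \<longleftrightarrow> smooth_manifold A \<and> smooth_two_form A \<omega> \<and> closed_two_form A \<omega> \<and>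
     (\<forall>p. nondegenerate_on UNIV (\<omega> p))"

definition symplectic_submanifold ::
  "('m::t2_space, 'e::real_normed_vector) chart set \<Rightarrow> ('m \<Rightarrow> 'e \<Rightarrow> 'e \<Rightarrow> real) \<Rightarrow>
   nat \<Rightarrow> 'm set \<Rightarrow> bool" where
  "symplectic_submanifold A \<omega> k S \<longleftrightarrow> submanifold A k S \<and>
     (\<forall>p\<in>S. nondegenerate_on (tangent_space A S p) (\<omega> p))"

definition hamiltonian_system ::
  "('m::{t2_space, second_countable_topology}, 'e::real_normed_vector) chart set \<Rightarrow>
   ('m \<Rightarrow> 'e \<Rightarrow> 'e \<Rightarrow> real) \<Rightarrow> ('m \<Rightarrow> real) \<Rightarrow> bool" where
  "hamiltonian_system A \<omega> h \<longleftrightarrow> symplectic_manifold A \<omega> \<and> smooth_map A vs_atlas h"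

definition hamiltonian_vf ::
  "('m, 'e::real_normed_vector) chart set \<Rightarrow> ('m \<Rightarrow> 'e \<Rightarrow> 'e \<Rightarrow> real) \<Rightarrow> ('m \<Rightarrow> real) \<Rightarrow> 'm \<Rightarrow> 'e" where
  "hamiltonian_vf A \<omega> h p = (THE X. \<forall>v. \<omega> p X v = mderiv A vs_atlas h p v)"

text \<open>\<open>flow_to A X t m p\<close>: the flow of \<open>X\<close> is defined at time \<open>t\<close> on \<open>m\<close> and takes \<open>m\<close> to \<open>p\<close>.\<close>

definition flow_to ::
  "('m::t2_space, 'e::real_normed_vector) chart set \<Rightarrow> ('m \<Rightarrow> 'e) \<Rightarrow> real \<Rightarrow> 'm \<Rightarrow> 'm \<Rightarrow> bool"
  where
  "flow_to A X t m p \<longleftrightarrow>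
     (\<exists>c I. open I \<and> is_interval I \<and> 0 \<in> I \<and> t \<in> I \<and>
        (\<forall>s\<in>I. has_velocity A c (X (c s)) s) \<and> c 0 = m \<and> c t = p)"


section \<open>Abelian Lie groups and their actions\<close>

text \<open>The group \<open>'g\<close> is Abelian and is written additively, so its unit is \<open>0\<close>.  Its Lie algebra,
  the tangent space at \<open>0\<close>, is the model space \<open>'f\<close>, and the dual of the Lie algebra is
  \<open>'f \<Rightarrow>\<^sub>L real\<close>.\<close>

definition abelian_lie_group ::
  "('g::{ab_group_add, t2_space, second_countable_topology}, 'f::real_normed_vector) chart set \<Rightarrow> bool"
  where
  "abelian_lie_group B \<longleftrightarrow> smooth_manifold B \<and>
     smooth_map (prod_atlas B B) B (\<lambda>(a, b). a + b) \<and> smooth_map B B uminus"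

definition one_parameter_subgroup ::
  "('g::{ab_group_add, t2_space}, 'f::real_normed_vector) chart set \<Rightarrow> 'f \<Rightarrow>
   (real \<Rightarrow> 'g) \<Rightarrow> bool" where
  "one_parameter_subgroup B \<zeta> c \<longleftrightarrow> smooth_map vs_atlas B c \<and>
     (\<forall>s t. c (s + t) = c s + c t) \<and> has_velocity B c \<zeta> 0"

definition lie_exp ::
  "('g::{ab_group_add, t2_space}, 'f::real_normed_vector) chart set \<Rightarrow> 'f \<Rightarrow> 'g" where
  "lie_exp B \<zeta> = (THE c. one_parameter_subgroup B \<zeta> c) 1"

definition smooth_action ::
  "('g::{ab_group_add, t2_space}, 'f::real_normed_vector) chart set \<Rightarrow>
   ('m::t2_space, 'e::real_normed_vector) chart set \<Rightarrow> ('g \<Rightarrow> 'm \<Rightarrow> 'm) \<Rightarrow> bool" where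
  "smooth_action B A act \<longleftrightarrow> (\<forall>m. act 0 m = m) \<and> (\<forall>a b m. act (a + b) m = act a (act b m)) \<and>
     smooth_map (prod_atlas B A) A (\<lambda>(g, m). act g m)"

definition proper_action :: "('g::t2_space \<Rightarrow> 'm::t2_space \<Rightarrow> 'm) \<Rightarrow> bool" where
  "proper_action act \<longleftrightarrow> proper_map euclidean euclidean (\<lambda>(g, m). (m, act g m))"

definition isotropy :: "('g \<Rightarrow> 'm \<Rightarrow> 'm) \<Rightarrow> 'm \<Rightarrow> 'g set" where
  "isotropy act m = {g. act g m = m}"

definition inf_generator ::
  "('g::{ab_group_add, t2_space}, 'f::real_normed_vector) chart set \<Rightarrow>
   ('m::t2_space, 'e::real_normed_vector) chart set \<Rightarrow> ('g \<Rightarrow> 'm \<Rightarrow> 'm) \<Rightarrow>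
   'f \<Rightarrow> 'm \<Rightarrow> 'e" where
  "inf_generator B A act \<zeta> m = mderiv vs_atlas A (\<lambda>t::real. act (lie_exp B (t *\<^sub>R \<zeta>)) m) 0 1"

definition symplectic_action ::
  "('m, 'e::real_normed_vector) chart set \<Rightarrow> ('m \<Rightarrow> 'e \<Rightarrow> 'e \<Rightarrow> real) \<Rightarrow> ('g \<Rightarrow> 'm \<Rightarrow> 'm) \<Rightarrow> bool"
  where
  "symplectic_action A \<omega> act \<longleftrightarrow>
     (\<forall>g m v w. \<omega> (act g m) (mderiv A A (act g) m v) (mderiv A A (act g) m w) = \<omega> m v w)"

definition momentum_map ::
  "('g::{ab_group_add, t2_space}, 'f::real_normed_vector) chart set \<Rightarrow>
   ('m::t2_space, 'e::real_normed_vector) chart set \<Rightarrow> ('m \<Rightarrow> 'e \<Rightarrow> 'e \<Rightarrow> real) \<Rightarrow>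
   ('g \<Rightarrow> 'm \<Rightarrow> 'm) \<Rightarrow> ('m \<Rightarrow> 'f \<Rightarrow>\<^sub>L real) \<Rightarrow> bool" where
  "momentum_map B A \<omega> act J \<longleftrightarrow> smooth_map A vs_atlas J \<and>
     (\<forall>\<zeta> m. inf_generator B A act \<zeta> m = hamiltonian_vf A \<omega> (\<lambda>m. blinfun_apply (J m) \<zeta>) m)"

text \<open>The momentum map is required to be equivariant; as the coadjoint action of an Abelian group
  is trivial, this means invariance.\<close>

definition globally_hamiltonian ::
  "('g::{ab_group_add, t2_space}, 'f::real_normed_vector) chart set \<Rightarrow>
   ('m::t2_space, 'e::real_normed_vector) chart set \<Rightarrow> ('m \<Rightarrow> 'e \<Rightarrow> 'e \<Rightarrow> real) \<Rightarrow>
   ('g \<Rightarrow> 'm \<Rightarrow> 'm) \<Rightarrow> ('m \<Rightarrow> 'f \<Rightarrow>\<^sub>L real) \<Rightarrow> bool" where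
  "globally_hamiltonian B A \<omega> act J \<longleftrightarrow> symplectic_action A \<omega> act \<and> momentum_map B A \<omega> act J \<and>
     (\<forall>g m. J (act g m) = J m)"


section \<open>Relative equilibria\<close>

definition relative_equilibrium ::
  "('g::{ab_group_add, t2_space}, 'f::real_normed_vector) chart set \<Rightarrow>
   ('m::t2_space, 'e::real_normed_vector) chart set \<Rightarrow> ('m \<Rightarrow> 'e \<Rightarrow> 'e \<Rightarrow> real) \<Rightarrow>
   ('g \<Rightarrow> 'm \<Rightarrow> 'm) \<Rightarrow> ('m \<Rightarrow> real) \<Rightarrow> 'f \<Rightarrow> 'm \<Rightarrow> bool" where
  "relative_equilibrium B A \<omega> act h \<xi> m \<longleftrightarrow>
     (\<forall>t. flow_to A (hamiltonian_vf A \<omega> h) t m (act (lie_exp B (t *\<^sub>R \<xi>)) m))"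

definition nondegenerate_relative_equilibrium ::
  "('g::{ab_group_add, t2_space}, 'f::real_normed_vector) chart set \<Rightarrow>
   ('m::t2_space, 'e::real_normed_vector) chart set \<Rightarrow> ('m \<Rightarrow> 'e \<Rightarrow> 'e \<Rightarrow> real) \<Rightarrow>
   ('g \<Rightarrow> 'm \<Rightarrow> 'm) \<Rightarrow> ('m \<Rightarrow> 'f \<Rightarrow>\<^sub>L real) \<Rightarrow> ('m \<Rightarrow> real) \<Rightarrow> 'f \<Rightarrow> 'm \<Rightarrow> bool" where
  "nondegenerate_relative_equilibrium B A \<omega> act J h \<xi> m \<longleftrightarrow>
     relative_equilibrium B A \<omega> act h \<xi> m \<and>
     (let K = {v. mderiv A vs_atlas J m v = 0};
          Q = hessian A (\<lambda>p. h p - blinfun_apply (J p) \<xi>) m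
      in {v \<in> K. \<forall>w\<in>K. Q v w = 0} = range (\<lambda>\<zeta>. inf_generator B A act \<zeta> m))"

end

theory Submission
  imports Defs
begin

text \<open>
  A point \<open>m\<close> is a relative equilibrium with generator \<open>\<eta>\<close> exactly when it is a critical point of
  \<open>h - J\<^sup>\<eta>\<close>, so the task is to solve \<open>d(h - J\<^bsup>\<xi>+\<eta>\<^esup>)(m) = 0\<close> for pairs \<open>(m, \<eta>)\<close> near \<open>(m\<^sub>e, 0)\<close>.
  Let \<open>r\<close> be the dimension of the orbit direction \<open>O = g\<cdot>m\<^sub>e\<close> and \<open>2n\<close> that of the manifold.  Since \<open>h\<close>
  and \<open>J\<close> are invariant, the differential always vanishes on the directions of the orbits.  It therefore
  suffices to demand that it vanish on a complement of \<open>O\<close>.  Such a complement is \<open>D + K'\<close>, where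
  \<open>K'\<close> is a complement of \<open>O\<close> in \<open>K = ker DJ(m\<^sub>e)\<close> and \<open>D\<close> is spanned by vectors \<open>\<omega>\<close>-dual to a basis of
  \<open>O\<close>.  Along \<open>D\<close> the equation is linear in \<open>\<eta>\<close> and, because \<open>dJ\<^sup>\<zeta> = \<omega>(\<zeta>\<^sub>M, \<cdot>)\<close>, it determines a
  multiplier \<open>\<eta>(m)\<close> smoothly.  The remaining \<open>2n - 2r\<close> equations along \<open>K'\<close> have the derivative
  \<open>Q = D\<^sup>2(h - J\<^sup>\<xi>)(m\<^sub>e)\<close>, whose restriction to \<open>K'\<close> is nondegenerate by hypothesis.  The inverse function
  theorem then gives a submanifold of dimension \<open>2r\<close>, with tangent space \<open>W = {v. Q(v, K') = 0}\<close> at \<open>m\<^sub>e\<close>.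

  This submanifold is symplectic at \<open>m\<^sub>e\<close>: one has \<open>O \<subseteq> W\<close>, \<open>W \<inter> K = O\<close>, and \<open>W + K\<close> is the whole tangent
  space.  If \<open>v \<in> W\<close> is \<open>\<omega>\<close>-orthogonal to \<open>W\<close>, it is orthogonal to \<open>O\<close>, hence lies in \<open>K\<close>, hence in
  \<open>O\<close>, hence is orthogonal to \<open>K\<close> as well, so \<open>v = 0\<close>.  All of this is
  the statement \<open>critical_slice\<close> about functions on a vector space.  The lemma
  \<open>straightened_submanifold\<close> carries it back to the manifold, and by \<open>nondegenerate_near\<close> the
  submanifold is still symplectic near \<open>m\<^sub>e\<close>.

  The passage between relative equilibria and critical points and the equation
  \<open>r = dim G - dim H\<close> both rest on the exponential map.  For an Abelian group it is the limit of
  \<open>2\<^sup>n\<cdot>\<psi>(v/2\<^sup>n)\<close>, where \<open>\<psi>\<close> is the inverse of a chart at the unit: the group law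
  differs from addition by a term bounded by \<open>C |x| |y|\<close>, which makes the sequence converge, and the
  limit is additive because \<open>g \<mapsto> 2\<^sup>n\<cdot>g\<close> is an endomorphism.
  Near the unit, the isotropy group is a linear subspace in exponential coordinates, namely the kernel of \<open>\<zeta> \<mapsto> \<zeta>\<^sub>M(m\<^sub>e)\<close>, so rank-nullity gives its codimension.
\<close>

section \<open>Finite-dimensional normed spaces\<close>

text \<open>The model spaces are only known to be spanned by a finite set; they carry neither an
  inner product nor a completeness assumption, so the usual finite-dimensional facts are derived
  from this alone.\<close>

definition finite_dim :: "'a::real_vector itself \<Rightarrow> bool" where
  "finite_dim (_ :: 'a itself) \<longleftrightarrow> (\<exists>b::'a set. finite b \<and> span b = UNIV)"

text \<open>Coordinates are bounded by the norm.  By induction on the basis: the span of the old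
  vectors is closed, because a convergent sequence in it has Cauchy coordinates, so the new basis
  vector has positive distance \<open>\<delta>\<close> from that span, and \<open>\<delta>\<close>
  bounds its coefficient.\<close>

lemma coefficients_bounded:
  fixes b :: "'a::real_normed_vector set"
  assumes "finite b" "independent b"
  shows "\<exists>C>0. \<forall>f. \<forall>i\<in>b. \<bar>f i\<bar> \<le> C * norm (\<Sum>j\<in>b. f j *\<^sub>R j)"
  using assms
proof (induction b rule: finite_induct)
  case empty
  show ?case by (intro exI[of _ 1]) auto
next
  case (insert a b)
  have ind: "independent b" using insert.prems independent_mono by blast
  have a: "a \<notin> span b" using insert.prems insert.hyps by (simp add: independent_insert)
  obtain C where C: "C > 0" "\<And>f i. i \<in> b \<Longrightarrow> \<bar>f i\<bar> \<le> C * norm (\<Sum>j\<in>b. f j *\<^sub>R j)"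
    using insert.IH[OF ind] by metis
  have "\<exists>\<delta>>0. \<forall>w\<in>span b. norm (a - w) \<ge> \<delta>"
  proof (rule ccontr)
    assume "\<not> ?thesis"
    then have "\<forall>n::nat. \<exists>w\<in>span b. norm (a - w) < inverse (Suc n)"
      by (metis inverse_positive_iff_positive not_le of_nat_0_less_iff zero_less_Suc)
    then obtain w where w: "\<And>n. w n \<in> span b" "\<And>n::nat. norm (a - w n) < inverse (Suc n)"
      by metis
    have "\<exists>f. w n = (\<Sum>j\<in>b. f j *\<^sub>R j)" for n
      using w(1)[of n] insert.hyps(1) by (auto simp: span_finite)
    then obtain f where f: "\<And>n. w n = (\<Sum>j\<in>b. f n j *\<^sub>R j)" by metis
    have "(\<lambda>n. norm (a - w n)) \<longlonglongrightarrow> 0"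
      by (rule Lim_null_comparison[OF _ LIMSEQ_inverse_real_of_nat])
         (use w(2) less_imp_le in \<open>auto intro!: eventuallyI\<close>)
    then have "(\<lambda>n. a - w n) \<longlonglongrightarrow> 0" by (rule tendsto_norm_zero_cancel)
    then have "(\<lambda>n. a - (a - w n)) \<longlonglongrightarrow> a - 0" by (intro tendsto_diff tendsto_const)
    then have wa: "w \<longlonglongrightarrow> a" by simp
    have "Cauchy (\<lambda>n. f n i)" if i: "i \<in> b" for i
    proof (rule metric_CauchyI)
      fix e :: real assume e: "e > 0"
      obtain M where M: "\<And>m n. m \<ge> M \<Longrightarrow> n \<ge> M \<Longrightarrow> dist (w m) (w n) < e / C"
        using LIMSEQ_imp_Cauchy[OF wa] e C(1) by (metis metric_CauchyD divide_pos_pos)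
      have "dist (f m i) (f n i) < e" if "m \<ge> M" "n \<ge> M" for m n
      proof -
        have "\<bar>f m i - f n i\<bar> \<le> C * norm (\<Sum>j\<in>b. (f m j - f n j) *\<^sub>R j)" using C(2)[OF i] .
        also have "(\<Sum>j\<in>b. (f m j - f n j) *\<^sub>R j) = w m - w n"
          by (simp add: f scaleR_diff_left sum_subtractf)
        also have "C * norm (w m - w n) < e"
          using M[OF that] C(1) by (simp add: dist_norm pos_less_divide_eq mult.commute)
        finally show ?thesis by (simp add: dist_norm)
      qed
      then show "\<exists>M. \<forall>m\<ge>M. \<forall>n\<ge>M. dist (f m i) (f n i) < e" by blast
    qed
    then have "\<forall>i\<in>b. \<exists>l. (\<lambda>n. f n i) \<longlonglongrightarrow> l"
      using real_Cauchy_convergent by (auto simp: convergent_def)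
    then obtain g where g: "\<And>i. i \<in> b \<Longrightarrow> (\<lambda>n. f n i) \<longlonglongrightarrow> g i" by metis
    have "w \<longlonglongrightarrow> (\<Sum>j\<in>b. g j *\<^sub>R j)"
      unfolding f by (intro tendsto_sum tendsto_scaleR g tendsto_const)
    then have "a = (\<Sum>j\<in>b. g j *\<^sub>R j)" using wa LIMSEQ_unique by blast
    then show False using a by (metis (no_types, lifting) span_base span_scale span_sum)
  qed
  then obtain \<delta> where \<delta>: "\<delta> > 0" "\<And>w. w \<in> span b \<Longrightarrow> norm (a - w) \<ge> \<delta>" by blast
  define D where "D = max (1 / \<delta>) (C * (1 + norm a / \<delta>))"
  have "\<bar>f i\<bar> \<le> D * norm (\<Sum>j\<in>insert a b. f j *\<^sub>R j)" if i: "i \<in> insert a b" for f i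
  proof -
    define w where "w = (\<Sum>j\<in>b. f j *\<^sub>R j)"
    define v where "v = f a *\<^sub>R a + w"
    have ws: "w \<in> span b" unfolding w_def by (intro span_sum span_scale span_base)
    have v: "(\<Sum>j\<in>insert a b. f j *\<^sub>R j) = v"
      using insert.hyps by (simp add: v_def w_def)
    have fa: "\<bar>f a\<bar> \<le> norm v / \<delta>"
    proof (cases "f a = 0")
      case True then show ?thesis using \<delta> by simp
    next
      case False
      have "- (w /\<^sub>R f a) \<in> span b" by (intro span_neg span_scale ws)
      then have "\<delta> \<le> norm (a + w /\<^sub>R f a)" using \<delta>(2) by fastforce
      then have "\<bar>f a\<bar> * \<delta> \<le> \<bar>f a\<bar> * norm (a + w /\<^sub>R f a)" by (simp add: mult_left_mono)
      also have "\<dots> = norm (f a *\<^sub>R (a + w /\<^sub>R f a))" by simp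
      also have "f a *\<^sub>R (a + w /\<^sub>R f a) = v" using False by (simp add: v_def scaleR_add_right)
      finally show ?thesis using \<delta>(1) by (simp add: pos_le_divide_eq)
    qed
    have "\<bar>f i\<bar> \<le> D * norm v"
    proof (cases "i = a")
      case True
      have "norm v / \<delta> \<le> D * norm v"
        unfolding D_def by (metis max.cobounded1 mult_right_mono norm_ge_zero times_divide_eq_left mult_1)
      then show ?thesis using order_trans[OF fa] True by simp
    next
      case False
      then have "i \<in> b" using i by simp
      then have "\<bar>f i\<bar> \<le> C * norm w" using C(2) unfolding w_def by blast
      also have "norm w \<le> norm v + \<bar>f a\<bar> * norm a"
        using norm_triangle_ineq4[of v "f a *\<^sub>R a"] by (simp add: v_def)
      also have "\<dots> \<le> norm v + norm v / \<delta> * norm a" using mult_right_mono[OF fa norm_ge_zero[of a]] by simp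
      also have "\<dots> = (1 + norm a / \<delta>) * norm v" by (simp add: algebra_simps)
      finally have "\<bar>f i\<bar> \<le> C * ((1 + norm a / \<delta>) * norm v)" using C(1) by simp
      also have "\<dots> \<le> D * norm v" unfolding D_def mult.assoc[symmetric]
        by (intro mult_right_mono) auto
      finally show ?thesis .
    qed
    then show ?thesis using v by simp
  qed
  moreover have "D > 0" using \<delta>(1) by (simp add: D_def less_max_iff_disj)
  ultimately show ?case by blast
qed

lemma finite_dim_coordinates:
  assumes "finite_dim TYPE('a::real_normed_vector)"
  obtains b :: "'a::real_normed_vector set" and c :: "'a \<Rightarrow> 'a \<Rightarrow> real"
  where "finite b" "independent b" "span b = UNIV"
    "\<And>i. i \<in> b \<Longrightarrow> bounded_linear (c i)" "\<And>v. (\<Sum>i\<in>b. c i v *\<^sub>R i) = v"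
proof -
  obtain S :: "'a set" where S: "finite S" "span S = UNIV" using assms finite_dim_def by blast
  obtain b where b: "b \<subseteq> S" "independent b" "S \<subseteq> span b" using maximal_independent_subset by blast
  have fb: "finite b" using b(1) S(1) finite_subset by blast
  have sb: "span b = UNIV" using b S by (metis span_mono span_span top.extremum_unique)
  define c where "c i v = representation b v i" for i v
  have sum: "(\<Sum>i\<in>b. c i v *\<^sub>R i) = v" for v
    unfolding c_def using sum_representation_eq[OF b(2) _ fb subset_refl] sb by blast
  obtain C where C: "C > 0" "\<And>f i. i \<in> b \<Longrightarrow> \<bar>f i\<bar> \<le> C * norm (\<Sum>j\<in>b. f j *\<^sub>R j)"
    using coefficients_bounded[OF fb b(2)] by metis
  have "bounded_linear (c i)" if "i \<in> b" for i
  proof (rule bounded_linear_intro[of _ C])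
    show "c i (x + y) = c i x + c i y" for x y
      unfolding c_def using representation_add[OF b(2)] sb by simp
    show "c i (r *\<^sub>R x) = r *\<^sub>R c i x" for r x
      unfolding c_def using representation_scale[OF b(2)] sb by simp
    show "norm (c i x) \<le> norm x * C" for x
      using C(2)[OF that, of "\<lambda>i. c i x"] by (simp add: sum mult.commute)
  qed
  then show ?thesis using that fb b(2) sb sum by blast
qed

lemma finite_dim_linear_bounded:
  fixes L :: "'a::real_normed_vector \<Rightarrow> 'b::real_normed_vector"
  assumes "finite_dim TYPE('a)" "linear L"
  shows "bounded_linear L"
proof -
  obtain b :: "'a set" and c where b: "finite b" "\<And>i. i \<in> b \<Longrightarrow> bounded_linear (c i)"
    "\<And>v. (\<Sum>i\<in>b. c i v *\<^sub>R i) = v"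
    using finite_dim_coordinates[OF assms(1)] by metis
  have "L v = (\<Sum>i\<in>b. c i v *\<^sub>R L i)" for v
    using b(3)[of v] by (metis (no_types, lifting) assms(2) linear_scale linear_sum sum.cong)
  then have "L = (\<lambda>v. \<Sum>i\<in>b. c i v *\<^sub>R L i)" by blast
  moreover have "bounded_linear (\<lambda>v. \<Sum>i\<in>b. c i v *\<^sub>R L i)"
    by (intro bounded_linear_sum bounded_linear_scaleR_const b(2))
  ultimately show ?thesis by simp
qed

lemma finite_dim_complete:
  assumes "finite_dim TYPE('a::real_normed_vector)"
  shows "complete (UNIV :: 'a set)"
  unfolding complete_def
proof (intro allI impI, elim conjE)
  fix x :: "nat \<Rightarrow> 'a" assume x: "Cauchy x"
  obtain b :: "'a set" and c where b: "finite b" "\<And>i. i \<in> b \<Longrightarrow> bounded_linear (c i)"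
    "\<And>v. (\<Sum>i\<in>b. c i v *\<^sub>R i) = v"
    using finite_dim_coordinates[OF assms(1)] by metis
  have "\<forall>i\<in>b. \<exists>l. (\<lambda>n. c i (x n)) \<longlonglongrightarrow> l"
    using bounded_linear.Cauchy[OF b(2) x] real_Cauchy_convergent by (auto simp: convergent_def)
  then obtain g where g: "\<And>i. i \<in> b \<Longrightarrow> (\<lambda>n. c i (x n)) \<longlonglongrightarrow> g i" by metis
  have "(\<lambda>n. \<Sum>i\<in>b. c i (x n) *\<^sub>R i) \<longlonglongrightarrow> (\<Sum>j\<in>b. g j *\<^sub>R j)"
    by (intro tendsto_sum tendsto_scaleR g tendsto_const)
  then show "\<exists>l\<in>UNIV. x \<longlonglongrightarrow> l" using b(3) by auto
qed

lemma finite_dim_prod: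
  assumes "finite_dim TYPE('a::real_normed_vector)" "finite_dim TYPE('b::real_normed_vector)"
  shows "finite_dim TYPE('a \<times> 'b)"
proof -
  obtain b :: "'a set" where b: "finite b" "span b = UNIV" using assms(1) finite_dim_def by blast
  obtain d :: "'b set" where d: "finite d" "span d = UNIV" using assms(2) finite_dim_def by blast
  let ?S = "(\<lambda>x. (x, 0)) ` b \<union> (\<lambda>y. (0, y)) ` d"
  have l1: "linear (\<lambda>x::'a. (x, 0::'b))" and l2: "linear (\<lambda>y::'b. (0::'a, y))"
    by (auto intro!: linearI)
  have "(x, y) \<in> span ?S" for x y
  proof -
    have "(x, 0) \<in> span ((\<lambda>x. (x, 0::'b)) ` b)"
      using linear_span_image[OF l1, of b] b(2) by simp
    moreover have "(0, y) \<in> span ((\<lambda>y. (0::'a, y)) ` d)"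
      using linear_span_image[OF l2, of d] d(2) by simp
    ultimately have "(x, 0) + (0, y) \<in> span ?S"
      by (meson span_add span_mono subsetD sup_ge1 sup_ge2)
    then show ?thesis by simp
  qed
  then have "span ?S = UNIV" by auto
  then show ?thesis unfolding finite_dim_def using b d by (intro exI[of _ ?S]) auto
qed

lemma finite_dim_locale:
  assumes "finite_dim TYPE('a::real_vector)"
  obtains b :: "'a::real_vector set" where "finite_dimensional_vector_space scaleR b"
proof -
  obtain S :: "'a set" where S: "finite S" "span S = UNIV" using assms finite_dim_def by blast
  obtain b where b: "b \<subseteq> S" "independent b" "S \<subseteq> span b" using maximal_independent_subset by blast
  have fb: "finite b" using b(1) S(1) finite_subset by blast
  have sb: "span b = UNIV" using b S by (metis span_mono span_span top.extremum_unique)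
  have "finite_dimensional_vector_space scaleR b"
    using fb sb b(2) by unfold_locales (auto simp: dependent_raw_def span_raw_def)
  then show ?thesis using that by blast
qed

lemma finite_dim_independent_finite:
  assumes "finite_dim TYPE('a::real_vector)" "independent (b::'a set)" shows "finite b"
proof -
  obtain B :: "'a set" where B: "finite_dimensional_vector_space scaleR B"
    using finite_dim_locale[OF assms(1)] .
  show ?thesis using finite_dimensional_vector_space.finiteI_independent[OF B] assms(2)
    by (simp add: dependent_raw_def)
qed

lemma finite_dim_subspace_basis:
  assumes "finite_dim TYPE('a::real_vector)" "subspace (V::'a set)"
  obtains b where "finite b" "independent b" "span b = V" "card b = dim V"
  using assms basis_exists[of V] finite_dim_independent_finite
  by (metis span_subspace)

text \<open>A basis of the subspace is mapped to an independent set of the same size.\<close>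

lemma finite_dim_inj_surj_on:
  fixes L :: "'a::real_vector \<Rightarrow> 'a"
  assumes fd: "finite_dim TYPE('a)" and L: "linear L" and V: "subspace V" "L ` V \<subseteq> V"
    and inj: "\<And>v. v \<in> V \<Longrightarrow> L v = 0 \<Longrightarrow> v = 0"
  shows "L ` V = V"
proof -
  obtain b where b: "finite b" "independent b" "span b = V" "card b = dim V"
    using finite_dim_subspace_basis[OF fd V(1)] .
  have injV: "inj_on L V"
    by (smt (verit) L V(1) inj inj_onI linear_diff right_minus_eq subspace_diff)
  have "independent (L ` b)" using linear_independent_injective_image[OF L b(2)] injV b(3) by simp
  moreover have "card (L ` b) = card b"
    using card_image[OF inj_on_subset[OF injV]] b(3) span_superset by blast
  moreover have "L ` b \<subseteq> V" using V b(3) span_superset by fastforce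
  moreover obtain B :: "'a set" where B: "finite_dimensional_vector_space scaleR B"
    using finite_dim_locale[OF fd] .
  ultimately have "V \<subseteq> span (L ` b)"
    using finite_dimensional_vector_space.card_ge_dim_independent[OF B, of "L ` b" V] b(4)
    by (simp add: dependent_raw_def dim_raw_def span_raw_def)
  then show ?thesis using linear_span_image[OF L, of b] b(3) V by blast
qed

lemma finite_dim_inj_bij:
  fixes L :: "'a::real_vector \<Rightarrow> 'a"
  assumes fd: "finite_dim TYPE('a)" and L: "linear L" and inj: "\<And>v. L v = 0 \<Longrightarrow> v = 0"
  shows "bij L"
  using finite_dim_inj_surj_on[OF fd L subspace_UNIV] inj linear_injective_0[OF L]
  by (auto simp: bij_def)

text \<open>Extend a basis \<open>b\<close> of the kernel to a basis \<open>B\<close> of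
  \<open>V\<close>; the map sends \<open>B - b\<close> bijectively to a basis of the image.\<close>

lemma rank_nullity:
  fixes L :: "'a::real_vector \<Rightarrow> 'b::real_vector"
  assumes fd: "finite_dim TYPE('a)" and L: "linear L" and V: "subspace V"
  shows "dim (L ` V) + dim {v \<in> V. L v = 0} = dim V"
proof -
  let ?N = "{v \<in> V. L v = 0}"
  have N: "subspace ?N"
    using V L by (auto simp: subspace_def linear_add linear_scale linear_0)
  obtain b where b: "finite b" "independent b" "span b = ?N" "card b = dim ?N"
    using finite_dim_subspace_basis[OF fd N] .
  have "b \<subseteq> V" using b(3) span_superset by blast
  then obtain B where B: "b \<subseteq> B" "B \<subseteq> V" "independent B" "V \<subseteq> span B"
    using maximal_independent_subset_extend[OF _ b(2)] by metis
  have fB: "finite B" using finite_dim_independent_finite[OF fd B(3)] .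
  have cB: "card B = dim V" using B basis_card_eq_dim by blast
  let ?C = "B - b"
  have indC: "independent ?C" using B(3) independent_mono by blast
  have inj: "inj_on L (span ?C)"
  proof (rule inj_onI)
    fix x y assume xy: "x \<in> span ?C" "y \<in> span ?C" "L x = L y"
    have d: "x - y \<in> span ?C" using xy span_diff by blast
    have "x - y \<in> V" using d B(2) V by (metis Diff_subset span_minimal subset_trans subsetD)
    then have "x - y \<in> span b" using b(3) xy(3) L by (simp add: linear_diff)
    then have d0: "representation B (x - y) i = 0" for i
      using d representation_extend[OF B(3) d] representation_extend[OF B(3) _ B(1), of "x - y"]
        representation_ne_zero[of ?C "x - y" i] representation_ne_zero[of b "x - y" i] by auto
    have "x - y \<in> span B" using d span_mono[of ?C B] by blast
    from sum_representation_eq[OF B(3) this fB subset_refl] show "x = y" using d0 by simp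
  qed
  have "L ` V = span (L ` ?C)"
  proof
    show "L ` V \<subseteq> span (L ` ?C)"
    proof
      fix y assume "y \<in> L ` V"
      then obtain v where v: "v \<in> V" "y = L v" by blast
      have "v \<in> span (b \<union> ?C)" using v B by (metis Un_Diff_cancel2 Un_absorb2 Un_commute subsetD)
      then obtain x z where "x \<in> span b" "z \<in> span ?C" "v = x + z"
        unfolding span_Un by blast
      then have "y = L z" "z \<in> span ?C" using v b(3) L by (auto simp: linear_add)
      then show "y \<in> span (L ` ?C)" using linear_span_image[OF L] by auto
    qed
    have "span ?C \<subseteq> V" using B(2) V by (meson Diff_subset span_minimal subset_trans)
    then show "span (L ` ?C) \<subseteq> L ` V" using linear_span_image[OF L, of ?C] by blast
  qed
  moreover have "independent (L ` ?C)" using linear_independent_injective_image[OF L indC inj] .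
  moreover have "card (L ` ?C) = card ?C"
    using card_image[OF inj_on_subset[OF inj]] span_superset by blast
  ultimately have "dim (L ` V) = card ?C" by (metis dim_span_eq_card_independent)
  moreover have "card ?C + card b = card B"
    using fB B(1) b(1) by (simp add: card_Diff_subset card_mono)
  ultimately show ?thesis using b(4) cB by simp
qed

section \<open>Calculus of smooth maps\<close>

lemma frechet_derivative_cong_open:
  assumes "open S" "x \<in> S" "\<And>y. y \<in> S \<Longrightarrow> f y = g y"
  shows "frechet_derivative f (at x) = frechet_derivative g (at x)"
proof -
  have "(f has_derivative D) (at x) \<longleftrightarrow> (g has_derivative D) (at x)" for D
    using has_derivative_transform_within_open[OF _ assms(1,2), of f D UNIV g]
      has_derivative_transform_within_open[OF _ assms(1,2), of g D UNIV f] assms(3) by metis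
  then show ?thesis unfolding frechet_derivative_def by simp
qed

lemma differentiable_cong_open:
  assumes "open S" "x \<in> S" "\<And>y. y \<in> S \<Longrightarrow> f y = g y"
  shows "f differentiable (at x) \<longleftrightarrow> g differentiable (at x)"
  using has_derivative_transform_within_open[OF _ assms(1,2), of f _ UNIV g]
    has_derivative_transform_within_open[OF _ assms(1,2), of g _ UNIV f] assms(3)
  unfolding differentiable_def by metis

lemma Ck_on_cong:
  assumes "open S" "\<And>y. y \<in> S \<Longrightarrow> f y = g y"
  shows "Ck_on k S f \<longleftrightarrow> Ck_on k S g"
  using assms(2)
proof (induction k arbitrary: f g)
  case 0
  then show ?case using continuous_on_cong by force
next
  case (Suc k)
  have "Ck_on k S (\<lambda>x. frechet_derivative f (at x) v) \<longleftrightarrow>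
        Ck_on k S (\<lambda>x. frechet_derivative g (at x) v)" for v
    by (rule Suc.IH) (use frechet_derivative_cong_open[OF assms(1) _ Suc.prems] in simp)
  then show ?case using differentiable_cong_open[OF assms(1) _ Suc.prems] by simp
qed

text \<open>The working form of the recursion: any expression for the derivative will do.\<close>

lemma Ck_on_SucI:
  assumes S: "open S" and der: "\<And>x. x \<in> S \<Longrightarrow> (f has_derivative D x) (at x)"
    and D: "\<And>v. Ck_on k S (\<lambda>x. D x v)"
  shows "Ck_on (Suc k) S f"
  unfolding Ck_on.simps
proof (intro conjI ballI allI)
  show "f differentiable (at x)" if "x \<in> S" for x using der[OF that] differentiable_def by blast
  show "Ck_on k S (\<lambda>x. frechet_derivative f (at x) v)" for v
    using Ck_on_cong[OF S, of "\<lambda>x. frechet_derivative f (at x) v" "\<lambda>x. D x v" k]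
      frechet_derivative_at[OF der] D by simp
qed

lemma Ck_on_Suc_imp: "Ck_on (Suc k) S f \<Longrightarrow> Ck_on k S f"
proof (induction k arbitrary: f)
  case 0
  then show ?case
    by (auto intro!: continuous_at_imp_continuous_on differentiable_imp_continuous_within)
next
  case (Suc k)
  show ?case unfolding Ck_on.simps(2)[of k]
  proof (intro conjI allI)
    show "\<forall>x\<in>S. f differentiable (at x)" using Suc.prems by simp
    show "Ck_on k S (\<lambda>x. frechet_derivative f (at x) v)" for v
      by (rule Suc.IH) (use Suc.prems in \<open>simp only: Ck_on.simps(2)[of "Suc k"]\<close>)
  qed
qed

lemma Ck_on_mono: "Ck_on k S f \<Longrightarrow> j \<le> k \<Longrightarrow> Ck_on j S f"
  by (induction k) (use Ck_on_Suc_imp le_Suc_eq in blast)+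

lemma Ck_on_subset: "Ck_on k S f \<Longrightarrow> T \<subseteq> S \<Longrightarrow> Ck_on k T f"
  by (induction k arbitrary: f) (auto intro: continuous_on_subset)

lemma Ck_on_local:
  assumes "\<And>x. x \<in> S \<Longrightarrow> \<exists>T. open T \<and> x \<in> T \<and> Ck_on k T f"
  shows "Ck_on k S f"
  using assms
proof (induction k arbitrary: f)
  case 0
  have "isCont f x" if "x \<in> S" for x
    using 0[OF that] by (auto simp: continuous_on_eq_continuous_at)
  then show ?case by (simp add: continuous_at_imp_continuous_on)
next
  case (Suc k)
  have "f differentiable (at x)" if "x \<in> S" for x using Suc.prems[OF that] by auto
  moreover have "Ck_on k S (\<lambda>x. frechet_derivative f (at x) v)" for v
    by (rule Suc.IH) (use Suc.prems in fastforce)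
  ultimately show ?case by simp
qed

lemma Ck_on_const: "Ck_on k S (\<lambda>x. c)"
  by (induction k arbitrary: c) (auto simp: frechet_derivative_const)

lemma frechet_derivative_bounded_linear:
  "bounded_linear L \<Longrightarrow> frechet_derivative L (at x) = L"
  using bounded_linear_imp_has_derivative frechet_derivative_at by metis

lemma Ck_on_bounded_linear:
  assumes "bounded_linear L" shows "Ck_on k S L"
proof (cases k)
  case 0
  then show ?thesis using assms by (simp add: linear_continuous_on)
next
  case (Suc j)
  have "L differentiable (at x)" for x
    using assms bounded_linear_imp_differentiable by blast
  then show ?thesis using Suc assms by (simp add: frechet_derivative_bounded_linear Ck_on_const)
qed

lemma Ck_on_bounded_linear_compose:
  assumes L: "bounded_linear L" and S: "open S" and "Ck_on k S f"
  shows "Ck_on k S (\<lambda>x. L (f x))"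
  using assms(3)
proof (induction k arbitrary: f)
  case 0
  then show ?case using bounded_linear.continuous_on[OF L] by simp
next
  case (Suc k)
  have der: "((\<lambda>x. L (f x)) has_derivative (\<lambda>v. L (frechet_derivative f (at x) v))) (at x)"
    if "x \<in> S" for x
    by (rule bounded_linear.has_derivative[OF L])
       (use that Suc.prems in \<open>simp add: frechet_derivative_works[symmetric]\<close>)
  show ?case
  proof (rule Ck_on_SucI[OF S der])
    fix v
    show "Ck_on k S (\<lambda>x. L (frechet_derivative f (at x) v))"
      using Suc.IH Suc.prems by simp
  qed
qed

lemma Ck_on_add:
  assumes S: "open S" and "Ck_on k S f" "Ck_on k S g"
  shows "Ck_on k S (\<lambda>x. f x + g x)"
  using assms(2,3)
proof (induction k arbitrary: f g)
  case 0
  then show ?case by (simp add: continuous_on_add)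
next
  case (Suc k)
  have der: "((\<lambda>x. f x + g x) has_derivative
      (\<lambda>v. frechet_derivative f (at x) v + frechet_derivative g (at x) v)) (at x)"
    if "x \<in> S" for x
    by (intro has_derivative_add) (use that Suc.prems in \<open>simp_all add: frechet_derivative_works[symmetric]\<close>)
  show ?case
  proof (rule Ck_on_SucI[OF S der])
    fix v
    show "Ck_on k S (\<lambda>x. frechet_derivative f (at x) v + frechet_derivative g (at x) v)"
      using Suc.IH Suc.prems by simp
  qed
qed

lemma Ck_on_sum:
  assumes S: "open S" and "\<And>i. i \<in> I \<Longrightarrow> Ck_on k S (f i)"
  shows "Ck_on k S (\<lambda>x. \<Sum>i\<in>I. f i x)"
  using assms(2)
  by (induction I rule: infinite_finite_induct) (auto intro: Ck_on_add[OF S] Ck_on_const)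

lemma Ck_on_bilinear:
  assumes B: "bounded_bilinear B" and S: "open S" and "Ck_on k S f" "Ck_on k S g"
  shows "Ck_on k S (\<lambda>x. B (f x) (g x))"
  using assms(3,4)
proof (induction k arbitrary: f g)
  case 0
  then show ?case using bounded_bilinear.continuous_on[OF B] by simp
next
  case (Suc k)
  have der: "((\<lambda>x. B (f x) (g x)) has_derivative
      (\<lambda>v. B (f x) (frechet_derivative g (at x) v) + B (frechet_derivative f (at x) v) (g x))) (at x)"
    if "x \<in> S" for x
    by (intro bounded_bilinear.FDERIV[OF B]) (use that Suc.prems in \<open>simp_all add: frechet_derivative_works[symmetric]\<close>)
  show ?case
  proof (rule Ck_on_SucI[OF S der])
    fix v
    show "Ck_on k S (\<lambda>x. B (f x) (frechet_derivative g (at x) v) + B (frechet_derivative f (at x) v) (g x))"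
      by (intro Ck_on_add[OF S] Suc.IH Ck_on_Suc_imp[of k S f] Ck_on_Suc_imp[of k S g])
         (use Suc.prems in simp_all)
  qed
qed

lemma frechet_derivative_apply:
  "(f has_derivative D) (at x) \<Longrightarrow> frechet_derivative f (at x) v = D v"
  by (simp add: frechet_derivative_at[symmetric])

lemma linear_frechet_derivative_at:
  "f differentiable (at x) \<Longrightarrow> linear (frechet_derivative f (at x))"
  using frechet_derivative_works has_derivative_linear by blast

lemma Ck_on_imp_continuous_on: "Ck_on k S f \<Longrightarrow> continuous_on S f"
  using Ck_on_mono[of k S f 0] by simp

text \<open>The chain rule leads out of compositions, since the derivative of \<open>g\<close> is
  applied to a varying vector.  Expanding this vector in a basis yields products of real coordinates
  with the maps \<open>Dg(\<cdot>) i \<circ> f\<close>, to which the induction hypothesis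
  applies.\<close>

lemma Ck_on_compose:
  fixes f :: "'a::real_normed_vector \<Rightarrow> 'b::real_normed_vector" and g :: "'b \<Rightarrow> 'c::real_normed_vector"
  assumes fd: "finite_dim TYPE('b)" and S: "open S"
    and f: "Ck_on k S f" and "Ck_on k T g" and fS: "f ` S \<subseteq> T"
  shows "Ck_on k S (\<lambda>x. g (f x))"
  using f assms(4)
proof (induction k arbitrary: g)
  case 0
  then show ?case using continuous_on_compose2 fS by auto
next
  case (Suc k)
  have f': "Ck_on k S f" using Ck_on_Suc_imp Suc.prems by blast
  obtain b :: "'b set" and c where b: "finite b" "\<And>i. i \<in> b \<Longrightarrow> bounded_linear (c i)"
    "\<And>v. (\<Sum>i\<in>b. c i v *\<^sub>R i) = v"
    using finite_dim_coordinates[OF fd] by metis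
  have gd: "g differentiable (at (f x))" if "x \<in> S" for x using that fS Suc.prems by auto
  have fdiff: "f differentiable (at x)" if "x \<in> S" for x using that Suc.prems by auto
  have der: "((\<lambda>x. g (f x)) has_derivative
      (\<lambda>v. \<Sum>i\<in>b. c i (frechet_derivative f (at x) v) *\<^sub>R frechet_derivative g (at (f x)) i)) (at x)"
    if x: "x \<in> S" for x
  proof -
    have d: "((\<lambda>x. g (f x)) has_derivative
      (\<lambda>v. frechet_derivative g (at (f x)) (frechet_derivative f (at x) v))) (at x)"
      by (rule has_derivative_compose[OF fdiff[OF x, unfolded frechet_derivative_works]
            gd[OF x, unfolded frechet_derivative_works]])
    have eq: "frechet_derivative g (at (f x)) u =
        (\<Sum>i\<in>b. c i u *\<^sub>R frechet_derivative g (at (f x)) i)" for u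
      using linear_sum[OF linear_frechet_derivative_at[OF gd[OF x]], of "\<lambda>i. c i u *\<^sub>R i" b]
      by (simp add: b(3) linear_scale[OF linear_frechet_derivative_at[OF gd[OF x]]])
    show ?thesis using d by (simp only: eq[of "frechet_derivative f (at x) v" for v])
  qed
  show ?case
  proof (rule Ck_on_SucI[OF S der])
    fix v
    show "Ck_on k S (\<lambda>x. \<Sum>i\<in>b. c i (frechet_derivative f (at x) v) *\<^sub>R frechet_derivative g (at (f x)) i)"
    proof (intro Ck_on_sum[OF S] Ck_on_bilinear[OF bounded_bilinear_scaleR S])
      fix i assume i: "i \<in> b"
      show "Ck_on k S (\<lambda>x. c i (frechet_derivative f (at x) v))"
        using Ck_on_bounded_linear_compose[OF b(2)[OF i] S] Suc.prems by simp
      show "Ck_on k S (\<lambda>x. frechet_derivative g (at (f x)) i)"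
        using Suc.IH[OF f', of "\<lambda>y. frechet_derivative g (at y) i"] Suc.prems by simp
    qed
  qed
qed

subsection \<open>Smoothness at a point\<close>

text \<open>Smoothness near a point.  Local statements compose without any bookkeeping of
  domains.\<close>

definition smooth_at :: "('a::real_normed_vector \<Rightarrow> 'b::real_normed_vector) \<Rightarrow> 'a \<Rightarrow> bool" where
  "smooth_at f x \<longleftrightarrow> (\<exists>T. open T \<and> x \<in> T \<and> smooth_on T f)"

lemma smooth_on_subset: "smooth_on S f \<Longrightarrow> T \<subseteq> S \<Longrightarrow> smooth_on T f"
  using Ck_on_subset unfolding smooth_on_def by blast

lemma smooth_at_smooth_on: "smooth_on S f \<Longrightarrow> open S \<Longrightarrow> x \<in> S \<Longrightarrow> smooth_at f x"
  unfolding smooth_at_def by blast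

lemma smooth_on_smooth_at:
  assumes "\<And>x. x \<in> S \<Longrightarrow> smooth_at f x" shows "smooth_on S f"
  unfolding smooth_on_def
proof (intro allI Ck_on_local)
  show "\<exists>T. open T \<and> x \<in> T \<and> Ck_on k T f" if "x \<in> S" for k x
    using assms[OF that] unfolding smooth_at_def smooth_on_def by blast
qed

lemma smooth_at_eventually:
  assumes "smooth_at f x" shows "\<forall>\<^sub>F y in nhds x. smooth_at f y"
proof -
  obtain T where T: "open T" "x \<in> T" "smooth_on T f" using assms smooth_at_def by blast
  then have "\<forall>y\<in>T. smooth_at f y" using smooth_at_smooth_on by blast
  with T(1,2) show ?thesis using eventually_nhds_in_open[OF T(1,2)] by (auto elim: eventually_mono)
qed

lemma smooth_at_cong:
  assumes "\<forall>\<^sub>F y in nhds x. f y = g y" shows "smooth_at f x \<longleftrightarrow> smooth_at g x"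
proof -
  obtain U where U: "open U" "x \<in> U" "\<And>y. y \<in> U \<Longrightarrow> f y = g y"
    using assms unfolding eventually_nhds by blast
  have *: "smooth_on (T \<inter> U) f \<longleftrightarrow> smooth_on (T \<inter> U) g" if "open T" for T
    unfolding smooth_on_def using Ck_on_cong[of "T \<inter> U" f g] that U by blast
  have "smooth_at f x \<longleftrightarrow> (\<exists>T. open T \<and> x \<in> T \<and> smooth_on (T \<inter> U) f)" for f :: "'a \<Rightarrow> 'b"
  proof
    assume "smooth_at f x"
    then show "\<exists>T. open T \<and> x \<in> T \<and> smooth_on (T \<inter> U) f"
      unfolding smooth_at_def using smooth_on_subset[of _ f] by (meson inf_le1)
  next
    assume "\<exists>T. open T \<and> x \<in> T \<and> smooth_on (T \<inter> U) f"
    then obtain T where "open T" "x \<in> T" "smooth_on (T \<inter> U) f" by blast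
    then show "smooth_at f x" unfolding smooth_at_def using U by (intro exI[of _ "T \<inter> U"]) auto
  qed
  then show ?thesis using * by blast
qed

lemma smooth_at_transform:
  "smooth_at f x \<Longrightarrow> \<forall>\<^sub>F y in nhds x. f y = g y \<Longrightarrow> smooth_at g x"
  using smooth_at_cong[of f g x] by blast

lemma smooth_at_isCont: assumes "smooth_at f x" shows "isCont f x"
proof -
  obtain T where "open T" "x \<in> T" "smooth_on T f" using assms smooth_at_def by blast
  moreover then have "continuous_on T f" using smooth_on_def Ck_on_imp_continuous_on by blast
  ultimately show ?thesis by (simp add: continuous_on_eq_continuous_at)
qed

lemma smooth_at_differentiable: assumes "smooth_at f x" shows "f differentiable (at x)"
proof -
  obtain T where T: "open T" "x \<in> T" "smooth_on T f" using assms smooth_at_def by blast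
  then have "Ck_on (Suc 0) T f" using smooth_on_def by blast
  then show ?thesis using T by simp
qed

lemma smooth_at_has_derivative:
  "smooth_at f x \<Longrightarrow> (f has_derivative frechet_derivative f (at x)) (at x)"
  using smooth_at_differentiable frechet_derivative_works by blast

lemma smooth_at_linear_derivative: "smooth_at f x \<Longrightarrow> linear (frechet_derivative f (at x))"
  using smooth_at_differentiable linear_frechet_derivative_at by blast

lemma smooth_at_frechet_derivative:
  assumes "smooth_at f x" shows "smooth_at (\<lambda>y. frechet_derivative f (at y) v) x"
proof -
  obtain T where T: "open T" "x \<in> T" "smooth_on T f" using assms smooth_at_def by blast
  have "Ck_on k T (\<lambda>y. frechet_derivative f (at y) v)" for k
    using T(3)[unfolded smooth_on_def, rule_format, of "Suc k"] by simp
  then show ?thesis using T smooth_at_def smooth_on_def by blast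
qed

lemma smooth_at_const [simp, intro]: "smooth_at (\<lambda>x. c) x"
  unfolding smooth_at_def smooth_on_def using Ck_on_const by blast

lemma smooth_at_bounded_linear: "bounded_linear L \<Longrightarrow> smooth_at L x"
  unfolding smooth_at_def smooth_on_def using Ck_on_bounded_linear by blast

lemma smooth_at_ident [simp, intro]: "smooth_at (\<lambda>x. x) x"
  by (rule smooth_at_bounded_linear[OF bounded_linear_ident])

lemma smooth_at_bounded_linear_compose:
  "bounded_linear L \<Longrightarrow> smooth_at f x \<Longrightarrow> smooth_at (\<lambda>x. L (f x)) x"
  unfolding smooth_at_def smooth_on_def using Ck_on_bounded_linear_compose[of L _ _ f] by blast

lemma smooth_at_bilinear:
  assumes "bounded_bilinear B" "smooth_at f x" "smooth_at g x"
  shows "smooth_at (\<lambda>x. B (f x) (g x)) x"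
proof -
  obtain S T where "open S" "x \<in> S" "smooth_on S f" "open T" "x \<in> T" "smooth_on T g"
    using assms unfolding smooth_at_def by blast
  then have "open (S \<inter> T)" "x \<in> S \<inter> T" "smooth_on (S \<inter> T) f" "smooth_on (S \<inter> T) g"
    using smooth_on_subset[of S f "S \<inter> T"] smooth_on_subset[of T g "S \<inter> T"] by auto
  then show ?thesis unfolding smooth_at_def smooth_on_def
    using Ck_on_bilinear[OF assms(1), of "S \<inter> T" _ f g] by blast
qed

lemmas smooth_at_scaleR = smooth_at_bilinear[OF bounded_bilinear_scaleR]

lemma smooth_at_add:
  assumes "smooth_at f x" "smooth_at g x"
  shows "smooth_at (\<lambda>x. f x + g x) x"
proof -
  obtain S T where "open S" "x \<in> S" "smooth_on S f" "open T" "x \<in> T" "smooth_on T g"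
    using assms unfolding smooth_at_def by blast
  then have "open (S \<inter> T)" "x \<in> S \<inter> T" "smooth_on (S \<inter> T) f" "smooth_on (S \<inter> T) g"
    using smooth_on_subset[of S f "S \<inter> T"] smooth_on_subset[of T g "S \<inter> T"] by auto
  then show ?thesis unfolding smooth_at_def smooth_on_def
    using Ck_on_add[of "S \<inter> T" _ f g] by blast
qed

lemma smooth_at_sum:
  "(\<And>i. i \<in> I \<Longrightarrow> smooth_at (f i) x) \<Longrightarrow> smooth_at (\<lambda>x. \<Sum>i\<in>I. f i x) x"
  by (induction I rule: infinite_finite_induct) (auto intro: smooth_at_add)

lemma smooth_at_diff:
  assumes "smooth_at f x" "smooth_at g x"
  shows "smooth_at (\<lambda>x. f x - g x) x"
  using smooth_at_add[OF assms(1) smooth_at_bounded_linear_compose[OF _ assms(2), of uminus]]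
  by (simp add: bounded_linear_minus)

lemma smooth_at_Pair:
  assumes "smooth_at f x" "smooth_at g x"
  shows "smooth_at (\<lambda>x. (f x, g x)) x"
  using smooth_at_add[OF smooth_at_bounded_linear_compose[OF _ assms(1), of "\<lambda>u. (u, 0)"]
      smooth_at_bounded_linear_compose[OF _ assms(2), of "\<lambda>u. (0, u)"]]
  by (simp add: bounded_linear_Pair)

lemma smooth_at_compose:
  fixes f :: "'a::real_normed_vector \<Rightarrow> 'b::real_normed_vector" and g :: "'b \<Rightarrow> 'c::real_normed_vector"
  assumes fd: "finite_dim TYPE('b)" and "smooth_at f x" "smooth_at g (f x)"
  shows "smooth_at (\<lambda>x. g (f x)) x"
proof -
  obtain S T where ST: "open S" "x \<in> S" "smooth_on S f" "open T" "f x \<in> T" "smooth_on T g"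
    using assms unfolding smooth_at_def by blast
  have "continuous_on S f" using ST(3) smooth_on_def Ck_on_imp_continuous_on by blast
  then have o: "open (S \<inter> f -` T)" using ST continuous_open_preimage by blast
  have sf: "smooth_on (S \<inter> f -` T) f" using ST(3) smooth_on_subset by blast
  have "Ck_on k (S \<inter> f -` T) (\<lambda>x. g (f x))" for k
    by (rule Ck_on_compose[OF fd o, of k f T g]) (use sf ST(6) smooth_on_def in auto)
  then have "smooth_on (S \<inter> f -` T) (\<lambda>x. g (f x))" using smooth_on_def by blast
  then show ?thesis unfolding smooth_at_def using o ST by (intro exI[of _ "S \<inter> f -` T"]) auto
qed

text \<open>Smoothness of a family of linear maps is only required for each fixed argument; on a
  finite-dimensional space this suffices also for smoothly varying arguments.\<close>

lemma smooth_at_family_apply: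
  fixes L :: "'x::real_normed_vector \<Rightarrow> 'a::real_normed_vector \<Rightarrow> 'b::real_normed_vector"
  assumes fd: "finite_dim TYPE('a)" and lin: "\<forall>\<^sub>F y in nhds x. linear (L y)"
    and L: "\<And>v. smooth_at (\<lambda>y. L y v) x" and w: "smooth_at w x"
  shows "smooth_at (\<lambda>y. L y (w y)) x"
proof -
  obtain b :: "'a set" and c where b: "finite b" "\<And>i. i \<in> b \<Longrightarrow> bounded_linear (c i)"
    "\<And>v. (\<Sum>i\<in>b. c i v *\<^sub>R i) = v"
    using finite_dim_coordinates[OF fd] by metis
  have "smooth_at (\<lambda>y. \<Sum>i\<in>b. c i (w y) *\<^sub>R L y i) x"
    by (intro smooth_at_sum smooth_at_scaleR L smooth_at_bounded_linear_compose[OF b(2)] w)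
  moreover have "\<forall>\<^sub>F y in nhds x. (\<Sum>i\<in>b. c i (w y) *\<^sub>R L y i) = L y (w y)"
    using lin
  proof eventually_elim
    case (elim y)
    show ?case using linear_sum[OF elim, of "\<lambda>i. c i (w y) *\<^sub>R i" b]
      by (simp add: b(3) linear_scale[OF elim])
  qed
  ultimately show ?thesis by (rule smooth_at_transform)
qed

subsection \<open>Families of linear maps\<close>

text \<open>It is enough to control the finitely many vectors of a basis.\<close>

lemma linear_family_uniformly_close:
  fixes L :: "'x::t2_space \<Rightarrow> 'a::real_normed_vector \<Rightarrow> 'b::real_normed_vector"
  assumes fd: "finite_dim TYPE('a)" and lin: "\<forall>\<^sub>F y in nhds x. linear (L y)"
    and cont: "\<And>v. isCont (\<lambda>y. L y v) x" and e: "e > 0"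
  shows "\<forall>\<^sub>F y in nhds x. \<forall>u. norm (L y u - L x u) \<le> e * norm u"
proof -
  obtain b :: "'a set" and c where b: "finite b" "\<And>i. i \<in> b \<Longrightarrow> bounded_linear (c i)"
    "\<And>v. (\<Sum>i\<in>b. c i v *\<^sub>R i) = v"
    using finite_dim_coordinates[OF fd] by metis
  define K where "K = 1 + (\<Sum>i\<in>b. onorm (c i))"
  have Kp: "K > 0" unfolding K_def using onorm_pos_le[OF b(2)]
    by (meson add_pos_nonneg sum_nonneg zero_less_one)
  have "\<forall>\<^sub>F y in nhds x. norm (L y i - L x i) < e / K" for i
  proof -
    have "((\<lambda>y. L y i) \<longlongrightarrow> L x i) (nhds x)"
      using cont[of i] tendsto_at_iff_tendsto_nhds[of "\<lambda>y. L y i" x] unfolding isCont_def by blast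
    from tendstoD[OF this, of "e / K"] show ?thesis using e Kp by (simp add: dist_norm)
  qed
  then have ev: "\<forall>\<^sub>F y in nhds x. \<forall>i\<in>b. norm (L y i - L x i) < e / K"
    by (intro eventually_ball_finite b(1)) auto
  have lx: "linear (L x)" using lin by (rule eventually_nhds_x_imp_x)
  from ev show ?thesis using lin
  proof eventually_elim
    case (elim y)
    show ?case
    proof
      fix u
      have ex: "L z u = (\<Sum>i\<in>b. c i u *\<^sub>R L z i)" if "linear (L z)" for z
        using linear_sum[OF that, of "\<lambda>i. c i u *\<^sub>R i" b] by (simp add: b(3) linear_scale[OF that])
      have df: "L y u - L x u = (\<Sum>i\<in>b. c i u *\<^sub>R (L y i - L x i))"
        by (simp add: ex[OF elim(2)] ex[OF lx] sum_subtractf scaleR_diff_right)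
      have "norm (L y u - L x u) \<le> (\<Sum>i\<in>b. norm (c i u *\<^sub>R (L y i - L x i)))"
        unfolding df by (rule norm_sum)
      also have "\<dots> \<le> (\<Sum>i\<in>b. onorm (c i) * norm u * (e / K))"
      proof (rule sum_mono)
        fix i assume i: "i \<in> b"
        show "norm (c i u *\<^sub>R (L y i - L x i)) \<le> onorm (c i) * norm u * (e / K)"
          unfolding norm_scaleR
          by (intro mult_mono) (use onorm[OF b(2)[OF i], of u] elim(1) i
              onorm_pos_le[OF b(2)[OF i]] in \<open>auto intro: less_imp_le\<close>)
      qed
      also have "\<dots> = (\<Sum>i\<in>b. onorm (c i)) / K * (e * norm u)"
        by (simp only: sum_distrib_right[symmetric]) simp
      also have "\<dots> \<le> 1 * (e * norm u)"
        by (intro mult_right_mono) (use Kp e in \<open>auto simp: K_def\<close>)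
      finally show "norm (L y u - L x u) \<le> e * norm u" by simp
    qed
  qed
qed

lemma finite_dim_linear_inv:
  fixes L :: "'a::real_normed_vector \<Rightarrow> 'a"
  assumes "linear L" "bij L" shows "linear (inv L)"
proof (rule linearI)
  have L: "L (inv L x) = x" "inv L (L x) = x" for x
    using assms(2) by (simp_all add: bij_is_surj bij_is_inj surj_f_inv_f)
  show "inv L (x + y) = inv L x + inv L y" for x y
    using L(2)[of "inv L x + inv L y"] by (simp add: linear_add[OF assms(1)] L(1))
  show "inv L (r *\<^sub>R x) = r *\<^sub>R inv L x" for r x
    using L(2)[of "r *\<^sub>R inv L x"] by (simp add: linear_scale[OF assms(1)] L(1))
qed

lemma linear_family_bounded_below:
  fixes L :: "'x::t2_space \<Rightarrow> 'a::real_normed_vector \<Rightarrow> 'a"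
  assumes fd: "finite_dim TYPE('a)" and lin: "\<forall>\<^sub>F y in nhds x. linear (L y)"
    and cont: "\<And>v. isCont (\<lambda>y. L y v) x" and bij: "bij (L x)"
  obtains C where "C > 0" "\<forall>\<^sub>F y in nhds x. \<forall>u. norm u \<le> C * norm (L y u)"
proof -
  have "linear (L x)" using lin by (rule eventually_nhds_x_imp_x)
  then have "bounded_linear (inv (L x))"
    using finite_dim_linear_bounded[OF fd finite_dim_linear_inv] bij by blast
  then obtain C where C: "C > 0" "\<And>v. norm (inv (L x) v) \<le> norm v * C"
    using bounded_linear.pos_bounded by blast
  have "\<forall>\<^sub>F y in nhds x. \<forall>u. norm (L y u - L x u) \<le> 1 / (2 * C) * norm u"
    using C by (intro linear_family_uniformly_close[OF fd lin cont]) simp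
  then have "\<forall>\<^sub>F y in nhds x. \<forall>u. norm u \<le> 2 * C * norm (L y u)"
  proof eventually_elim
    case (elim y)
    show ?case
    proof
      fix u
      have "norm u = norm (inv (L x) (L x u))" using bij by (simp add: bij_is_inj)
      also have "\<dots> \<le> norm (L x u) * C" by (rule C)
      also have "norm (L x u) \<le> norm (L y u) + 1 / (2 * C) * norm u"
        using elim[rule_format, of u] norm_triangle_ineq3[of "L x u" "L y u"]
        by (simp add: norm_minus_commute)
      finally have "norm u \<le> (norm (L y u) + 1 / (2 * C) * norm u) * C" using C by simp
      then show "norm u \<le> 2 * C * norm (L y u)" using C by (simp add: field_simps)
    qed
  qed
  then show ?thesis using that[of "2 * C"] C by simp
qed

lemma linear_family_eventually_bij:
  fixes L :: "'x::t2_space \<Rightarrow> 'a::real_normed_vector \<Rightarrow> 'a"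
  assumes fd: "finite_dim TYPE('a)" and lin: "\<forall>\<^sub>F y in nhds x. linear (L y)"
    and cont: "\<And>v. isCont (\<lambda>y. L y v) x" and bij: "bij (L x)"
  shows "\<forall>\<^sub>F y in nhds x. bij (L y)"
proof -
  obtain C where "C > 0" and C: "\<forall>\<^sub>F y in nhds x. \<forall>u. norm u \<le> C * norm (L y u)"
    using linear_family_bounded_below[OF assms] .
  show ?thesis using C lin
  proof eventually_elim
    case (elim y)
    then show ?case by (intro finite_dim_inj_bij[OF fd]) (metis mult_zero_right norm_le_zero_iff norm_zero)+
  qed
qed

text \<open>A product rule in which the second factor is only continuous, because the first one
  vanishes at the point.\<close>

lemma has_derivative_scaleR_vanishing:
  fixes f :: "'a::real_normed_vector \<Rightarrow> real" and g :: "'a \<Rightarrow> 'b::real_normed_vector"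
  assumes f: "(f has_derivative f') (at x)" and fx: "f x = 0" and g: "isCont g x"
  shows "((\<lambda>y. f y *\<^sub>R g y) has_derivative (\<lambda>h. f' h *\<^sub>R g x)) (at x)"
proof -
  have "bounded_linear f'" using f has_derivative_bounded_linear by blast
  then obtain C where C: "C > 0" "\<And>v. norm (f' v) \<le> norm v * C"
    using bounded_linear.pos_bounded by blast
  have q: "((\<lambda>y. norm (f y - f x - f' (y - x)) / norm (y - x)) \<longlongrightarrow> 0) (at x)"
    using f by (simp add: has_derivative_iff_norm)
  have gl: "((\<lambda>y. g y) \<longlongrightarrow> g x) (at x)" using g by (simp add: isCont_def)
  have 1: "((\<lambda>y. norm (f y - f x - f' (y - x)) / norm (y - x) * norm (g y) + C * norm (g y - g x))
      \<longlongrightarrow> 0 * norm (g x) + C * norm (g x - g x)) (at x)"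
    by (intro tendsto_intros q gl)
  have 2: "norm (f y *\<^sub>R g y - f x *\<^sub>R g x - f' (y - x) *\<^sub>R g x) / norm (y - x)
     \<le> norm (f y - f x - f' (y - x)) / norm (y - x) * norm (g y) + C * norm (g y - g x)"
    if "y \<noteq> x" for y
  proof -
    have eq: "f y *\<^sub>R g y - f x *\<^sub>R g x - f' (y - x) *\<^sub>R g x =
       (f y - f x - f' (y - x)) *\<^sub>R g y + f' (y - x) *\<^sub>R (g y - g x)"
      by (simp add: fx algebra_simps)
    have "norm (f y *\<^sub>R g y - f x *\<^sub>R g x - f' (y - x) *\<^sub>R g x) \<le>
       norm (f y - f x - f' (y - x)) * norm (g y) + norm (f' (y - x)) * norm (g y - g x)"
      unfolding eq by (rule order_trans[OF norm_triangle_ineq]) simp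
    also have "\<dots> \<le> norm (f y - f x - f' (y - x)) * norm (g y) + norm (y - x) * C * norm (g y - g x)"
      using C(2)[of "y - x"] by (intro add_left_mono mult_right_mono) auto
    finally show ?thesis using that by (simp add: field_simps)
  qed
  have 3: "((\<lambda>y. norm (f y *\<^sub>R g y - f x *\<^sub>R g x - f' (y - x) *\<^sub>R g x) / norm (y - x)) \<longlongrightarrow> 0) (at x)"
    by (rule Lim_null_comparison[OF _ 1[simplified]])
       (use 2 in \<open>auto simp: eventually_at_filter intro!: always_eventually\<close>)
  have "bounded_linear (\<lambda>h. f' h *\<^sub>R g x)"
    using f by (intro bounded_linear_scaleR_const has_derivative_bounded_linear)
  then show ?thesis using 3 by (simp add: has_derivative_iff_norm)
qed

text \<open>With \<open>w = (L x)\<inverse> v\<close> one has \<open>L y ((L y)\<inverse> v - w) = L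
  x w - L y w\<close>, and \<open>L y\<close> is bounded below uniformly near
  \<open>x\<close>.\<close>

lemma isCont_linear_inverse:
  fixes L :: "'x::t2_space \<Rightarrow> 'a::real_normed_vector \<Rightarrow> 'a"
  assumes fd: "finite_dim TYPE('a)" and lin: "\<forall>\<^sub>F y in nhds x. linear (L y)"
    and cont: "\<And>v. isCont (\<lambda>y. L y v) x" and bij: "bij (L x)"
  shows "isCont (\<lambda>y. inv (L y) v) x"
proof -
  obtain C where C0: "C > 0" and C: "\<forall>\<^sub>F y in nhds x. \<forall>u. norm u \<le> C * norm (L y u)"
    using linear_family_bounded_below[OF assms] .
  define w where "w = inv (L x) v"
  have wv: "L x w = v" unfolding w_def using bij by (simp add: bij_is_surj surj_f_inv_f)
  have ev: "\<forall>\<^sub>F y in nhds x. norm (inv (L y) v - w) \<le> C * norm (L x w - L y w)"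
    using C lin linear_family_eventually_bij[OF assms]
  proof eventually_elim
    case (elim y)
    have "L y (inv (L y) v - w) = L x w - L y w"
      using elim(2,3) wv by (simp add: linear_diff bij_is_surj surj_f_inv_f)
    then show ?case using elim(1) by metis
  qed
  have "((\<lambda>y. C * norm (L x w - L y w)) \<longlongrightarrow> C * norm (L x w - L x w)) (at x)"
    using cont[of w] by (intro tendsto_intros) (simp add: isCont_def)
  then have l: "((\<lambda>y. C * norm (L x w - L y w)) \<longlongrightarrow> 0) (at x)" by simp
  have "((\<lambda>y. inv (L y) v - w) \<longlongrightarrow> 0) (at x)"
    by (rule Lim_null_comparison[OF _ l])
       (use ev in \<open>simp add: eventually_nhds_conv_at\<close>)
  then show ?thesis unfolding isCont_def w_def using LIM_zero_iff by blast
qed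

text \<open>Differentiating \<open>L y (w y) = v\<close> gives \<open>Dw = - L\<inverse> (DL)
  w\<close>.  The right-hand side involves \<open>L\<inverse>\<close> undifferentiated, so one
  derivative is gained at each step of the induction.\<close>

lemma Ck_on_linear_inverse:
  fixes L :: "'x::real_normed_vector \<Rightarrow> 'a::real_normed_vector \<Rightarrow> 'a"
  assumes fd: "finite_dim TYPE('a)" and S: "open S"
    and lin: "\<And>y. y \<in> S \<Longrightarrow> linear (L y)" and bij: "\<And>y. y \<in> S \<Longrightarrow> bij (L y)"
    and "\<And>v. Ck_on k S (\<lambda>y. L y v)"
  shows "Ck_on k S (\<lambda>y. inv (L y) v)"
  using assms(5)
proof (induction k arbitrary: v)
  case (0 v)
  have "isCont (\<lambda>y. inv (L y) v) x" if x: "x \<in> S" for x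
  proof (rule isCont_linear_inverse[OF fd])
    show "bij (L x)" using bij[OF x] .
    show "\<forall>\<^sub>F y in nhds x. linear (L y)"
      using eventually_nhds_in_open[OF S x] by eventually_elim (rule lin)
    show "isCont (\<lambda>y. L y v) x" for v
      using 0[of v] S x by (simp add: continuous_on_eq_continuous_at)
  qed
  then show ?case by (simp add: continuous_at_imp_continuous_on)
next
  case (Suc k v)
  obtain b :: "'a set" and c where b: "finite b" "\<And>i. i \<in> b \<Longrightarrow> bounded_linear (c i)"
    "\<And>v. (\<Sum>i\<in>b. c i v *\<^sub>R i) = v"
    using finite_dim_coordinates[OF fd] by metis
  have Lk: "Ck_on k S (\<lambda>y. L y v)" for v using Suc.prems Ck_on_Suc_imp by blast
  have IH: "Ck_on k S (\<lambda>y. inv (L y) v)" for v using Suc.IH[OF Lk] .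
  define DL where "DL j y u = frechet_derivative (\<lambda>y. L y j) (at y) u" for j y u
  define D where "D y u =
    (\<Sum>i\<in>b. - c i (\<Sum>j\<in>b. c j (inv (L y) v) *\<^sub>R DL j y u) *\<^sub>R inv (L y) i)" for y u
  show ?case
  proof (rule Ck_on_SucI[OF S, of _ D])
    fix u
    have DLk: "Ck_on k S (\<lambda>y. DL j y u)" for j
      using Suc.prems[of j] unfolding DL_def by simp
    show "Ck_on k S (\<lambda>y. D y u)" unfolding D_def
    proof (intro Ck_on_sum[OF S] Ck_on_bilinear[OF bounded_bilinear_scaleR S] IH)
      fix i assume i: "i \<in> b"
      show "Ck_on k S (\<lambda>y. - c i (\<Sum>j\<in>b. c j (inv (L y) v) *\<^sub>R DL j y u))"
        by (intro Ck_on_bounded_linear_compose[OF bounded_linear_minus[OF bounded_linear_ident] S]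
            Ck_on_bounded_linear_compose[OF b(2)[OF i] S] Ck_on_sum[OF S]
            Ck_on_bilinear[OF bounded_bilinear_scaleR S] DLk
            Ck_on_bounded_linear_compose[OF b(2) S] IH)
    qed
  next
    fix x assume x: "x \<in> S"
    define w where "w = inv (L x) v"
    have wv: "L x w = v" unfolding w_def using bij[OF x] by (simp add: bij_is_surj surj_f_inv_f)
    have ex: "L y u = (\<Sum>j\<in>b. c j u *\<^sub>R L y j)" if "y \<in> S" for y u
      using linear_sum[OF lin[OF that], of "\<lambda>i. c i u *\<^sub>R i" b]
      by (simp add: b(3) linear_scale[OF lin[OF that]])
    have dL: "((\<lambda>y. L y j) has_derivative DL j x) (at x)" for j
      using Suc.prems[of j] x unfolding DL_def Ck_on.simps frechet_derivative_works by blast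
    have "((\<lambda>y. \<Sum>j\<in>b. c j w *\<^sub>R L y j) has_derivative (\<lambda>u. \<Sum>j\<in>b. c j w *\<^sub>R DL j x u)) (at x)"
      by (intro has_derivative_sum has_derivative_scaleR_right dL)
    then have "((\<lambda>y. (\<Sum>j\<in>b. c j w *\<^sub>R L y j) - v) has_derivative (\<lambda>u. (\<Sum>j\<in>b. c j w *\<^sub>R DL j x u) - 0)) (at x)"
      by (intro has_derivative_diff has_derivative_const)
    from has_derivative_transform_within_open[OF this S x, of "\<lambda>y. L y w - v"]
    have q: "((\<lambda>y. L y w - v) has_derivative (\<lambda>u. \<Sum>j\<in>b. c j w *\<^sub>R DL j x u)) (at x)"
      by (simp only: ex[of _ w, symmetric] diff_0_right)
    have IHc: "isCont (\<lambda>y. inv (L y) i) x" for i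
      using Ck_on_imp_continuous_on[OF IH] S x continuous_on_eq_continuous_at by blast
    have "((\<lambda>y. \<Sum>i\<in>b. - c i (L y w - v) *\<^sub>R inv (L y) i) has_derivative D x) (at x)"
      unfolding D_def w_def[symmetric]
    proof (intro has_derivative_sum has_derivative_scaleR_vanishing IHc)
      fix i assume i: "i \<in> b"
      show "((\<lambda>y. - c i (L y w - v)) has_derivative
          (\<lambda>u. - c i (\<Sum>j\<in>b. c j w *\<^sub>R DL j x u))) (at x)"
        by (intro has_derivative_minus bounded_linear.has_derivative[OF b(2)[OF i]] q)
      show "- c i (L x w - v) = 0" using bounded_linear.linear[OF b(2)[OF i]] wv linear_0 by simp
    qed
    from has_derivative_add[OF has_derivative_const this]
    have d: "((\<lambda>y. w + (\<Sum>i\<in>b. - c i (L y w - v) *\<^sub>R inv (L y) i)) has_derivative D x) (at x)"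
      by simp
    show "((\<lambda>y. inv (L y) v) has_derivative D x) (at x)"
    proof (rule has_derivative_transform_within_open[OF d S x])
      fix y assume y: "y \<in> S"
      have li: "linear (inv (L y))" using finite_dim_linear_inv lin bij y by blast
      have "(\<Sum>i\<in>b. - c i (L y w - v) *\<^sub>R inv (L y) i) = - inv (L y) (\<Sum>i\<in>b. c i (L y w - v) *\<^sub>R i)"
        by (simp add: linear_sum[OF li] linear_scale[OF li] sum_negf)
      also have "\<dots> = - (w - inv (L y) v)"
        by (simp add: b(3) linear_diff[OF li] bij_is_inj[OF bij[OF y]])
      finally show "w + (\<Sum>i\<in>b. - c i (L y w - v) *\<^sub>R inv (L y) i) = inv (L y) v" by simp
    qed
  qed
qed

lemma smooth_at_linear_inverse:
  fixes L :: "'x::real_normed_vector \<Rightarrow> 'a::real_normed_vector \<Rightarrow> 'a"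
  assumes fd: "finite_dim TYPE('a)" and lin: "\<forall>\<^sub>F y in nhds x. linear (L y)"
    and L: "\<And>v. smooth_at (\<lambda>y. L y v) x" and bij: "bij (L x)"
  shows "smooth_at (\<lambda>y. inv (L y) v) x"
proof -
  obtain b :: "'a set" and c where b: "finite b" "\<And>i. i \<in> b \<Longrightarrow> bounded_linear (c i)"
    "\<And>v. (\<Sum>i\<in>b. c i v *\<^sub>R i) = v"
    using finite_dim_coordinates[OF fd] by metis
  have "\<forall>\<^sub>F y in nhds x. \<forall>i\<in>b. smooth_at (\<lambda>y. L y i) y"
    by (intro eventually_ball_finite b(1) ballI smooth_at_eventually L)
  then have "\<forall>\<^sub>F y in nhds x. linear (L y) \<and> bij (L y) \<and> (\<forall>i\<in>b. smooth_at (\<lambda>y. L y i) y)"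
    using lin linear_family_eventually_bij[OF fd lin smooth_at_isCont[OF L] bij]
    by eventually_elim blast
  then obtain S where S: "open S" "x \<in> S"
    and SL: "\<And>y. y \<in> S \<Longrightarrow> linear (L y) \<and> bij (L y) \<and> (\<forall>i\<in>b. smooth_at (\<lambda>y. L y i) y)"
    unfolding eventually_nhds by blast
  have "smooth_on S (\<lambda>y. L y v)" for v
  proof (rule smooth_on_smooth_at)
    fix y assume y: "y \<in> S"
    have "smooth_at (\<lambda>y. \<Sum>i\<in>b. c i v *\<^sub>R L y i) y"
      using SL[OF y] by (intro smooth_at_sum smooth_at_scaleR smooth_at_const) blast
    moreover have "(\<Sum>i\<in>b. c i v *\<^sub>R L z i) = L z v" if "z \<in> S" for z
      using linear_sum[of "L z" "\<lambda>i. c i v *\<^sub>R i" b] SL[OF that] by (simp add: b(3) linear_scale)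
    ultimately show "smooth_at (\<lambda>y. L y v) y"
      using eventually_nhds_in_open[OF S(1) y] by (elim smooth_at_transform) (auto elim: eventually_mono)
  qed
  then have "smooth_on S (\<lambda>y. inv (L y) v)"
    using Ck_on_linear_inverse[OF fd S(1), of L] SL unfolding smooth_on_def by blast
  then show ?thesis using S smooth_at_def by blast
qed

subsection \<open>The inverse function theorem\<close>

text \<open>The contraction \<open>x \<mapsto> x - f x + y\<close> solves \<open>f x = y\<close>.
  Straightening maps and exponential coordinates are built so as to satisfy \<open>Df(x0) =
  id\<close>.  The inverse is smooth since \<open>Dg = (Df \<circ> g)\<inverse>\<close> expresses
  \<open>k + 1\<close> derivatives of \<open>g\<close> by \<open>k\<close>.\<close>

theorem smooth_local_inverse:
  fixes f :: "'a::real_normed_vector \<Rightarrow> 'a"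
  assumes fd: "finite_dim TYPE('a)" and S: "open S" "x0 \<in> S" and f: "smooth_on S f"
    and der: "frechet_derivative f (at x0) = (\<lambda>v. v)"
  obtains V g where "open V" "x0 \<in> V" "V \<subseteq> S" "open (f ` V)" "homeomorphism V (f ` V) f g"
    "smooth_on (f ` V) g" "\<And>x. x \<in> V \<Longrightarrow> bij (frechet_derivative f (at x))"
proof -
  define L where "L x = frechet_derivative f (at x)" for x
  have sm: "smooth_at f x" if "x \<in> S" for x using f S(1) that smooth_at_smooth_on by blast
  have lin: "linear (L x)" if "x \<in> S" for x
    unfolding L_def using sm[OF that] smooth_at_linear_derivative by blast
  have evlin: "\<forall>\<^sub>F y in nhds x. linear (L y)" if "x \<in> S" for x
    using eventually_nhds_in_open[OF S(1) that] by eventually_elim (rule lin)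
  have smL: "smooth_at (\<lambda>y. L y v) x" if "x \<in> S" for x v
    unfolding L_def using smooth_at_frechet_derivative[OF sm[OF that]] .
  have dL: "(f has_derivative L x) (at x)" if "x \<in> S" for x
    unfolding L_def using smooth_at_has_derivative[OF sm[OF that]] .
  have "\<forall>\<^sub>F y in nhds x0. \<forall>u. norm (L y u - L x0 u) \<le> 1/2 * norm u"
    by (intro linear_family_uniformly_close[OF fd evlin smooth_at_isCont[OF smL]] S) simp
  then have "\<forall>\<^sub>F y in nhds x0. y \<in> S \<and> (\<forall>u. norm (L y u - u) \<le> 1/2 * norm u)"
    using eventually_nhds_in_open[OF S] by eventually_elim (simp add: L_def der)
  then obtain r0 where r0: "r0 > 0" "\<And>y. dist y x0 < r0 \<Longrightarrow> y \<in> S \<and> (\<forall>u. norm (L y u - u) \<le> 1/2 * norm u)"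
    unfolding eventually_nhds_metric by blast
  define r where "r = r0 / 2"
  have r: "r > 0" using r0 by (simp add: r_def)
  have rS: "y \<in> S" and rL: "norm (L y u - u) \<le> 1/2 * norm u" if "y \<in> cball x0 r" for y u
    using r0(2)[of y] that r0(1) by (auto simp: r_def dist_commute)
  have low: "norm u \<le> 2 * norm (L y u)" if "y \<in> cball x0 r" for y u
    using rL[OF that, of u] norm_triangle_ineq2[of u "L y u"] by (simp add: norm_minus_commute)
  have bijL: "bij (L y)" if "y \<in> cball x0 r" for y
    using low[OF that] by (intro finite_dim_inj_bij[OF fd lin[OF rS[OF that]]])
      (metis mult_zero_right norm_le_zero_iff norm_zero)
  have lip: "norm ((f x - x) - (f y - y)) \<le> 1/2 * norm (x - y)"
    if "x \<in> cball x0 r" "y \<in> cball x0 r" for x y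
  proof (rule differentiable_bound[OF convex_cball _ _ that(1) that(2)])
    fix z assume z: "z \<in> cball x0 r"
    show "((\<lambda>x. f x - x) has_derivative (\<lambda>u. L z u - u)) (at z within cball x0 r)"
      by (intro has_derivative_diff has_derivative_ident has_derivative_at_withinI[OF dL[OF rS[OF z]]])
    show "onorm (\<lambda>u. L z u - u) \<le> 1/2" by (rule onorm_bound) (use rL[OF z] in auto)
  qed
  have low2: "norm (x - y) \<le> 2 * norm (f x - f y)" if "x \<in> cball x0 r" "y \<in> cball x0 r" for x y
    using lip[OF that] norm_triangle_ineq2[of "x - y" "f x - f y"]
    by (simp add: norm_minus_commute algebra_simps)
  define V where "V = ball x0 r \<inter> f -` ball (f x0) (r/2)"
  have VC: "V \<subseteq> cball x0 r" unfolding V_def by auto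
  have fcont: "continuous_on (ball x0 r) f"
    by (intro continuous_at_imp_continuous_on ballI smooth_at_isCont sm rS) auto
  have oV: "open V" unfolding V_def
    by (rule continuous_open_preimage[OF fcont]) auto
  have surj: "y \<in> f ` V" if y: "y \<in> ball (f x0) (r/2)" for y
  proof -
    have T: "norm (x - f x + y - x0) < r" if "x \<in> cball x0 r" for x
    proof -
      have "norm (x - f x + y - x0) \<le> norm ((f x - x) - (f x0 - x0)) + norm (y - f x0)"
        using norm_triangle_ineq4[of "y - f x0" "(f x - x) - (f x0 - x0)"] by (simp add: algebra_simps)
      also have "\<dots> < 1/2 * norm (x - x0) + r/2"
        using lip[OF that, of x0] y r by (simp add: dist_norm norm_minus_commute)
      also have "\<dots> \<le> r" using that by (simp add: dist_norm norm_minus_commute)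
      finally show ?thesis .
    qed
    have "\<exists>!x. x \<in> cball x0 r \<and> x - f x + y = x"
    proof (rule Banach_fix[of "cball x0 r" "1/2" "\<lambda>x. x - f x + y"])
      show "complete (cball x0 r)"
        by (rule complete_closed_subset[OF closed_cball subset_UNIV finite_dim_complete[OF fd]])
      show "(\<lambda>x. x - f x + y) ` cball x0 r \<subseteq> cball x0 r"
        using T by (force simp: dist_norm norm_minus_commute less_imp_le)
      show "dist (x - f x + y) (z - f z + y) \<le> 1/2 * dist x z" if "x \<in> cball x0 r" "z \<in> cball x0 r" for x z
        using lip[OF that] by (simp add: dist_norm norm_minus_commute algebra_simps)
    qed (use r in auto)
    then obtain x where x: "x \<in> cball x0 r" "x - f x + y = x" by blast
    then have "f x = y" by (metis add_diff_cancel_left' diff_add_eq diff_diff_eq2 add.commute)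
    moreover have "x \<in> ball x0 r" using T[OF x(1)] x(2) by (simp add: dist_norm norm_minus_commute)
    ultimately show ?thesis using y unfolding V_def by blast
  qed
  then have fV: "f ` V = ball (f x0) (r/2)" unfolding V_def by auto
  have inj: "inj_on f V"
    using low2 VC by (intro inj_onI) (metis diff_self mult_zero_right norm_le_zero_iff norm_zero
        right_minus_eq subsetD)
  define g where "g = inv_into V f"
  have gV: "g y \<in> V" and fg: "f (g y) = y" if "y \<in> f ` V" for y
    using that unfolding g_def by (auto intro: inv_into_into f_inv_into_f)
  have gf: "g (f x) = x" if "x \<in> V" for x unfolding g_def using inj that by simp
  have glip: "norm (g x - g y) \<le> 2 * norm (x - y)" if "x \<in> f ` V" "y \<in> f ` V" for x y
    using low2[of "g x" "g y"] gV fg VC that by (metis subsetD)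
  have gcont: "continuous_on (f ` V) g"
    unfolding continuous_on_iff
  proof (intro ballI allI impI)
    fix x and e :: real assume "x \<in> f ` V" "e > 0"
    then show "\<exists>d>0. \<forall>y\<in>f ` V. dist y x < d \<longrightarrow> dist (g y) (g x) < e"
      using glip by (intro exI[of _ "e/2"]) (fastforce simp: dist_norm)
  qed
  have oW: "open (f ` V)" by (simp add: fV)
  have hom: "homeomorphism V (f ` V) f g"
    unfolding homeomorphism_def using gcont fcont gV gf fg V_def
    by (auto intro: continuous_on_subset simp: image_iff)
  have dg: "(g has_derivative inv (L (g y))) (at y)" if y: "y \<in> f ` V" for y
  proof (rule has_derivative_inverse_basic[OF dL _ _ _ oW y fg])
    have gc: "g y \<in> cball x0 r" using gV[OF y] VC by blast
    show "g y \<in> S" using rS[OF gc] .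
    show "bounded_linear (inv (L (g y)))"
      by (intro finite_dim_linear_bounded[OF fd] finite_dim_linear_inv lin rS bijL gc)
    show "inv (L (g y)) \<circ> L (g y) = id" using bijL[OF gc] by (simp add: bij_is_inj)
    show "isCont g y" using gcont oW y continuous_on_eq_continuous_at by blast
  qed
  have "Ck_on k (f ` V) g" for k
  proof (induction k)
    case 0
    then show ?case using gcont by simp
  next
    case (Suc k)
    show ?case
    proof (rule Ck_on_SucI[OF oW dg])
      fix v
      have "Ck_on k V (\<lambda>x. inv (L x) v)"
        using VC rS bijL lin smL
        by (intro Ck_on_linear_inverse[OF fd oV])
           (auto intro!: smooth_on_smooth_at[unfolded smooth_on_def, rule_format])
      then show "Ck_on k (f ` V) (\<lambda>y. inv (L (g y)) v)"
        using gV by (intro Ck_on_compose[OF fd oW Suc]) auto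
    qed
  qed
  then have sg: "smooth_on (f ` V) g" using smooth_on_def by blast
  show ?thesis
  proof (rule that[OF oV _ _ oW hom sg])
    show "x0 \<in> V" using r by (simp add: V_def)
    show "V \<subseteq> S" using VC rS by blast
    show "bij (frechet_derivative f (at x))" if "x \<in> V" for x
      using bijL VC that L_def by (metis subsetD)
  qed
qed

section \<open>Charts\<close>

lemma subspace_projection:
  fixes V :: "'a::real_normed_vector set"
  assumes fd: "finite_dim TYPE('a)" and V: "subspace V"
  obtains P where "bounded_linear P" "range P \<subseteq> V" "\<And>v. P v = v \<longleftrightarrow> v \<in> V"
proof -
  obtain P :: "'a \<Rightarrow> 'a" where P: "P ` UNIV \<subseteq> V" "linear P" "\<forall>v\<in>V. P v = v"
    using linear_exists_left_inverse_on[OF linear_ident V] by (auto simp: inj_on_def)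
  show ?thesis
  proof (rule that[of P])
    show "bounded_linear P" by (rule finite_dim_linear_bounded[OF fd P(2)])
    show "P v = v \<longleftrightarrow> v \<in> V" for v using P by (metis rangeI subsetD)
  qed (use P in auto)
qed

text \<open>Apply a projection \<open>P\<close> onto \<open>W\<close>: the curve satisfies \<open>P
  \<circ> c = c\<close>, hence so does its velocity.\<close>

lemma vector_derivative_in_subspace:
  fixes W :: "'a::real_normed_vector set"
  assumes fd: "finite_dim TYPE('a)" and W: "subspace W"
    and c: "(c has_vector_derivative v) (at t)" and ev: "\<forall>\<^sub>F s in nhds t. c s \<in> W"
  shows "v \<in> W"
proof -
  obtain P where P: "bounded_linear P" "\<And>v. P v = v \<longleftrightarrow> v \<in> W"
    using subspace_projection[OF fd W] by metis
  have "((\<lambda>s. P (c s)) has_vector_derivative P v) (at t)"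
    by (rule bounded_linear.has_vector_derivative[OF P(1) c])
  moreover obtain U where U: "open U" "t \<in> U" "\<And>s. s \<in> U \<Longrightarrow> c s \<in> W"
    using ev unfolding eventually_nhds by blast
  ultimately have "(c has_vector_derivative P v) (at t)"
    using P(2) by (elim has_vector_derivative_transform_within_open) auto
  then have "P v = v" using c vector_derivative_unique_at by blast
  then show ?thesis using P(2) by blast
qed

lemma smooth_manifold_finite_dim:
  fixes A :: "('m::{t2_space, second_countable_topology}, 'e::real_normed_vector) chart set"
  shows "smooth_manifold A \<Longrightarrow> finite_dim TYPE('e)"
  unfolding smooth_manifold_def finite_dim_def by blast

lemma chart_inv_left: "is_chart c \<Longrightarrow> p \<in> fst c \<Longrightarrow> chart_inv c (snd c p) = p"
  unfolding is_chart_def homeomorphism_def by blast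

lemma chart_inv_right: "is_chart c \<Longrightarrow> x \<in> snd c ` fst c \<Longrightarrow> snd c (chart_inv c x) = x"
  unfolding is_chart_def homeomorphism_def by blast

lemma chart_inv_in: "is_chart c \<Longrightarrow> x \<in> snd c ` fst c \<Longrightarrow> chart_inv c x \<in> fst c"
  unfolding is_chart_def homeomorphism_def by blast

lemma chart_open: "is_chart c \<Longrightarrow> open (fst c)"
  unfolding is_chart_def by blast

lemma chart_open_image: "is_chart c \<Longrightarrow> open (snd c ` fst c)"
  unfolding is_chart_def by blast

lemma isCont_chart: "is_chart c \<Longrightarrow> p \<in> fst c \<Longrightarrow> isCont (snd c) p"
  unfolding is_chart_def homeomorphism_def using continuous_on_eq_continuous_at by blast

lemma isCont_chart_inv: "is_chart c \<Longrightarrow> x \<in> snd c ` fst c \<Longrightarrow> isCont (chart_inv c) x"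
  unfolding is_chart_def homeomorphism_def using continuous_on_eq_continuous_at by blast

lemma isCont_eventually_in:
  "isCont f x \<Longrightarrow> open N \<Longrightarrow> f x \<in> N \<Longrightarrow> \<forall>\<^sub>F y in nhds x. f y \<in> N"
  unfolding isCont_def tendsto_at_iff_tendsto_nhds[of f x] by (rule topological_tendstoD)

lemma isCont_eventually_compose:
  assumes "isCont f x" "\<forall>\<^sub>F z in nhds (f x). P z"
  shows "\<forall>\<^sub>F y in nhds x. P (f y)"
proof -
  obtain N where N: "open N" "f x \<in> N" "\<forall>z\<in>N. P z" using assms(2) unfolding eventually_nhds by blast
  show ?thesis using isCont_eventually_in[OF assms(1) N(1,2)] by eventually_elim (use N in blast)
qed

lemma eventually_chart_image:
  assumes "is_chart c" "p \<in> fst c" shows "\<forall>\<^sub>F x in nhds (snd c p). x \<in> snd c ` fst c"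
  using eventually_nhds_in_open[OF chart_open_image[OF assms(1)]] assms(2) by blast

lemma eventually_chart_inv_in:
  assumes "is_chart c" "p \<in> fst c" "open N" "p \<in> N"
  shows "\<forall>\<^sub>F x in nhds (snd c p). chart_inv c x \<in> N"
  using assms by (intro isCont_eventually_in isCont_chart_inv) (auto simp: chart_inv_left)

lemma eventually_in_charts:
  assumes "is_chart c" "p \<in> fst c" "\<forall>\<^sub>F q in nhds p. P q"
  shows "\<forall>\<^sub>F x in nhds (snd c p). P (chart_inv c x)"
  using assms by (intro isCont_eventually_compose[OF isCont_chart_inv]) (auto simp: chart_inv_left)

lemma open_chart_inv_image:
  assumes c: "is_chart c" and V: "open V" "V \<subseteq> snd c ` fst c"
  shows "open (chart_inv c ` V)"
proof -
  have "chart_inv c ` V = fst c \<inter> snd c -` V"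
    using V(2) c by (auto simp: chart_inv_left chart_inv_right chart_inv_in intro!: chart_inv_in)
      (metis chart_inv_left imageI)
  moreover have "continuous_on (fst c) (snd c)"
    using c unfolding is_chart_def homeomorphism_def by blast
  ultimately show ?thesis using continuous_open_preimage[OF _ chart_open[OF c] V(1)] by simp
qed

lemma chart_inv_eqI:
  assumes "\<And>p. p \<in> U \<Longrightarrow> g (f p) = p" "x \<in> f ` U"
  shows "chart_inv (U, f) x = g x"
proof -
  obtain p where p: "p \<in> U" "x = f p" using assms(2) by blast
  have "inj_on f U" by (rule inj_on_inverseI[of _ g]) (rule assms(1))
  then show ?thesis using p assms(1) by (simp add: chart_inv_def)
qed

lemma in_charts_apply: "in_charts c d f x = snd d (f (chart_inv c x))"
  by (simp add: in_charts_def)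

text \<open>The coordinate expressions of \<open>f\<close> and \<open>g\<close> can be composed only
  where \<open>f\<close> stays in the intermediate chart; continuity provides a
  neighbourhood.\<close>

lemma in_charts_compose:
  assumes c: "is_chart c" and d: "is_chart d" and p: "p \<in> fst c" "f p \<in> fst d" and f: "isCont f p"
  shows "\<forall>\<^sub>F x in nhds (snd c p). in_charts d e g (in_charts c d f x) = in_charts c e (\<lambda>q. g (f q)) x"
proof -
  have "\<forall>\<^sub>F q in nhds p. f q \<in> fst d" by (rule isCont_eventually_in[OF f chart_open[OF d] p(2)])
  then have "\<forall>\<^sub>F x in nhds (snd c p). f (chart_inv c x) \<in> fst d"
    by (rule eventually_in_charts[OF c p(1)])
  then show ?thesis by eventually_elim (simp add: in_charts_apply chart_inv_left[OF d])
qed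

lemma smooth_in_charts_compose:
  fixes d :: "('n::t2_space, 'f::real_normed_vector) chart"
  assumes fd: "finite_dim TYPE('f)" and c: "is_chart c" and d: "is_chart d"
    and p: "p \<in> fst c" "f p \<in> fst d" and f: "isCont f p"
    and s: "smooth_at (in_charts c d f) (snd c p)" "smooth_at (in_charts d e g) (snd d (f p))"
  shows "smooth_at (in_charts c e (\<lambda>q. g (f q))) (snd c p)"
proof (rule smooth_at_transform[OF _ in_charts_compose[OF c d p f]])
  have "in_charts c d f (snd c p) = snd d (f p)" by (simp add: in_charts_apply chart_inv_left[OF c p(1)])
  then show "smooth_at (\<lambda>x. in_charts d e g (in_charts c d f x)) (snd c p)"
    by (intro smooth_at_compose[OF fd s(1)]) (simp add: s(2))
qed

lemma smooth_manifold_is_chart: "smooth_manifold A \<Longrightarrow> c \<in> A \<Longrightarrow> is_chart c"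
  unfolding smooth_manifold_def by blast

lemma maximal_atlas_is_chart: "c \<in> maximal_atlas A \<Longrightarrow> is_chart c"
  unfolding maximal_atlas_def by blast

lemma atlas_subset_maximal: "smooth_manifold A \<Longrightarrow> c \<in> A \<Longrightarrow> c \<in> maximal_atlas A"
  unfolding maximal_atlas_def smooth_manifold_def by blast

lemma atlas_chart_exists:
  assumes "smooth_manifold A" obtains c where "c \<in> A" "p \<in> fst c"
  using assms unfolding smooth_manifold_def by blast

lemma chart_open_overlap:
  assumes "is_chart c" "open N" shows "open (snd c ` (fst c \<inter> N))"
proof -
  have "openin (top_of_set (snd c ` fst c)) (snd c ` (fst c \<inter> N))"
    using assms unfolding is_chart_def
    by (intro homeomorphism_imp_open_map[of "fst c" "snd c ` fst c" "snd c" "chart_inv c"])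
       (auto simp: openin_open)
  then show ?thesis using chart_open_image[OF assms(1)] openin_open_eq by blast
qed

lemma smooth_transition_atlas:
  assumes "c \<in> maximal_atlas A" "d \<in> A" "smooth_manifold A" "p \<in> fst c" "p \<in> fst d"
  shows "smooth_at (in_charts c d id) (snd c p)" "smooth_at (in_charts d c id) (snd d p)"
proof -
  have c: "is_chart c" and d: "is_chart d"
    using assms maximal_atlas_is_chart smooth_manifold_is_chart by blast+
  have s: "smooth_on (snd c ` (fst c \<inter> fst d)) (in_charts c d id)"
      "smooth_on (snd d ` (fst c \<inter> fst d)) (in_charts d c id)"
    using assms unfolding maximal_atlas_def compatible_def by blast+
  show "smooth_at (in_charts c d id) (snd c p)"
    by (rule smooth_at_smooth_on[OF s(1) chart_open_overlap[OF c chart_open[OF d]]]) (use assms in blast)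
  have o: "open (snd d ` (fst c \<inter> fst d))"
    using chart_open_overlap[OF d chart_open[OF c]] by (simp add: Int_commute)
  show "smooth_at (in_charts d c id) (snd d p)"
    by (rule smooth_at_smooth_on[OF s(2) o]) (use assms in blast)
qed

lemma smooth_transition:
  fixes A :: "('m::{t2_space, second_countable_topology}, 'e::real_normed_vector) chart set"
  assumes A: "smooth_manifold A" and "c \<in> maximal_atlas A" "d \<in> maximal_atlas A" "p \<in> fst c" "p \<in> fst d"
  shows "smooth_at (in_charts c d id) (snd c p)"
proof -
  obtain e where e: "e \<in> A" "p \<in> fst e" using atlas_chart_exists[OF A] .
  have 1: "smooth_at (in_charts c e id) (snd c p)"
    by (rule smooth_transition_atlas(1)[OF assms(2) e(1) A assms(4) e(2)])
  have 2: "smooth_at (in_charts e d id) (snd e (id p))"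
    using smooth_transition_atlas(2)[OF assms(3) e(1) A assms(5) e(2)] by simp
  have "smooth_at (in_charts c d (\<lambda>q. id (id q))) (snd c p)"
    by (rule smooth_in_charts_compose[OF smooth_manifold_finite_dim[OF A] maximal_atlas_is_chart[OF assms(2)]
          smooth_manifold_is_chart[OF A e(1)] assms(4) _ _ 1 2]) (simp_all add: e(2))
  then show ?thesis by (simp add: id_def)
qed

lemma smooth_map_isCont:
  assumes "smooth_map A B f" shows "isCont f p"
  using assms continuous_on_eq_continuous_at[of UNIV f] unfolding smooth_map_def by auto

lemma smooth_map_in_atlas:
  assumes f: "smooth_map A B f" and c: "c \<in> A" "is_chart c" and d: "d \<in> B" "is_chart d"
    and p: "p \<in> fst c" "f p \<in> fst d"
  shows "smooth_at (in_charts c d f) (snd c p)"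
proof (rule smooth_at_smooth_on)
  show "smooth_on (snd c ` (fst c \<inter> f -` fst d)) (in_charts c d f)"
    using f c d unfolding smooth_map_def by blast
  have "open (f -` fst d)"
    using f chart_open[OF d(2)] open_vimage unfolding smooth_map_def by blast
  then show "open (snd c ` (fst c \<inter> f -` fst d))" using chart_open_overlap c(2) by blast
qed (use p in blast)

lemma smooth_map_in_charts:
  fixes A :: "('m::{t2_space, second_countable_topology}, 'e::real_normed_vector) chart set"
    and B :: "('n::{t2_space, second_countable_topology}, 'f::real_normed_vector) chart set"
  assumes A: "smooth_manifold A" and B: "smooth_manifold B" and f: "smooth_map A B f"
    and c: "c \<in> maximal_atlas A" and d: "d \<in> maximal_atlas B"
    and p: "p \<in> fst c" "f p \<in> fst d"
  shows "smooth_at (in_charts c d f) (snd c p)"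
proof -
  obtain c' where c': "c' \<in> A" "p \<in> fst c'" using atlas_chart_exists[OF A] .
  obtain d' where d': "d' \<in> B" "f p \<in> fst d'" using atlas_chart_exists[OF B] .
  note ch = maximal_atlas_is_chart[OF c] maximal_atlas_is_chart[OF d]
    smooth_manifold_is_chart[OF A c'(1)] smooth_manifold_is_chart[OF B d'(1)]
  have 1: "smooth_at (in_charts c' d' f) (snd c' p)"
    by (rule smooth_map_in_atlas[OF f c'(1) ch(3) d'(1) ch(4) c'(2) d'(2)])
  have 2: "smooth_at (in_charts c' d (\<lambda>q. id (f q))) (snd c' p)"
    by (rule smooth_in_charts_compose[OF smooth_manifold_finite_dim[OF B] ch(3) ch(4) c'(2) d'(2)
          smooth_map_isCont[OF f] 1 smooth_transition_atlas(2)[OF d d'(1) B p(2) d'(2)]])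
  have "smooth_at (in_charts c d (\<lambda>q. f (id q))) (snd c p)"
    by (rule smooth_in_charts_compose[OF smooth_manifold_finite_dim[OF A] ch(1) ch(3) p(1), of id])
       (use c' 2 smooth_transition_atlas(1)[OF c c'(1) A p(1) c'(2)] in \<open>auto simp: id_def\<close>)
  then show ?thesis by simp
qed

subsection \<open>Charts of vector spaces and of products\<close>

lemma is_chart_vs: "is_chart (UNIV, id)"
  unfolding is_chart_def chart_inv_def by (simp add: homeomorphism_def inv_id[unfolded id_def] id_def)

lemma chart_inv_vs [simp]: "chart_inv (UNIV, id) = id"
  by (simp add: chart_inv_def inv_id)

lemma chart_at_vs [simp]: "chart_at vs_atlas p = (UNIV, id)"
  unfolding chart_at_def vs_atlas_def by (rule some_equality) auto

lemma smooth_map_to_vs: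
  fixes A :: "('m::{t2_space, second_countable_topology}, 'e::real_normed_vector) chart set"
  assumes A: "smooth_manifold A" and f: "smooth_map A vs_atlas f"
    and c: "c \<in> maximal_atlas A" and p: "p \<in> fst c"
  shows "smooth_at (\<lambda>x. f (chart_inv c x)) (snd c p)"
proof -
  obtain c' where c': "c' \<in> A" "p \<in> fst c'" using atlas_chart_exists[OF A] .
  note ch = maximal_atlas_is_chart[OF c] smooth_manifold_is_chart[OF A c'(1)]
  have 1: "smooth_at (in_charts c' (UNIV, id) f) (snd c' p)"
    by (rule smooth_map_in_atlas[OF f c'(1) ch(2) _ is_chart_vs c'(2)]) (auto simp: vs_atlas_def)
  have "smooth_at (in_charts c (UNIV, id) (\<lambda>q. f (id q))) (snd c p)"
    by (rule smooth_in_charts_compose[OF smooth_manifold_finite_dim[OF A] ch(1) ch(2) p, of id])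
       (use c' 1 smooth_transition_atlas(1)[OF c c'(1) A p c'(2)] in \<open>auto simp: id_def\<close>)
  then show ?thesis by (simp add: in_charts_def comp_def)
qed

text \<open>A map on a product is smooth in product charts, whose inverses are computed
  componentwise.  The box \<open>T\<close> is an open part of the domain of the coordinate
  expression.\<close>

lemma smooth_map_from_prod:
  assumes f: "smooth_map (prod_atlas B A) C f" and b: "b \<in> B" "is_chart b" and a: "a \<in> A" "is_chart a"
    and c: "c \<in> C" "is_chart c" and p: "p \<in> fst b" "q \<in> fst a" "f (p, q) \<in> fst c"
  shows "smooth_at (\<lambda>(x, y). snd c (f (chart_inv b x, chart_inv a y))) (snd b p, snd a q)"
proof -
  let ?e = "(fst b \<times> fst a, \<lambda>(x, y). (snd b x, snd a y))"
  have e: "?e \<in> prod_atlas B A" unfolding prod_atlas_def using a b by blast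
  have inv: "chart_inv ?e (x, y) = (chart_inv b x, chart_inv a y)"
    if "x \<in> snd b ` fst b" "y \<in> snd a ` fst a" for x y
  proof -
    have "(x, y) = (\<lambda>(x, y). (snd b x, snd a y)) (chart_inv b x, chart_inv a y)"
      using that chart_inv_right[OF a(2)] chart_inv_right[OF b(2)] by simp
    then have im: "(x, y) \<in> (\<lambda>(x, y). (snd b x, snd a y)) ` (fst b \<times> fst a)"
      using that chart_inv_in[OF a(2)] chart_inv_in[OF b(2)] by blast
    have "chart_inv ?e (x, y) = (\<lambda>(x, y). (chart_inv b x, chart_inv a y)) (x, y)"
      by (rule chart_inv_eqI[OF _ im]) (auto simp: chart_inv_left[OF a(2)] chart_inv_left[OF b(2)])
    then show ?thesis by simp
  qed
  have "open (f -` fst c)"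
    using f chart_open[OF c(2)] open_vimage unfolding smooth_map_def by blast
  moreover have "(p, q) \<in> f -` fst c" using p by simp
  ultimately obtain M N where MN: "open M" "open N" "p \<in> M" "q \<in> N" "M \<times> N \<subseteq> f -` fst c"
    by (metis open_prod_elim mem_Times_iff fst_conv snd_conv)
  define T where "T = snd b ` (fst b \<inter> M) \<times> snd a ` (fst a \<inter> N)"
  have T: "open T" unfolding T_def
    using chart_open_overlap[OF b(2) MN(1)] chart_open_overlap[OF a(2) MN(2)] open_Times by blast
  have pT: "(snd b p, snd a q) \<in> T" unfolding T_def using p MN by blast
  have "smooth_on (snd ?e ` (fst ?e \<inter> f -` fst c)) (in_charts ?e c f)"
    using f e c unfolding smooth_map_def by blast
  moreover have "T \<subseteq> snd ?e ` (fst ?e \<inter> f -` fst c)"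
  proof
    fix z assume "z \<in> T"
    then obtain u v where uv: "u \<in> fst b" "u \<in> M" "v \<in> fst a" "v \<in> N" "z = (snd b u, snd a v)"
      unfolding T_def by auto
    then have "(u, v) \<in> fst ?e \<inter> f -` fst c" using MN(5) by auto
    moreover have "z = snd ?e (u, v)" using uv(5) by simp
    ultimately show "z \<in> snd ?e ` (fst ?e \<inter> f -` fst c)" by blast
  qed
  ultimately have "smooth_on T (in_charts ?e c f)" using smooth_on_subset by blast
  then have "smooth_at (in_charts ?e c f) (snd b p, snd a q)"
    using smooth_at_smooth_on T pT by blast
  then show ?thesis
  proof (rule smooth_at_transform)
    show "\<forall>\<^sub>F y in nhds (snd b p, snd a q). in_charts ?e c f y =
       (case y of (x, y) \<Rightarrow> snd c (f (chart_inv b x, chart_inv a y)))"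
      using eventually_nhds_in_open[OF T pT]
      by eventually_elim (auto simp: T_def in_charts_apply inv)
  qed
qed

subsection \<open>New charts\<close>

lemma is_chartI:
  assumes "open U" "open (f ` U)" "continuous_on U f" "continuous_on (f ` U) g"
    and "\<And>p. p \<in> U \<Longrightarrow> g (f p) = p"
  shows "is_chart (U, f)"
proof -
  have inv: "chart_inv (U, f) x = g x" if "x \<in> f ` U" for x
    by (rule chart_inv_eqI[OF assms(5) that])
  have "continuous_on (f ` U) (chart_inv (U, f))"
    by (rule continuous_on_eq[OF assms(4)]) (simp add: inv)
  moreover have "chart_inv (U, f) ` (f ` U) = U"
    using inv assms(5) by (force simp: image_image)
  ultimately show ?thesis unfolding is_chart_def homeomorphism_def
    using assms(1-3,5) inv by auto
qed

text \<open>Exponential coordinates and straightened submanifolds are obtained from existing charts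
  in this way.  Compatibility follows by composing the transition maps with \<open>\<Phi>\<close>
  and \<open>g\<close>.\<close>

lemma chart_change_coordinates:
  fixes A :: "('m::{t2_space, second_countable_topology}, 'e::real_normed_vector) chart set"
  assumes A: "smooth_manifold A" and c: "c \<in> maximal_atlas A" and V: "open V" "V \<subseteq> snd c ` fst c"
    and W: "open (\<Phi> ` V)" and hom: "homeomorphism V (\<Phi> ` V) \<Phi> g"
    and sm: "smooth_on V \<Phi>" "smooth_on (\<Phi> ` V) g"
  defines "c' \<equiv> (chart_inv c ` V, \<lambda>p. \<Phi> (snd c p))"
  shows "c' \<in> maximal_atlas A" and "\<And>x. x \<in> \<Phi> ` V \<Longrightarrow> chart_inv c' x = chart_inv c (g x)"
    and "snd c' ` fst c' = \<Phi> ` V"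
proof -
  have fd: "finite_dim TYPE('e)" using smooth_manifold_finite_dim[OF A] .
  have ch: "is_chart c" using maximal_atlas_is_chart[OF c] .
  have gV: "g y \<in> V" "\<Phi> (g y) = y" if "y \<in> \<Phi> ` V" for y
    using that hom unfolding homeomorphism_def by blast+
  have g\<Phi>: "g (\<Phi> x) = x" if "x \<in> V" for x using that hom unfolding homeomorphism_def by blast
  have cV: "snd c (chart_inv c x) = x" if "x \<in> V" for x using chart_inv_right[OF ch] V(2) that by blast
  show im: "snd c' ` fst c' = \<Phi> ` V" unfolding c'_def using cV by (auto simp: image_image)
  have left: "chart_inv c (g (\<Phi> (snd c p))) = p" if "p \<in> chart_inv c ` V" for p
    using that cV g\<Phi> by auto
  show inv: "chart_inv c' x = chart_inv c (g x)" if "x \<in> \<Phi> ` V" for x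
    unfolding c'_def using chart_inv_eqI[where g="\<lambda>x. chart_inv c (g x)", OF left] im that
    unfolding c'_def by auto
  have sub: "chart_inv c ` V \<subseteq> fst c" using V(2) chart_inv_in[OF ch] by blast
  have chc: "continuous_on (fst c) (snd c)" "continuous_on (snd c ` fst c) (chart_inv c)"
    using ch unfolding is_chart_def homeomorphism_def by blast+
  have ch': "is_chart c'" unfolding c'_def
  proof (rule is_chartI[where g="\<lambda>x. chart_inv c (g x)"])
    show "open (chart_inv c ` V)" by (rule open_chart_inv_image[OF ch V])
    have i: "(\<lambda>p. \<Phi> (snd c p)) ` chart_inv c ` V = \<Phi> ` V" using im unfolding c'_def by simp
    show "open ((\<lambda>p. \<Phi> (snd c p)) ` chart_inv c ` V)" using W i by simp
    show "continuous_on (chart_inv c ` V) (\<lambda>p. \<Phi> (snd c p))"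
    proof (rule continuous_on_compose2[of V \<Phi>])
      show "continuous_on V \<Phi>" using hom unfolding homeomorphism_def by blast
      show "continuous_on (chart_inv c ` V) (snd c)" by (rule continuous_on_subset[OF chc(1) sub])
      show "snd c ` chart_inv c ` V \<subseteq> V" using cV by auto
    qed
    show "continuous_on ((\<lambda>p. \<Phi> (snd c p)) ` chart_inv c ` V) (\<lambda>x. chart_inv c (g x))"
      unfolding i
    proof (rule continuous_on_compose2[OF chc(2)])
      show "continuous_on (\<Phi> ` V) g" using hom unfolding homeomorphism_def by blast
      show "g ` \<Phi> ` V \<subseteq> snd c ` fst c" using gV(1) V(2) by blast
    qed
  qed (rule left)
  have "compatible c' d" if d: "d \<in> A" for d
    unfolding compatible_def
  proof (intro conjI smooth_on_smooth_at)
    fix x assume "x \<in> snd c' ` (fst c' \<inter> fst d)"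
    then obtain p where p: "p \<in> fst c'" "p \<in> fst d" "x = snd c' p" by blast
    have pc: "p \<in> fst c" using p(1) sub unfolding c'_def by auto
    have xV: "x \<in> \<Phi> ` V" using p im by blast
    have gx: "g x = snd c p" using p(1,3) g\<Phi> cV unfolding c'_def by auto
    have "smooth_at (in_charts c d id) (g x)"
      unfolding gx by (rule smooth_transition_atlas(1)[OF c d A pc p(2)])
    then have "smooth_at (\<lambda>y. in_charts c d id (g y)) x"
      by (rule smooth_at_compose[OF fd smooth_at_smooth_on[OF sm(2) W xV]])
    then show "smooth_at (in_charts c' d id) x"
    proof (rule smooth_at_transform)
      show "\<forall>\<^sub>F y in nhds x. in_charts c d id (g y) = in_charts c' d id y"
        using eventually_nhds_in_open[OF W xV] by eventually_elim (simp add: in_charts_apply inv)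
    qed
  next
    fix x assume "x \<in> snd d ` (fst c' \<inter> fst d)"
    then obtain p where p: "p \<in> fst c'" "p \<in> fst d" "x = snd d p" by blast
    have pc: "p \<in> fst c" using p(1) sub unfolding c'_def by auto
    have dc: "is_chart d" using smooth_manifold_is_chart[OF A d] .
    have eq: "in_charts d c id x = snd c p" by (simp add: in_charts_apply p(3) chart_inv_left[OF dc p(2)])
    have pV: "snd c p \<in> V" using p(1) cV unfolding c'_def by auto
    have "smooth_at (in_charts d c id) x"
      unfolding p(3) by (rule smooth_transition_atlas(2)[OF c d A pc p(2)])
    then have "smooth_at (\<lambda>y. \<Phi> (in_charts d c id y)) x"
      by (rule smooth_at_compose[OF fd]) (simp add: eq smooth_at_smooth_on[OF sm(1) V(1) pV])
    then show "smooth_at (in_charts d c' id) x"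
      by (simp add: c'_def in_charts_def comp_def)
  qed
  then show "c' \<in> maximal_atlas A" using ch' unfolding maximal_atlas_def by blast
qed

text \<open>This moves exponential coordinates from the unit to the other points of the
  group.\<close>

lemma chart_transport:
  fixes A :: "('m::{t2_space, second_countable_topology}, 'e::real_normed_vector) chart set"
  assumes A: "smooth_manifold A" and c: "c \<in> maximal_atlas A"
    and T: "smooth_map A A T" "smooth_map A A T'" and inv: "\<And>p. T (T' p) = p" "\<And>p. T' (T p) = p"
  defines "c' \<equiv> (T ` fst c, \<lambda>p. snd c (T' p))"
  shows "c' \<in> maximal_atlas A" and "snd c' ` fst c' = snd c ` fst c"
proof -
  have ch: "is_chart c" using maximal_atlas_is_chart[OF c] .
  show im: "snd c' ` fst c' = snd c ` fst c" unfolding c'_def by (simp add: image_image inv)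
  have TU: "T ` fst c = T' -` fst c" using inv by (auto simp: image_iff) (metis inv(1))+
  have cT: "continuous_on S T" "continuous_on S T'" for S
    using T continuous_on_subset unfolding smooth_map_def by blast+
  have chc: "continuous_on (fst c) (snd c)" "continuous_on (snd c ` fst c) (chart_inv c)"
    using ch unfolding is_chart_def homeomorphism_def by blast+
  have left: "T (chart_inv c (snd c (T' p))) = p" if "p \<in> T ` fst c" for p
    using that inv chart_inv_left[OF ch] by auto
  have cinv: "chart_inv c' x = T (chart_inv c x)" if "x \<in> snd c ` fst c" for x
    unfolding c'_def using chart_inv_eqI[where g="\<lambda>x. T (chart_inv c x)", OF left] im that
    unfolding c'_def by auto
  have ch': "is_chart c'" unfolding c'_def
  proof (rule is_chartI[where g="\<lambda>x. T (chart_inv c x)"])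
    have i: "(\<lambda>p. snd c (T' p)) ` T ` fst c = snd c ` fst c" using im unfolding c'_def by simp
    show "open (T ` fst c)" unfolding TU using open_vimage[OF chart_open[OF ch] cT(2)] .
    show "open ((\<lambda>p. snd c (T' p)) ` T ` fst c)" unfolding i by (rule chart_open_image[OF ch])
    show "continuous_on (T ` fst c) (\<lambda>p. snd c (T' p))"
      by (rule continuous_on_compose2[OF chc(1) cT(2)]) (auto simp: inv)
    show "continuous_on ((\<lambda>p. snd c (T' p)) ` T ` fst c) (\<lambda>x. T (chart_inv c x))"
      unfolding i by (rule continuous_on_compose2[OF cT(1) chc(2)]) auto
  qed (rule left)
  have "compatible c' d" if d: "d \<in> A" for d
    unfolding compatible_def
  proof (intro conjI smooth_on_smooth_at)
    fix x assume "x \<in> snd c' ` (fst c' \<inter> fst d)"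
    then obtain p where p: "p \<in> fst c'" "p \<in> fst d" "x = snd c' p" by blast
    have pc: "T' p \<in> fst c" using p(1) unfolding c'_def by (auto simp: inv)
    have x: "x = snd c (T' p)" using p(3) by (simp add: c'_def)
    have "smooth_at (in_charts c d T) x" unfolding x
      by (rule smooth_map_in_charts[OF A A T(1) c atlas_subset_maximal[OF A d] pc]) (simp add: inv p)
    then show "smooth_at (in_charts c' d id) x"
    proof (rule smooth_at_transform)
      show "\<forall>\<^sub>F y in nhds x. in_charts c d T y = in_charts c' d id y"
        using eventually_chart_image[OF ch pc] unfolding x
        by eventually_elim (simp add: in_charts_apply cinv)
    qed
  next
    fix x assume "x \<in> snd d ` (fst c' \<inter> fst d)"
    then obtain p where p: "p \<in> fst c'" "p \<in> fst d" "x = snd d p" by blast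
    have pc: "T' p \<in> fst c" using p(1) unfolding c'_def by (auto simp: inv)
    have "smooth_at (in_charts d c T') x" unfolding p(3)
      by (rule smooth_map_in_charts[OF A A T(2) atlas_subset_maximal[OF A d] c p(2) pc])
    then show "smooth_at (in_charts d c' id) x" by (simp add: c'_def in_charts_def comp_def)
  qed
  then show "c' \<in> maximal_atlas A" using ch' unfolding maximal_atlas_def by blast
qed

subsection \<open>Derivatives and dimension\<close>

lemma transition_derivative_inverse:
  fixes A :: "('m::{t2_space, second_countable_topology}, 'e::real_normed_vector) chart set"
  assumes A: "smooth_manifold A" and c: "c \<in> maximal_atlas A" and d: "d \<in> maximal_atlas A"
    and p: "p \<in> fst c" "p \<in> fst d"
  shows "frechet_derivative (in_charts d c id) (at (snd d p))
          (frechet_derivative (in_charts c d id) (at (snd c p)) v) = v"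
proof -
  have ch: "is_chart c" "is_chart d" using maximal_atlas_is_chart c d by blast+
  let ?D = "frechet_derivative (in_charts c d id) (at (snd c p))"
  let ?E = "frechet_derivative (in_charts d c id) (at (snd d p))"
  have eq: "in_charts c d id (snd c p) = snd d p" by (simp add: in_charts_apply chart_inv_left[OF ch(1) p(1)])
  have D: "(in_charts c d id has_derivative ?D) (at (snd c p))"
    by (rule smooth_at_has_derivative[OF smooth_transition[OF A c d p]])
  have E: "(in_charts d c id has_derivative ?E) (at (in_charts c d id (snd c p)))"
    unfolding eq by (rule smooth_at_has_derivative[OF smooth_transition[OF A d c p(2,1)]])
  have DE: "((\<lambda>x. in_charts d c id (in_charts c d id x)) has_derivative (\<lambda>v. ?E (?D v))) (at (snd c p))"
    using has_derivative_compose[OF D E] .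
  have 1: "\<forall>\<^sub>F x in nhds (snd c p). in_charts d c id (in_charts c d id x) = in_charts c c (\<lambda>q. id (id q)) x"
    by (rule in_charts_compose[OF ch(1) ch(2) p(1)]) (use p(2) in \<open>auto simp: id_def\<close>)
  have "\<forall>\<^sub>F x in nhds (snd c p). in_charts d c id (in_charts c d id x) = x"
    using 1 eventually_chart_image[OF ch(1) p(1)]
    by eventually_elim (simp add: in_charts_apply chart_inv_right[OF ch(1)])
  then obtain U where U: "open U" "snd c p \<in> U" "\<And>x. x \<in> U \<Longrightarrow> in_charts d c id (in_charts c d id x) = x"
    unfolding eventually_nhds by blast
  have "((\<lambda>x. x) has_derivative (\<lambda>v. ?E (?D v))) (at (snd c p))"
    by (rule has_derivative_transform_within_open[OF DE U(1,2)]) (rule U(3))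
  then have "(\<lambda>v. ?E (?D v)) = (\<lambda>v. v)" using has_derivative_unique has_derivative_ident by blast
  then show ?thesis by metis
qed

text \<open>The derivative of the transition between two adapted charts is injective and maps one
  linear model into the other, because curves in the submanifold have their velocities in both
  models.\<close>

lemma submanifold_dim_le:
  fixes A :: "('m::{t2_space, second_countable_topology}, 'e::real_normed_vector) chart set"
  assumes A: "smooth_manifold A" and S: "submanifold A k S" "submanifold A l S" and p: "p \<in> S"
  shows "k \<le> l"
proof -
  have fd: "finite_dim TYPE('e)" using smooth_manifold_finite_dim[OF A] .
  obtain c K where c: "c \<in> maximal_atlas A" "p \<in> fst c"
    and K: "subspace K" "dim K = k" "snd c ` (fst c \<inter> S) = snd c ` fst c \<inter> K"
    using S(1) p unfolding submanifold_def by blast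
  obtain d L where d: "d \<in> maximal_atlas A" "p \<in> fst d"
    and L: "subspace L" "dim L = l" "snd d ` (fst d \<inter> S) = snd d ` fst d \<inter> L"
    using S(2) p unfolding submanifold_def by blast
  have ch: "is_chart c" "is_chart d" using maximal_atlas_is_chart c d by blast+
  define D where "D = frechet_derivative (in_charts c d id) (at (snd c p))"
  have sm: "smooth_at (in_charts c d id) (snd c p)" using smooth_transition[OF A c(1) d(1) c(2) d(2)] .
  have D: "(in_charts c d id has_derivative D) (at (snd c p))"
    unfolding D_def by (rule smooth_at_has_derivative[OF sm])
  have lin: "linear D" unfolding D_def by (rule smooth_at_linear_derivative[OF sm])
  have pK: "snd c p \<in> K" using K(3) c(2) p by blast
  have "D v \<in> L" if v: "v \<in> K" for v
  proof (rule vector_derivative_in_subspace[OF fd L(1)])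
    let ?l = "\<lambda>s::real. snd c p + s *\<^sub>R v"
    have l: "(?l has_vector_derivative v) (at 0)" by (auto intro!: derivative_eq_intros)
    have D0: "(in_charts c d id has_derivative D) (at (?l 0))" using D by simp
    show "((\<lambda>s. in_charts c d id (?l s)) has_vector_derivative D v) (at 0)"
      using has_derivative_compose[OF l[unfolded has_vector_derivative_def] D0]
      unfolding has_vector_derivative_def by (simp add: linear_scale[OF lin])
    have ic: "isCont ?l 0" by (intro continuous_intros)
    have "\<forall>\<^sub>F x in nhds (snd c p). x \<in> snd c ` fst c \<and> chart_inv c x \<in> fst d"
      by (intro eventually_conj eventually_chart_image eventually_chart_inv_in ch c d chart_open)
    then have "\<forall>\<^sub>F s in nhds 0. ?l s \<in> snd c ` fst c \<and> chart_inv c (?l s) \<in> fst d"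
      using isCont_eventually_compose[OF ic, of "\<lambda>x. x \<in> snd c ` fst c \<and> chart_inv c x \<in> fst d"] by simp
    then show "\<forall>\<^sub>F s in nhds 0. in_charts c d id (?l s) \<in> L"
    proof eventually_elim
      case (elim s)
      have "?l s \<in> K" using pK v K(1) by (simp add: subspace_add subspace_scale)
      then have "?l s \<in> snd c ` (fst c \<inter> S)" using K(3) elim by blast
      then obtain q where "q \<in> fst c" "q \<in> S" "?l s = snd c q" by blast
      then have "chart_inv c (?l s) \<in> S" by (simp add: chart_inv_left[OF ch(1)])
      then have "snd d (chart_inv c (?l s)) \<in> L" using elim L(3) by blast
      then show ?case by (simp add: in_charts_apply)
    qed
  qed
  then have sub: "D ` K \<subseteq> L" by blast
  obtain B where B: "finite_dimensional_vector_space scaleR (B :: 'e set)" using finite_dim_locale[OF fd] .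
  have "{v \<in> K. D v = 0} = {0}"
    using transition_derivative_inverse[OF A c(1) d(1) c(2) d(2)] lin K(1)
      linear_0[OF smooth_at_linear_derivative[OF smooth_transition[OF A d(1) c(1) d(2) c(2)]]]
    unfolding D_def[symmetric] by (auto simp: linear_0 subspace_0) metis
  moreover have "dim {0::'e} = 0" by (metis dim_eq_card_independent independent_empty card.empty
        dim_span span_empty)
  ultimately have "dim (D ` K) = dim K" using rank_nullity[OF fd lin K(1)] by simp
  moreover have "dim (D ` K) \<le> dim L"
    using finite_dimensional_vector_space.dim_subset[OF B sub] by (simp add: dim_raw_def)
  ultimately show ?thesis using K(2) L(2) by simp
qed

lemma submanifold_dim_eq:
  fixes A :: "('m::{t2_space, second_countable_topology}, 'e::real_normed_vector) chart set"
  assumes "smooth_manifold A" "submanifold A k S" "p \<in> S"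
  shows "submanifold_dim A S = k"
  unfolding submanifold_dim_def
proof (rule the_equality)
  show "submanifold A k S" by (rule assms(2))
  show "l = k" if "submanifold A l S" for l
    using submanifold_dim_le[OF assms(1) that assms(2,3)] submanifold_dim_le[OF assms(1,2) that assms(3)]
    by simp
qed

section \<open>The exponential map of an Abelian Lie group\<close>

lemma smooth_at_lipschitz:
  fixes f :: "'a::real_normed_vector \<Rightarrow> 'b::real_normed_vector"
  assumes fd: "finite_dim TYPE('a)" and f: "smooth_at f z"
  obtains K d where "K > 0" "d > 0" "\<And>x y. x \<in> ball z d \<Longrightarrow> y \<in> ball z d \<Longrightarrow> norm (f x - f y) \<le> K * norm (x - y)"
proof -
  define L where "L x = frechet_derivative f (at x)" for x
  have ev: "\<forall>\<^sub>F y in nhds z. smooth_at f y" by (rule smooth_at_eventually[OF f])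
  then have lin: "\<forall>\<^sub>F y in nhds z. linear (L y)"
    unfolding L_def by eventually_elim (rule smooth_at_linear_derivative)
  have "bounded_linear (L z)"
    unfolding L_def by (rule finite_dim_linear_bounded[OF fd smooth_at_linear_derivative[OF f]])
  then obtain C where C: "C > 0" "\<And>v. norm (L z v) \<le> norm v * C"
    using bounded_linear.pos_bounded by blast
  have "\<forall>\<^sub>F y in nhds z. \<forall>u. norm (L y u - L z u) \<le> 1 * norm u"
    by (rule linear_family_uniformly_close[OF fd lin])
       (auto simp: L_def intro!: smooth_at_isCont smooth_at_frechet_derivative[OF f])
  then have "\<forall>\<^sub>F y in nhds z. smooth_at f y \<and> (\<forall>u. norm (L y u) \<le> (C + 1) * norm u)"
    using ev
  proof eventually_elim
    case (elim y)
    have "norm (L y u) \<le> (C + 1) * norm u" for u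
      using elim(1)[rule_format, of u] C(2)[of u] norm_triangle_ineq2[of "L y u" "L z u"]
      by (simp add: algebra_simps)
    then show ?case using elim by blast
  qed
  then obtain d where d: "d > 0" "\<And>y. dist y z < d \<Longrightarrow> smooth_at f y \<and> (\<forall>u. norm (L y u) \<le> (C + 1) * norm u)"
    unfolding eventually_nhds_metric by blast
  show ?thesis
  proof (rule that[of "C + 1" d])
    fix x y assume xy: "x \<in> ball z d" "y \<in> ball z d"
    show "norm (f x - f y) \<le> (C + 1) * norm (x - y)"
    proof (rule differentiable_bound[OF convex_ball _ _ xy])
      fix w assume w: "w \<in> ball z d"
      then have w': "smooth_at f w" "\<And>u. norm (L w u) \<le> (C + 1) * norm u"
        using d(2)[of w] by (auto simp: dist_commute)
      show "(f has_derivative L w) (at w within ball z d)"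
        unfolding L_def by (rule has_derivative_at_withinI[OF smooth_at_has_derivative[OF w'(1)]])
      show "onorm (L w) \<le> C + 1" by (rule onorm_bound) (use w'(2) C in auto)
    qed
  qed (use C d in auto)
qed

text \<open>Since \<open>F(0, y) = y\<close>, the partial derivative \<open>D\<^sub>2F(x, y)\<close>
  is the identity for \<open>x = 0\<close> and differs from it by at most \<open>C |x|\<close>.  As
  \<open>F(x, 0) = x\<close>, integrating along \<open>y\<close> gives the product bound.\<close>

lemma unital_product_estimate:
  fixes F :: "'f::real_normed_vector \<times> 'f \<Rightarrow> 'f"
  assumes fd: "finite_dim TYPE('f)" and F: "smooth_at F (0, 0)"
    and left: "\<forall>\<^sub>F y in nhds 0. F (0, y) = y" and right: "\<forall>\<^sub>F x in nhds 0. F (x, 0) = x"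
  obtains C r where "C > 0" "r > 0"
    "\<And>x y. norm x \<le> r \<Longrightarrow> norm y \<le> r \<Longrightarrow> norm (F (x, y) - x - y) \<le> C * norm x * norm y"
proof -
  obtain b :: "'f set" and c where b: "finite b" "\<And>i. i \<in> b \<Longrightarrow> bounded_linear (c i)"
    "\<And>v. (\<Sum>i\<in>b. c i v *\<^sub>R i) = v"
    using finite_dim_coordinates[OF fd] by metis
  have fd2: "finite_dim TYPE('f \<times> 'f)" by (rule finite_dim_prod[OF fd fd])
  define G where "G i z = frechet_derivative F (at z) (0, i)" for i z
  have "\<exists>K d. K > 0 \<and> d > 0 \<and> (\<forall>x y. x \<in> ball (0, 0) d \<longrightarrow> y \<in> ball (0, 0) d \<longrightarrow> norm (G i x - G i y) \<le> K * norm (x - y))" for i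
  proof -
    have "smooth_at (G i) (0, 0)" unfolding G_def by (rule smooth_at_frechet_derivative[OF F])
    from smooth_at_lipschitz[OF fd2 this] show ?thesis by metis
  qed
  then obtain K d where K: "\<And>i. K i > 0" "\<And>i. d i > 0"
    "\<And>i x y. x \<in> ball (0, 0) (d i) \<Longrightarrow> y \<in> ball (0, 0) (d i) \<Longrightarrow> norm (G i x - G i y) \<le> K i * norm (x - y)"
    by metis
  obtain d1 where d1: "d1 > 0" "\<And>z. dist z (0, 0) < d1 \<Longrightarrow> smooth_at F z"
    using smooth_at_eventually[OF F] unfolding eventually_nhds_metric by blast
  obtain d2 where d2: "d2 > 0" "\<And>y. dist y 0 < d2 \<Longrightarrow> F (0, y) = y"
    using left unfolding eventually_nhds_metric by blast
  obtain d3 where d3: "d3 > 0" "\<And>y. dist y 0 < d3 \<Longrightarrow> F (y, 0) = y"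
    using right unfolding eventually_nhds_metric by blast
  define r where "r = Min ({d1, d2, d3} \<union> d ` b) / 4"
  have rb: "4 * r \<le> d1" "4 * r \<le> d2" "4 * r \<le> d3" "\<And>i. i \<in> b \<Longrightarrow> 4 * r \<le> d i"
    using Min_le[of "{d1, d2, d3} \<union> d ` b"] b(1) unfolding r_def by auto
  have rp: "r > 0" unfolding r_def using b(1) d1(1) d2(1) d3(1) K(2) by simp
  have n2: "norm (x, y) < 4 * r" if "norm x \<le> r" "norm y \<le> r" for x y :: 'f
    using norm_Pair_le[of x y] that rp by linarith
  have smF: "smooth_at F (x, y)" if "norm x \<le> r" "norm y \<le> r" for x y
    using d1(2)[of "(x, y)"] n2[OF that] rb(1) by (simp add: dist_norm)
  have lin: "linear (frechet_derivative F (at (x, y)))" if "norm x \<le> r" "norm y \<le> r" for x y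
    using smF[OF that] smooth_at_linear_derivative by blast
  have dF2: "((\<lambda>y. F (x, y)) has_derivative (\<lambda>v. frechet_derivative F (at (x, y)) (0, v))) (at y)"
    if "norm x \<le> r" "norm y \<le> r" for x y
  proof -
    have "((\<lambda>y. (x, y)) has_derivative (\<lambda>v. (0, v))) (at y)"
      by (intro has_derivative_Pair has_derivative_const has_derivative_ident)
    from has_derivative_compose[OF this smooth_at_has_derivative[OF smF[OF that]]] show ?thesis .
  qed
  have G0: "G i (0, y) = i" if y: "norm y < r" for i y
  proof -
    have 1: "((\<lambda>y. F (0, y)) has_derivative (\<lambda>v. frechet_derivative F (at (0, y)) (0, v))) (at y)"
      using dF2[of 0 y] y rp by simp
    have "((\<lambda>y. y) has_derivative (\<lambda>v. frechet_derivative F (at (0, y)) (0, v))) (at y)"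
      by (rule has_derivative_transform_within_open[OF 1, of "ball 0 r"])
         (use y d2(2) rb(2) rp in \<open>auto simp: dist_norm\<close>)
    then have "(\<lambda>v. frechet_derivative F (at (0, y)) (0, v)) = (\<lambda>v. v)"
      using has_derivative_unique has_derivative_ident by blast
    then show ?thesis unfolding G_def by metis
  qed
  define C where "C = 1 + (\<Sum>i\<in>b. onorm (c i) * K i)"
  have nn: "0 \<le> (\<Sum>i\<in>b. onorm (c i) * K i)"
    using K(1) onorm_pos_le[OF b(2)] by (intro sum_nonneg mult_nonneg_nonneg) (auto intro: less_imp_le)
  have bound: "norm (frechet_derivative F (at (x, y)) (0, v) - v) \<le> C * norm x * norm v"
    if x: "norm x < r" and y: "norm y < r" for x y v
  proof -
    have lin': "linear (frechet_derivative F (at (x, y)))" using lin x y by simp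
    have l2: "linear (\<lambda>v. frechet_derivative F (at (x, y)) (0, v))"
      using linear_compose[OF _ lin', of "\<lambda>v. (0, v)"] by (simp add: comp_def linear_iff)
    have "frechet_derivative F (at (x, y)) (0, v) = (\<Sum>i\<in>b. c i v *\<^sub>R G i (x, y))"
      using linear_sum[OF l2, of "\<lambda>i. c i v *\<^sub>R i" b] by (simp add: b(3) linear_scale[OF l2] G_def)
    then have "frechet_derivative F (at (x, y)) (0, v) - v = (\<Sum>i\<in>b. c i v *\<^sub>R (G i (x, y) - G i (0, y)))"
      by (simp add: G0[OF y] scaleR_diff_right sum_subtractf b(3))
    then have "norm (frechet_derivative F (at (x, y)) (0, v) - v) \<le> (\<Sum>i\<in>b. norm (c i v *\<^sub>R (G i (x, y) - G i (0, y))))"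
      by (simp only: norm_sum)
    also have "\<dots> \<le> (\<Sum>i\<in>b. onorm (c i) * K i * (norm x * norm v))"
    proof (rule sum_mono)
      fix i assume i: "i \<in> b"
      have "norm (G i (x, y) - G i (0, y)) \<le> K i * norm ((x, y) - (0, y))"
        by (rule K(3)) (use n2[of x y] n2[of 0 y] x y rp rb(4)[OF i] in
            \<open>simp_all add: zero_prod_def[symmetric] del: norm_Pair\<close>)
      then have 1: "norm (G i (x, y) - G i (0, y)) \<le> K i * norm x" by (simp add: norm_Pair)
      have 2: "\<bar>c i v\<bar> \<le> onorm (c i) * norm v" using onorm[OF b(2)[OF i], of v] by simp
      have "norm (c i v *\<^sub>R (G i (x, y) - G i (0, y))) \<le> (onorm (c i) * norm v) * (K i * norm x)"
        unfolding norm_scaleR by (rule mult_mono[OF 2 1]) (auto intro: mult_nonneg_nonneg onorm_pos_le[OF b(2)[OF i]])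
      then show "norm (c i v *\<^sub>R (G i (x, y) - G i (0, y))) \<le> onorm (c i) * K i * (norm x * norm v)"
        by (simp add: mult_ac)
    qed
    also have "\<dots> = (\<Sum>i\<in>b. onorm (c i) * K i) * (norm x * norm v)"
      by (simp only: sum_distrib_right[symmetric])
    also have "\<dots> \<le> C * (norm x * norm v)" unfolding C_def by (rule mult_right_mono) auto
    finally show ?thesis by (simp add: mult_ac)
  qed
  show ?thesis
  proof (rule that[of C "r / 2"])
    fix x y :: 'f assume xy: "norm x \<le> r / 2" "norm y \<le> r / 2"
    have x: "norm x < r" and y: "norm y < r" using xy rp by auto
    have "norm ((F (x, y) - y) - (F (x, 0) - 0)) \<le> C * norm x * norm (y - 0)"
    proof (rule differentiable_bound[OF convex_ball])
      fix w :: 'f assume w: "w \<in> ball 0 r"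
      show "((\<lambda>y. F (x, y) - y) has_derivative (\<lambda>v. frechet_derivative F (at (x, w)) (0, v) - v)) (at w within ball 0 r)"
        by (intro has_derivative_diff has_derivative_ident has_derivative_at_withinI[OF dF2]) (use x w in auto)
      show "onorm (\<lambda>v. frechet_derivative F (at (x, w)) (0, v) - v) \<le> C * norm x"
        by (rule onorm_bound) (use bound[of x w] x w nn in \<open>auto simp: C_def\<close>)
    qed (use y rp in auto)
    then show "norm (F (x, y) - x - y) \<le> C * norm x * norm y"
      using d3(2)[of x] x rp rb(3) by (simp add: dist_norm algebra_simps)
  qed (use rp nn in \<open>auto simp: C_def\<close>)
qed

text \<open>The increments decay geometrically; completeness comes from finite dimension.\<close>

lemma dyadic_Cauchy_limit:
  fixes a :: "nat \<Rightarrow> 'a::real_normed_vector"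
  assumes fd: "finite_dim TYPE('a)" and step: "\<And>n. norm (a (Suc n) - a n) \<le> K / 2 ^ n"
  obtains l where "a \<longlonglongrightarrow> l" "norm (l - a 0) \<le> 2 * K"
proof -
  have K0: "K \<ge> 0" using order_trans[OF norm_ge_zero step[of 0]] by simp
  have tail: "norm (a (n + k) - a n) \<le> 2 * K / 2 ^ n - 2 * K / 2 ^ (n + k)" for n k
  proof (induction k)
    case (Suc k)
    have "norm (a (n + Suc k) - a n) \<le> norm (a (Suc (n + k)) - a (n + k)) + norm (a (n + k) - a n)"
      using norm_triangle_ineq[of "a (Suc (n + k)) - a (n + k)" "a (n + k) - a n"] by simp
    also have "\<dots> \<le> K / 2 ^ (n + k) + (2 * K / 2 ^ n - 2 * K / 2 ^ (n + k))"
      using step[of "n + k"] Suc by linarith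
    also have "\<dots> = 2 * K / 2 ^ n - 2 * K / 2 ^ (n + Suc k)" by (simp add: field_simps)
    finally show ?case .
  qed simp
  have tail': "norm (a (n + k) - a n) \<le> 2 * K / 2 ^ n" for n k
    using tail[of n k] K0 by (smt (verit) divide_nonneg_pos zero_less_power)
  have "Cauchy a"
  proof (rule metric_CauchyI)
    fix e :: real assume e: "e > 0"
    have "(\<lambda>n. 2 * K * (1 / 2) ^ n) \<longlonglongrightarrow> 2 * K * 0"
      by (intro tendsto_mult tendsto_const LIMSEQ_power_zero) simp
    then have "\<forall>\<^sub>F n in sequentially. 2 * K * (1 / 2) ^ n < e"
      using e by (intro order_tendstoD) auto
    then obtain M where M: "2 * K / 2 ^ M < e / 1" 
      unfolding eventually_sequentially by (auto simp: power_one_over)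
    have close: "dist (a m) (a n) < e" if M': "2 * K / 2 ^ M' < e" and mn: "m \<ge> M'" "n \<ge> m" for M' m n
    proof -
      have "norm (a m - a n) \<le> 2 * K / 2 ^ m"
        using tail'[of m "n - m"] mn by (simp add: norm_minus_commute)
      also have "\<dots> \<le> 2 * K / 2 ^ M'"
        using K0 mn by (intro divide_left_mono) (auto intro: power_increasing)
      finally show ?thesis using M' by (simp add: dist_norm)
    qed
    have "dist (a m) (a n) < e" if "m \<ge> M" "n \<ge> M" for m n
      using close[of M m n] close[of M n m] that M by (cases "n \<ge> m") (auto simp: dist_commute)
    then show "\<exists>M. \<forall>m\<ge>M. \<forall>n\<ge>M. dist (a m) (a n) < e" by blast
  qed
  then obtain l where l: "a \<longlonglongrightarrow> l"
    using finite_dim_complete[OF fd] unfolding complete_def by blast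
  have "norm (l - a 0) \<le> 2 * K"
  proof (rule LIMSEQ_le_const2)
    show "(\<lambda>n. norm (a n - a 0)) \<longlonglongrightarrow> norm (l - a 0)" by (intro tendsto_intros l)
    show "\<exists>N. \<forall>n\<ge>N. norm (a n - a 0) \<le> 2 * K" using tail'[of 0] by simp
  qed
  then show ?thesis using that l by blast
qed

primrec nmul :: "nat \<Rightarrow> 'g::ab_group_add \<Rightarrow> 'g" where
  "nmul 0 g = 0"
| "nmul (Suc n) g = nmul n g + g"

lemma nmul_add: "nmul n (a + b) = nmul n a + nmul n b"
  by (induction n) (auto simp: algebra_simps)

lemma nmul_diff: "nmul n (a - b) = nmul n a - nmul n b"
  by (induction n) (auto simp: algebra_simps)

lemma nmul_plus: "nmul (m + n) g = nmul m g + nmul n g"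
  by (induction n) (auto simp: algebra_simps)

lemma nmul_mult: "nmul (m * n) g = nmul m (nmul n g)"
  by (induction m) (auto simp: nmul_plus add.commute)

locale abelian_lie =
  fixes B :: "('g::{ab_group_add, t2_space, second_countable_topology}, 'f::real_normed_vector) chart set"
  assumes lie: "abelian_lie_group B"
begin

lemma smooth_manifold_B: "smooth_manifold B"
  and smooth_add: "smooth_map (prod_atlas B B) B (\<lambda>(a, b). a + b)"
  and smooth_uminus: "smooth_map B B uminus"
  using lie unfolding abelian_lie_group_def by auto

lemma fdB: "finite_dim TYPE('f)" by (rule smooth_manifold_finite_dim[OF smooth_manifold_B])

text \<open>The chart at the unit is shifted so that the unit has coordinate 0 and sums in the group
  can be compared with sums of coordinates.\<close>

definition c0 where "c0 = chart_at B 0"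
definition \<phi> :: "'g \<Rightarrow> 'f" where "\<phi> g = snd c0 g - snd c0 0"
definition \<psi> :: "'f \<Rightarrow> 'g" where "\<psi> x = chart_inv c0 (x + snd c0 0)"

lemma c0: "c0 \<in> B" "0 \<in> fst c0" "is_chart c0"
proof -
  have "\<exists>c. c \<in> B \<and> 0 \<in> fst c" using atlas_chart_exists[OF smooth_manifold_B] by metis
  then have "c0 \<in> B \<and> 0 \<in> fst c0" unfolding c0_def chart_at_def by (rule someI_ex)
  then show "c0 \<in> B" "0 \<in> fst c0" by auto
  then show "is_chart c0" using smooth_manifold_is_chart[OF smooth_manifold_B] by blast
qed

lemma \<phi>_0 [simp]: "\<phi> 0 = 0" by (simp add: \<phi>_def)

lemma \<psi>_\<phi>: "g \<in> fst c0 \<Longrightarrow> \<psi> (\<phi> g) = g" by (simp add: \<phi>_def \<psi>_def chart_inv_left[OF c0(3)])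

lemma \<psi>_0 [simp]: "\<psi> 0 = 0" using \<psi>_\<phi>[OF c0(2)] by simp

lemma continuous_add: "continuous_on UNIV (\<lambda>(a, b::'g). a + b)"
  using smooth_add unfolding smooth_map_def by blast

lemma continuous_uminus: "continuous_on UNIV (uminus :: 'g \<Rightarrow> 'g)"
  using smooth_uminus unfolding smooth_map_def by blast

lemma tendsto_add_g:
  fixes a b :: "'x \<Rightarrow> 'g"
  assumes "(a \<longlongrightarrow> x) F" "(b \<longlongrightarrow> y) F" shows "((\<lambda>n. a n + b n) \<longlongrightarrow> x + y) F"
proof -
  have "isCont (\<lambda>(a, b::'g). a + b) (x, y)"
    using continuous_add by (simp add: continuous_on_eq_continuous_at)
  from isCont_tendsto_compose[OF this tendsto_Pair[OF assms]] show ?thesis by simp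
qed

lemma tendsto_uminus_g:
  fixes a :: "'x \<Rightarrow> 'g"
  assumes "(a \<longlongrightarrow> x) F" shows "((\<lambda>n. - a n) \<longlongrightarrow> - x) F"
proof -
  have "isCont (uminus :: 'g \<Rightarrow> 'g) x"
    using continuous_uminus by (simp add: continuous_on_eq_continuous_at)
  from isCont_tendsto_compose[OF this assms] show ?thesis .
qed

lemma tendsto_diff_g:
  fixes a b :: "'x \<Rightarrow> 'g"
  assumes "(a \<longlongrightarrow> x) F" "(b \<longlongrightarrow> y) F" shows "((\<lambda>n. a n - b n) \<longlongrightarrow> x - y) F"
  using tendsto_add_g[OF assms(1) tendsto_uminus_g[OF assms(2)]] by simp

lemma tendsto_nmul_g:
  fixes a :: "'x \<Rightarrow> 'g"
  assumes "(a \<longlongrightarrow> x) F" shows "((\<lambda>n. nmul k (a n)) \<longlongrightarrow> nmul k x) F"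
  by (induction k) (auto intro: tendsto_add_g assms)

lemma isCont_\<phi>: "g \<in> fst c0 \<Longrightarrow> isCont \<phi> g"
  unfolding \<phi>_def by (intro continuous_intros isCont_chart[OF c0(3)])

lemma open_small: "open {g \<in> fst c0. norm (\<phi> g) < s}"
proof -
  have "{g \<in> fst c0. norm (\<phi> g) < s} = fst c0 \<inter> \<phi> -` ball 0 s" by auto
  moreover have "continuous_on (fst c0) \<phi>"
    by (intro continuous_at_imp_continuous_on ballI isCont_\<phi>)
  ultimately show ?thesis using continuous_open_preimage[OF _ chart_open[OF c0(3)] open_ball] by simp
qed

lemma eventually_\<psi>: "\<forall>\<^sub>F x in nhds 0. \<psi> x \<in> fst c0 \<and> \<phi> (\<psi> x) = x \<and> isCont \<psi> x"
proof -
  have "isCont (\<lambda>x. x + snd c0 0) (0::'f)" by (intro continuous_intros)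
  then have "\<forall>\<^sub>F x in nhds (0::'f). x + snd c0 0 \<in> snd c0 ` fst c0"
    using c0 by (intro isCont_eventually_in chart_open_image) auto
  then show ?thesis
  proof eventually_elim
    case (elim x)
    have "isCont (\<lambda>x. x + snd c0 0) x" by (intro continuous_intros)
    then have "isCont \<psi> x" unfolding \<psi>_def
      using isCont_o2[of x "\<lambda>x. x + snd c0 0" "chart_inv c0"] isCont_chart_inv[OF c0(3) elim] by blast
    then show ?case using elim by (simp add: \<phi>_def \<psi>_def chart_inv_in[OF c0(3)] chart_inv_right[OF c0(3)])
  qed
qed

text \<open>The group law in coordinates.\<close>

definition gprod :: "'f \<times> 'f \<Rightarrow> 'f" where "gprod = (\<lambda>(x, y). \<phi> (\<psi> x + \<psi> y))"

lemma smooth_gprod: "smooth_at gprod (0, 0)"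
proof -
  have "smooth_at (\<lambda>(x, y). snd c0 (case (chart_inv c0 x, chart_inv c0 y) of (a, b) \<Rightarrow> a + b)) (snd c0 0, snd c0 0)"
    by (rule smooth_map_from_prod[OF smooth_add]) (use c0 in auto)
  then have 1: "smooth_at (\<lambda>z. snd c0 (chart_inv c0 (fst z) + chart_inv c0 (snd z))) ((0, 0) + (snd c0 0, snd c0 0))"
    by (simp add: case_prod_beta')
  have 2: "smooth_at (\<lambda>z. z + (snd c0 0, snd c0 0)) (0, 0)"
    by (intro smooth_at_add) auto
  have "smooth_at (\<lambda>z. snd c0 (chart_inv c0 (fst (z + (snd c0 0, snd c0 0))) + chart_inv c0 (snd (z + (snd c0 0, snd c0 0)))) - snd c0 0) (0, 0)"
    by (intro smooth_at_diff smooth_at_compose[OF finite_dim_prod[OF fdB fdB] 2 1]) auto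
  then show ?thesis by (simp add: gprod_def \<phi>_def \<psi>_def case_prod_beta')
qed

definition small :: "real \<Rightarrow> 'g \<Rightarrow> bool" where "small s g \<longleftrightarrow> g \<in> fst c0 \<and> norm (\<phi> g) \<le> s"

text \<open>The constants that govern the group law on a ball of radius \<open>r\<close>:
  \<open>\<psi>\<close> inverts the chart there, the coordinate of a sum is the sum of the
  coordinates up to a second-order term, and the coordinate of a difference is at most twice the
  difference of the coordinates.  The condition \<open>C * r \<le> 1/2\<close> makes the
  second-order terms at most half of the first-order ones.\<close>

definition controlled :: "real \<Rightarrow> real \<Rightarrow> bool" where
  "controlled C r \<longleftrightarrow> C > 0 \<and> r > 0 \<and> C * r \<le> 1/2 \<and>
    (\<forall>x. norm x \<le> r \<longrightarrow> \<psi> x \<in> fst c0 \<and> \<phi> (\<psi> x) = x \<and> isCont \<psi> x) \<and>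
    (\<forall>a b. small r a \<longrightarrow> small r b \<longrightarrow> a + b \<in> fst c0 \<and>
       norm (\<phi> (a + b) - \<phi> a - \<phi> b) \<le> C * norm (\<phi> a) * norm (\<phi> b)) \<and>
    (\<forall>a b. small r a \<longrightarrow> small r b \<longrightarrow> a - b \<in> fst c0 \<and> norm (\<phi> (a - b)) \<le> 2 * norm (\<phi> a - \<phi> b))"

lemma controlled_exists: "\<exists>C r. controlled C r"
proof -
  have ev0: "\<forall>\<^sub>F y in nhds 0. gprod (0, y) = y" "\<forall>\<^sub>F x in nhds 0. gprod (x, 0) = x"
    using eventually_\<psi> by (eventually_elim, simp add: gprod_def)+
  obtain C r1 where C: "C > 0" "r1 > 0"
    "\<And>x y. norm x \<le> r1 \<Longrightarrow> norm y \<le> r1 \<Longrightarrow> norm (gprod (x, y) - x - y) \<le> C * norm x * norm y"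
    using unital_product_estimate[OF fdB smooth_gprod ev0] by metis
  obtain d2 where d2: "d2 > 0" "\<And>x. dist x 0 < d2 \<Longrightarrow> \<psi> x \<in> fst c0 \<and> \<phi> (\<psi> x) = x \<and> isCont \<psi> x"
    using eventually_\<psi> unfolding eventually_nhds_metric by blast
  have \<psi>c: "isCont \<psi> 0" using d2 by auto
  have tl: "((\<lambda>z. \<psi> (fst z)) \<longlongrightarrow> 0) (nhds (0::'f, 0::'f))" "((\<lambda>z. \<psi> (snd z)) \<longlongrightarrow> 0) (nhds (0::'f, 0::'f))"
  proof -
    have "(fst \<longlongrightarrow> 0) (nhds (0::'f, 0::'f))" "(snd \<longlongrightarrow> 0) (nhds (0::'f, 0::'f))"
      using tendsto_fst[OF filterlim_ident, of "(0::'f, 0::'f)"] tendsto_snd[OF filterlim_ident, of "(0::'f, 0::'f)"]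
      by (simp_all add: filterlim_def)
    from this[THEN isCont_tendsto_compose[OF \<psi>c]]
    show "((\<lambda>z. \<psi> (fst z)) \<longlongrightarrow> 0) (nhds (0::'f, 0::'f))" "((\<lambda>z. \<psi> (snd z)) \<longlongrightarrow> 0) (nhds (0::'f, 0::'f))" by simp_all
  qed
  define r2 where "r2 = min (min r1 (d2 / 2)) (1 / (2 * C))"
  have r2: "r2 > 0" "r2 \<le> r1" "r2 < d2" using C(1,2) d2(1) unfolding r2_def by auto
  have "C * r2 \<le> C * (1 / (2 * C))" unfolding r2_def using C(1) by (intro mult_left_mono) auto
  then have r2: "r2 > 0" "r2 \<le> r1" "r2 < d2" "C * r2 \<le> 1/2" using r2 C(1) by auto
  define N where "N = {g \<in> fst c0. norm (\<phi> g) < r2}"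
  have oN: "open N" unfolding N_def by (rule open_small)
  have N0: "0 \<in> N" unfolding N_def using c0 r2 by simp
  have evs: "\<forall>\<^sub>F z in nhds (0, 0). \<psi> (fst z) + \<psi> (snd z) \<in> N"
    using topological_tendstoD[OF tendsto_add_g[OF tl] oN] N0 by simp
  have evd: "\<forall>\<^sub>F z in nhds (0, 0). \<psi> (fst z) - \<psi> (snd z) \<in> N"
    using topological_tendstoD[OF tendsto_diff_g[OF tl] oN] N0 by simp
  obtain d3 where d3: "d3 > 0" "\<And>z. dist z (0, 0) < d3 \<Longrightarrow> \<psi> (fst z) + \<psi> (snd z) \<in> N \<and> \<psi> (fst z) - \<psi> (snd z) \<in> N"
    using eventually_conj[OF evs evd] unfolding eventually_nhds_metric by blast
  define r where "r = min r2 (d3 / 4)"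
  have r: "r > 0" "r \<le> r2" "4 * r \<le> d3" using r2 d3(1) by (auto simp: r_def)
  have n2: "dist (x, y) (0, 0) < d3" if "norm x \<le> r" "norm y \<le> r" for x y :: 'f
    using norm_Pair_le[of x y] that r by (simp add: dist_norm)
  have in_N: "a + b \<in> N" "a - b \<in> N" if "small r a" "small r b" for a b
    using d3(2)[OF n2[of "\<phi> a" "\<phi> b"]] that unfolding small_def by (auto simp: \<psi>_\<phi>)
  have add: "norm (\<phi> (a + b) - \<phi> a - \<phi> b) \<le> C * norm (\<phi> a) * norm (\<phi> b)" if "small r2 a" "small r2 b" for a b
    using C(3)[of "\<phi> a" "\<phi> b"] that r r2 unfolding small_def gprod_def by (simp add: \<psi>_\<phi>)
  have "controlled C r"
    unfolding controlled_def
  proof (intro conjI allI impI)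
    show "C * r \<le> 1/2" using r2(4) r(2) C(1) by (meson mult_left_mono order_trans less_imp_le)
    fix a b assume ab: "small r a" "small r b"
    show "a - b \<in> fst c0" using in_N[OF ab] unfolding N_def by blast
    show "a + b \<in> fst c0" using in_N[OF ab] unfolding N_def by blast
    show "norm (\<phi> (a + b) - \<phi> a - \<phi> b) \<le> C * norm (\<phi> a) * norm (\<phi> b)"
      by (rule add) (use ab r in \<open>auto simp: small_def\<close>)
    have "norm (\<phi> (a - b + b) - \<phi> (a - b) - \<phi> b) \<le> C * norm (\<phi> (a - b)) * norm (\<phi> b)"
      by (rule add) (use in_N[OF ab] ab r in \<open>auto simp: small_def N_def\<close>)
    also have "\<dots> = (C * norm (\<phi> b)) * norm (\<phi> (a - b))" by simp
    also have "\<dots> \<le> 1/2 * norm (\<phi> (a - b))"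
    proof (rule mult_right_mono)
      have "C * norm (\<phi> b) \<le> C * r2" using ab r C by (auto simp: small_def)
      then show "C * norm (\<phi> b) \<le> 1/2" using r2(4) by simp
    qed simp
    finally show "norm (\<phi> (a - b)) \<le> 2 * norm (\<phi> a - \<phi> b)"
      using norm_triangle_ineq2[of "\<phi> (a - b)" "\<phi> a - \<phi> b"]
      by (simp add: norm_minus_commute algebra_simps)
  qed (use C r r2 d2(2) in \<open>auto simp: dist_norm\<close>)
  then show ?thesis by blast
qed

definition C0 where "C0 = fst (SOME p. controlled (fst p) (snd p))"
definition r0 where "r0 = snd (SOME p. controlled (fst p) (snd p))"

lemma controlled: "controlled C0 r0"
proof -
  have "\<exists>p. controlled (fst p) (snd p)" using controlled_exists by auto
  then show ?thesis unfolding C0_def r0_def by (rule someI_ex)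
qed

lemma C0: "C0 > 0" "r0 > 0" "C0 * r0 \<le> 1/2"
  using controlled unfolding controlled_def by auto

lemma \<phi>_\<psi>: "norm x \<le> r0 \<Longrightarrow> \<phi> (\<psi> x) = x"
  and \<psi>_in: "norm x \<le> r0 \<Longrightarrow> \<psi> x \<in> fst c0"
  and isCont_\<psi>: "norm x \<le> r0 \<Longrightarrow> isCont \<psi> x"
  using controlled unfolding controlled_def by auto

lemma small_\<psi>: "norm x \<le> s \<Longrightarrow> s \<le> r0 \<Longrightarrow> small s (\<psi> x)"
  unfolding small_def using \<phi>_\<psi> \<psi>_in by auto

lemma add_estimate:
  assumes "small r0 a" "small r0 b"
  shows "norm (\<phi> (a + b) - \<phi> a - \<phi> b) \<le> C0 * norm (\<phi> a) * norm (\<phi> b)" "a + b \<in> fst c0"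
  using controlled assms unfolding controlled_def by blast+

lemma diff_estimate:
  assumes "small r0 a" "small r0 b"
  shows "norm (\<phi> (a - b)) \<le> 2 * norm (\<phi> a - \<phi> b)" "a - b \<in> fst c0"
  using controlled assms unfolding controlled_def by blast+

lemma small_mono: "small s g \<Longrightarrow> s \<le> t \<Longrightarrow> small t g"
  unfolding small_def by auto

text \<open>The coordinate of a multiple grows at most twice as fast as in a vector space as long as
  it stays in the controlled ball: each step adds \<open>a\<close> and an error of at most
  \<open>a/2\<close>.\<close>

lemma small_nmul:
  assumes g: "small a g" and n: "2 * real n * a \<le> r0"
  shows "small (2 * real n * a) (nmul n g)"
  using n
proof (induction n)
  case 0
  then show ?case using c0 by (simp add: small_def)
next
  case (Suc n)
  have a: "a \<ge> 0" using g norm_ge_zero[of "\<phi> g"] unfolding small_def by linarith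
  have le: "2 * real n * a \<le> r0" "a \<le> r0" and le': "2 * real n * a + 2 * a \<le> r0"
    using Suc.prems a by (auto simp: algebra_simps) (smt (verit) mult_nonneg_nonneg of_nat_0_le_iff)+
  have IH: "small (2 * real n * a) (nmul n g)" using Suc.IH le by simp
  have s: "small r0 (nmul n g)" "small r0 g" using IH g le small_mono by blast+
  have n1: "norm (\<phi> (nmul n g)) \<le> 2 * real n * a" "norm (\<phi> g) \<le> a" using IH g unfolding small_def by auto
  have "norm (\<phi> (nmul n g + g)) \<le> norm (\<phi> (nmul n g)) + norm (\<phi> g) + C0 * norm (\<phi> (nmul n g)) * norm (\<phi> g)"
    using add_estimate(1)[OF s] norm_triangle_ineq[of "\<phi> (nmul n g)" "\<phi> g"]
      norm_triangle_ineq2[of "\<phi> (nmul n g + g)" "\<phi> (nmul n g) + \<phi> g"] by (simp add: algebra_simps)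
  also have "C0 * norm (\<phi> (nmul n g)) * norm (\<phi> g) \<le> C0 * r0 * a"
    using n1 le C0 a by (intro mult_mono) auto
  also have "\<dots> \<le> 1/2 * a" using C0 a by (intro mult_right_mono)
  finally have "norm (\<phi> (nmul n g + g)) \<le> 2 * real (Suc n) * a" using n1 a by (simp add: algebra_simps)
  then show ?case using add_estimate(2)[OF s] by (simp add: small_def)
qed

lemma small_tendsto_0:
  assumes "\<forall>\<^sub>F n in F. small (s n) (a n)" "(s \<longlongrightarrow> 0) F"
  shows "(a \<longlongrightarrow> 0) F"
proof -
  have 1: "((\<lambda>n. \<phi> (a n)) \<longlongrightarrow> 0) F"
    by (rule Lim_null_comparison[OF _ assms(2)]) (use assms(1) in \<open>auto simp: small_def elim: eventually_mono\<close>)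
  have "((\<lambda>n. \<psi> (\<phi> (a n))) \<longlongrightarrow> \<psi> 0) F"
    by (rule isCont_tendsto_compose[OF isCont_\<psi> 1]) (use C0 in simp)
  moreover have "\<forall>\<^sub>F n in F. \<psi> (\<phi> (a n)) = a n"
    using assms(1) by eventually_elim (simp add: small_def \<psi>_\<phi>)
  ultimately show ?thesis using tendsto_cong by force
qed


definition dyadic :: "nat \<Rightarrow> 'f \<Rightarrow> 'g" where
  "dyadic n v = nmul (2 ^ n) (\<psi> (v /\<^sub>R 2 ^ n))"

lemma dyadic_shift: "dyadic (n + k) v = nmul (2 ^ k) (dyadic n (v /\<^sub>R 2 ^ k))"
  by (simp add: dyadic_def power_add nmul_mult[symmetric] mult.commute field_simps)

lemma norm_dyadic: "norm (v /\<^sub>R 2 ^ n) = norm v / 2 ^ n"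
  by (simp add: divide_inverse mult.commute)

lemma norm_dyadic_le: "norm (v /\<^sub>R 2 ^ n) \<le> norm v"
proof -
  have "norm v / 2 ^ n \<le> norm v / 1" by (rule divide_left_mono) auto
  then show ?thesis unfolding norm_dyadic by simp
qed

lemma dyadic_small:
  assumes "2 * norm v \<le> r0" shows "small (2 * norm v) (dyadic n v)"
proof -
  have n1: "norm (v /\<^sub>R 2 ^ n) \<le> r0"
    using assms norm_dyadic_le[of n v] norm_ge_zero[of v] by linarith
  have eq: "2 * real (2 ^ n) * norm (v /\<^sub>R 2 ^ n) = 2 * norm v" unfolding norm_dyadic by simp
  have "small (2 * real (2 ^ n) * norm (v /\<^sub>R 2 ^ n)) (dyadic n v)"
    unfolding dyadic_def
    by (rule small_nmul[OF small_\<psi>[OF order_refl n1]]) (use assms eq in linarith)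
  then show ?thesis unfolding eq .
qed

text \<open>Consecutive approximations differ by \<open>2\<^sup>n\<cdot>\<delta>\<close>, where
  \<open>\<delta> = 2\<cdot>\<psi>(v/2\<^bsup>n+1\<^esup>) - \<psi>(v/2\<^sup>n)\<close> is of size
  \<open>4\<^bsup>-n\<^esup>\<close> by the estimate of the group law.  Commutativity enters in
  pulling \<open>\<delta>\<close> out of the multiple.\<close>

lemma dyadic_step:
  assumes v: "4 * norm v \<le> r0"
  shows "norm (\<phi> (dyadic (Suc n) v) - \<phi> (dyadic n v)) \<le> 2 * C0 * (norm v)\<^sup>2 / 2 ^ n"
proof -
  define x where "x = v /\<^sub>R 2 ^ Suc n"
  define \<delta> where "\<delta> = nmul 2 (\<psi> x) - \<psi> (v /\<^sub>R 2 ^ n)"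
  have nx: "norm x = norm v / 2 ^ Suc n" unfolding x_def by (rule norm_dyadic)
  have v2: "v /\<^sub>R 2 ^ n = 2 *\<^sub>R x" by (simp add: x_def)
  have xv: "norm x \<le> norm v" unfolding x_def by (rule norm_dyadic_le)
  have "norm (2 *\<^sub>R x) = 2 * norm x" by simp
  then have xr: "norm x \<le> r0" "norm (2 *\<^sub>R x) \<le> r0" using v xv norm_ge_zero[of v] by linarith+
  have s\<psi>: "small r0 (\<psi> x)" "small r0 (\<psi> (2 *\<^sub>R x))" using xr small_\<psi> by auto
  have n2: "nmul 2 (\<psi> x) = \<psi> x + \<psi> x" by (simp add: numeral_2_eq_2)
  have s2: "small r0 (\<psi> x + \<psi> x)"
  proof -
    have "small (2 * real 2 * norm x) (nmul 2 (\<psi> x))"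
      by (rule small_nmul[OF small_\<psi>[OF order_refl xr(1)]])
         (use xv v in simp)
    then show ?thesis unfolding n2 by (rule small_mono) (use xv v in simp)
  qed
  have "norm (\<phi> \<delta>) \<le> 2 * norm (\<phi> (\<psi> x + \<psi> x) - \<phi> (\<psi> (2 *\<^sub>R x)))" "\<delta> \<in> fst c0"
    unfolding \<delta>_def n2 v2 using diff_estimate[OF s2 s\<psi>(2)] by auto
  moreover have "norm (\<phi> (\<psi> x + \<psi> x) - \<phi> (\<psi> (2 *\<^sub>R x))) \<le> C0 * norm x * norm x"
    using add_estimate(1)[OF s\<psi>(1) s\<psi>(1)] xr by (simp add: \<phi>_\<psi> scaleR_2 algebra_simps)
  ultimately have \<delta>s: "small (2 * (C0 * norm x * norm x)) \<delta>" unfolding small_def by linarith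
  have bnd: "2 * real (2 ^ n) * (2 * (C0 * norm x * norm x)) = C0 * (norm v)\<^sup>2 / 2 ^ n"
    unfolding nx by (simp add: field_simps power2_eq_square)
  have "C0 * (norm v)\<^sup>2 / 2 ^ n \<le> C0 * (norm v)\<^sup>2 / 1"
    using C0(1) by (intro divide_left_mono) auto
  also have "C0 * (norm v)\<^sup>2 \<le> C0 * (r0 * norm v)"
  proof -
    have "norm v \<le> r0" using v norm_ge_zero[of v] by linarith
    then show ?thesis
      using C0(1) unfolding power2_eq_square by (intro mult_left_mono mult_right_mono) auto
  qed
  also have "\<dots> = (C0 * r0) * norm v" by simp
  also have "\<dots> \<le> 1/2 * norm v" using C0(3) by (intro mult_right_mono) auto
  finally have bnd2: "C0 * (norm v)\<^sup>2 / 2 ^ n \<le> r0" using v norm_ge_zero[of v] by linarith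
  define D where "D = nmul (2 ^ n) \<delta>"
  have D: "small (C0 * (norm v)\<^sup>2 / 2 ^ n) D"
    unfolding D_def using small_nmul[OF \<delta>s, of "2 ^ n"] bnd bnd2 by simp
  have eq: "dyadic (Suc n) v = dyadic n v + D"
  proof -
    have "dyadic (Suc n) v = nmul (2 ^ n) (nmul 2 (\<psi> x))"
      unfolding dyadic_def x_def by (simp add: nmul_mult[symmetric] mult.commute del: nmul.simps)
    also have "\<dots> = nmul (2 ^ n) (\<psi> (v /\<^sub>R 2 ^ n) + \<delta>)" by (simp add: \<delta>_def)
    finally show ?thesis by (simp add: nmul_add D_def dyadic_def)
  qed
  have sd: "small r0 (dyadic n v)" "small r0 D"
  proof -
    have "2 * norm v \<le> r0" using v norm_ge_zero[of v] by linarith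
    then show "small r0 (dyadic n v)" using small_mono[OF dyadic_small] by blast
    show "small r0 D" using small_mono[OF D bnd2] .
  qed
  have "norm (\<phi> (dyadic n v + D) - \<phi> (dyadic n v)) \<le>
      norm (\<phi> D) + C0 * norm (\<phi> (dyadic n v)) * norm (\<phi> D)"
    using add_estimate(1)[OF sd] norm_triangle_ineq2[of "\<phi> (dyadic n v + D) - \<phi> (dyadic n v)" "\<phi> D"]
    by (simp add: algebra_simps)
  also have "C0 * norm (\<phi> (dyadic n v)) * norm (\<phi> D) \<le> C0 * r0 * norm (\<phi> D)"
    using sd C0(1) by (intro mult_right_mono mult_left_mono) (auto simp: small_def)
  also have "\<dots> \<le> 1/2 * norm (\<phi> D)" using C0(3) by (intro mult_right_mono) auto
  finally have "norm (\<phi> (dyadic n v + D) - \<phi> (dyadic n v)) \<le> 2 * norm (\<phi> D)"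
    using norm_ge_zero[of "\<phi> D"] by linarith
  also have "\<dots> \<le> 2 * (C0 * (norm v)\<^sup>2 / 2 ^ n)" using D unfolding small_def by simp
  finally show ?thesis by (simp add: eq mult.assoc)
qed

lemma dyadic_limit_near_0:
  assumes v: "8 * norm v \<le> r0"
  obtains x where "(\<lambda>n. dyadic n v) \<longlonglongrightarrow> \<psi> x" "norm (x - v) \<le> 4 * C0 * (norm v)\<^sup>2" "norm x \<le> r0"
proof -
  have v4: "4 * norm v \<le> r0" and v2: "2 * norm v \<le> r0" and v1: "norm v \<le> r0"
    using v norm_ge_zero[of v] by linarith+
  obtain x where x: "(\<lambda>n. \<phi> (dyadic n v)) \<longlonglongrightarrow> x" "norm (x - \<phi> (dyadic 0 v)) \<le> 2 * (2 * C0 * (norm v)\<^sup>2)"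
    using dyadic_Cauchy_limit[OF fdB dyadic_step[OF v4]] by metis
  have d0: "\<phi> (dyadic 0 v) = v" by (simp add: dyadic_def \<phi>_\<psi>[OF v1])
  have small: "dyadic n v \<in> fst c0" "norm (\<phi> (dyadic n v)) \<le> r0" for n
    using dyadic_small[OF v2, of n] v2 unfolding small_def by auto
  have xr: "norm x \<le> r0"
    by (rule LIMSEQ_le_const2[OF tendsto_norm[OF x(1)]]) (use small in auto)
  have "(\<lambda>n. \<psi> (\<phi> (dyadic n v))) \<longlonglongrightarrow> \<psi> x"
    by (rule isCont_tendsto_compose[OF isCont_\<psi>[OF xr] x(1)])
  then have "(\<lambda>n. dyadic n v) \<longlonglongrightarrow> \<psi> x" by (simp add: \<psi>_\<phi>[OF small(1)])
  then show ?thesis using that x(2) d0 xr by simp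
qed

definition expo :: "'f \<Rightarrow> 'g" where "expo v = lim (\<lambda>n. dyadic n v)"

text \<open>Near 0 this is \<open>dyadic_limit_near_0\<close>; a general \<open>v\<close> is first
  divided by a power of 2, which shifts the sequence.\<close>

lemma dyadic_tendsto_expo: "(\<lambda>n. dyadic n v) \<longlonglongrightarrow> expo v"
proof -
  have "(\<lambda>k. norm v * (1 / 2) ^ k) \<longlonglongrightarrow> norm v * 0"
    by (intro tendsto_mult tendsto_const LIMSEQ_power_zero) simp
  then have "\<forall>\<^sub>F k in sequentially. norm v * (1 / 2) ^ k < r0 / 8"
    using C0(2) by (intro order_tendstoD) auto
  then obtain k where "norm v * (1 / 2) ^ k < r0 / 8" unfolding eventually_sequentially by blast
  then have "8 * norm (v /\<^sub>R 2 ^ k) \<le> r0" by (simp add: power_one_over field_simps)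
  then obtain x where "(\<lambda>n. dyadic n (v /\<^sub>R 2 ^ k)) \<longlonglongrightarrow> \<psi> x" using dyadic_limit_near_0 by metis
  then have "(\<lambda>n. dyadic (n + k) v) \<longlonglongrightarrow> nmul (2 ^ k) (\<psi> x)"
    unfolding dyadic_shift by (rule tendsto_nmul_g)
  then have "(\<lambda>n. dyadic n v) \<longlonglongrightarrow> nmul (2 ^ k) (\<psi> x)" by (rule LIMSEQ_offset)
  then show ?thesis unfolding expo_def using limI by force
qed

lemma expo_near_0:
  assumes v: "8 * norm v \<le> r0"
  shows "expo v \<in> fst c0" "norm (\<phi> (expo v)) \<le> r0" "norm (\<phi> (expo v) - v) \<le> 4 * C0 * (norm v)\<^sup>2"
proof -
  obtain x where x: "(\<lambda>n. dyadic n v) \<longlonglongrightarrow> \<psi> x" "norm (x - v) \<le> 4 * C0 * (norm v)\<^sup>2" "norm x \<le> r0"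
    using dyadic_limit_near_0[OF v] .
  have "expo v = \<psi> x" using LIMSEQ_unique[OF dyadic_tendsto_expo x(1)] .
  then show "expo v \<in> fst c0" "norm (\<phi> (expo v)) \<le> r0" "norm (\<phi> (expo v) - v) \<le> 4 * C0 * (norm v)\<^sup>2"
    using x \<psi>_in \<phi>_\<psi> by auto
qed

text \<open>The defect \<open>\<psi>(v') + \<psi>(w') - \<psi>(v' + w')\<close> at \<open>v' =
  v/2\<^sup>n\<close>, \<open>w' = w/2\<^sup>n\<close> has size \<open>4\<^bsup>-n\<^esup>\<close>,
  so its multiple by \<open>2\<^sup>n\<close> tends to 0.\<close>

lemma expo_add: "expo (v + w) = expo v + expo w"
proof -
  define s where "s n = 4 * (C0 * norm v * norm w) / 2 ^ n" for n :: nat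
  have pw: "(\<lambda>n. a / 2 ^ n) \<longlonglongrightarrow> 0" for a :: real
    by (rule LIMSEQ_divide_realpow_zero) simp
  have s0: "s \<longlonglongrightarrow> 0" unfolding s_def by (rule pw)
  have ev: "\<forall>\<^sub>F n in sequentially. norm (u /\<^sub>R 2 ^ n) \<le> r0 / 4" for u :: 'f
  proof -
    have "\<forall>\<^sub>F n in sequentially. norm u / 2 ^ n < r0 / 4"
      using C0(2) by (intro order_tendstoD(2)[OF pw]) simp
    then show ?thesis unfolding norm_dyadic by eventually_elim simp
  qed
  have evs: "\<forall>\<^sub>F n in sequentially. s n \<le> r0"
    using order_tendstoD(2)[OF s0 C0(2)] by eventually_elim simp
  have "\<forall>\<^sub>F n in sequentially. small (s n) (dyadic n v + dyadic n w - dyadic n (v + w))"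
    using ev[of v] ev[of w] ev[of "v + w"] evs
  proof eventually_elim
    case (elim n)
    define v' where "v' = v /\<^sub>R 2 ^ n"
    define w' where "w' = w /\<^sub>R 2 ^ n"
    have vw: "(v + w) /\<^sub>R 2 ^ n = v' + w'" by (simp add: v'_def w'_def scaleR_add_right)
    have r4: "norm v' \<le> r0 / 4" "norm w' \<le> r0 / 4" "norm (v' + w') \<le> r0 / 4"
      using elim(1-3) unfolding vw v'_def[symmetric] w'_def[symmetric] .
    then have r: "norm v' \<le> r0" "norm w' \<le> r0" "norm (v' + w') \<le> r0" using C0(2) by linarith+
    have sm: "small r0 (\<psi> v')" "small r0 (\<psi> w')" "small r0 (\<psi> (v' + w'))" using r small_\<psi> by auto
    have est: "norm (\<phi> (\<psi> v' + \<psi> w') - (v' + w')) \<le> C0 * norm v' * norm w'"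
      using add_estimate(1)[OF sm(1,2)] by (simp only: \<phi>_\<psi>[OF r(1)] \<phi>_\<psi>[OF r(2)] diff_diff_eq)
    have "C0 * norm v' * norm w' \<le> C0 * r0 * (r0 / 4)"
      using r4 r C0 by (intro mult_mono) auto
    also have "\<dots> \<le> 1/2 * (r0 / 4)" using C0 by (intro mult_right_mono) auto
    finally have "norm (\<phi> (\<psi> v' + \<psi> w')) \<le> r0"
      using est r4 C0(2) norm_triangle_ineq2[of "\<phi> (\<psi> v' + \<psi> w')" "v' + w'"] by linarith
    then have sm2: "small r0 (\<psi> v' + \<psi> w')" using add_estimate(2)[OF sm(1,2)] by (simp add: small_def)
    have "norm (\<phi> (\<psi> v' + \<psi> w' - \<psi> (v' + w'))) \<le> 2 * (C0 * norm v' * norm w')"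
      using diff_estimate(1)[OF sm2 sm(3)] est unfolding \<phi>_\<psi>[OF r(3)] by linarith
    then have d: "small (2 * (C0 * norm v' * norm w')) (\<psi> v' + \<psi> w' - \<psi> (v' + w'))"
      using diff_estimate(2)[OF sm2 sm(3)] by (simp add: small_def)
    have eq: "2 * real (2 ^ n) * (2 * (C0 * norm v' * norm w')) = s n"
      unfolding v'_def w'_def norm_dyadic by (simp add: s_def)
    have "small (2 * real (2 ^ n) * (2 * (C0 * norm v' * norm w'))) (nmul (2 ^ n) (\<psi> v' + \<psi> w' - \<psi> (v' + w')))"
      by (rule small_nmul[OF d]) (use elim(4) eq in linarith)
    then show ?case unfolding eq by (simp add: dyadic_def nmul_add nmul_diff vw v'_def[symmetric] w'_def[symmetric])
  qed
  from small_tendsto_0[OF this s0]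
  have "(\<lambda>n. dyadic n v + dyadic n w - dyadic n (v + w)) \<longlonglongrightarrow> 0" .
  moreover have "(\<lambda>n. dyadic n v + dyadic n w - dyadic n (v + w)) \<longlonglongrightarrow> expo v + expo w - expo (v + w)"
    by (intro tendsto_diff_g tendsto_add_g dyadic_tendsto_expo)
  ultimately have "expo v + expo w - expo (v + w) = 0" using LIMSEQ_unique by blast
  then show ?thesis by simp
qed

lemma expo_0 [simp]: "expo 0 = 0"
  using expo_add[of 0 0] by simp

lemma expo_diff: "expo (v - w) = expo v - expo w"
  using expo_add[of "v - w" w] by (simp add: algebra_simps)

lemma expo_has_derivative_0: "((\<lambda>v. \<phi> (expo v)) has_derivative (\<lambda>v. v)) (at 0)"
  unfolding has_derivative_iff_norm
proof (intro conjI bounded_linear_ident)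
  have l: "((\<lambda>v::'f. 4 * C0 * norm v) \<longlongrightarrow> 4 * C0 * norm (0::'f)) (at 0)" by (intro tendsto_intros)
  have "\<forall>\<^sub>F v::'f in at 0. norm v < r0 / 8"
    unfolding eventually_at using C0(2) by (intro exI[of _ "r0 / 8"]) auto
  then have "\<forall>\<^sub>F v::'f in at 0. norm (norm (\<phi> (expo v) - \<phi> (expo 0) - (v - 0)) / norm (v - 0)) \<le> 4 * C0 * norm v"
  proof eventually_elim
    case (elim v)
    then have "norm (\<phi> (expo v) - v) \<le> 4 * C0 * norm v * norm v"
      using expo_near_0(3)[of v] by (simp add: power2_eq_square)
    then show ?case by (cases "v = 0") (simp_all add: divide_le_eq)
  qed
  from Lim_null_comparison[OF this] l
  show "((\<lambda>v. norm (\<phi> (expo v) - \<phi> (expo 0) - (v - 0)) / norm (v - 0)) \<longlongrightarrow> 0) (at 0)" by simp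
qed

lemma gprod_expo:
  assumes "8 * norm v \<le> r0" "8 * norm w \<le> r0"
  shows "\<phi> (expo (v + w)) = gprod (\<phi> (expo v), \<phi> (expo w))"
  using expo_near_0(1)[OF assms(1)] expo_near_0(1)[OF assms(2)]
  by (simp add: gprod_def \<psi>_\<phi> expo_add)

text \<open>Additivity turns the derivative at 0 into the differential equation
  \<open>D\<epsilon>(v) u = D\<^sub>2F(\<epsilon> v, 0) u\<close> for \<open>\<epsilon> = \<phi>
  \<circ> exp\<close>, with a smooth right-hand side.  It raises the differentiability of
  \<open>\<epsilon>\<close> by one each time it is used.\<close>

lemma smooth_at_\<phi>_expo:
  obtains d where "d > 0" "\<And>v. norm v < d \<Longrightarrow> smooth_at (\<lambda>v. \<phi> (expo v)) v"
proof -
  define \<epsilon> where "\<epsilon> v = \<phi> (expo v)" for v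
  have \<epsilon>0: "\<epsilon> 0 = 0" by (simp add: \<epsilon>_def)
  have "\<forall>\<^sub>F z in nhds (0, 0). smooth_at gprod z" by (rule smooth_at_eventually[OF smooth_gprod])
  moreover have "isCont (\<lambda>x::'f. (x, 0::'f)) 0" by (intro continuous_intros)
  ultimately have ev: "\<forall>\<^sub>F x in nhds 0. smooth_at gprod (x, 0)"
    using isCont_eventually_compose[of 0 "\<lambda>x::'f. (x, 0::'f)" "smooth_at gprod"] by simp
  have "isCont \<epsilon> 0" using has_derivative_continuous[OF expo_has_derivative_0] unfolding \<epsilon>_def by simp
  then have "\<forall>\<^sub>F v in nhds 0. smooth_at gprod (\<epsilon> v, 0)"
    using isCont_eventually_compose[of 0 \<epsilon> "\<lambda>x. smooth_at gprod (x, 0)"] ev \<epsilon>0 by simp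
  then obtain d1 where d1: "d1 > 0" "\<And>v. dist v 0 < d1 \<Longrightarrow> smooth_at gprod (\<epsilon> v, 0)"
    unfolding eventually_nhds_metric by blast
  define d where "d = min d1 (r0 / 8)"
  have d: "d > 0" using d1 C0 by (simp add: d_def)
  define D where "D v u = frechet_derivative gprod (at (\<epsilon> v, 0)) (0, u)" for v u
  have der: "(\<epsilon> has_derivative D v) (at v)" if v: "v \<in> ball 0 d" for v
  proof -
    have vd: "norm v < d1" "8 * norm v \<le> r0" using v by (auto simp: d_def)
    have sm: "smooth_at gprod (\<epsilon> v, 0)" using d1(2)[of v] vd by simp
    have "((\<lambda>w. w - v) has_derivative (\<lambda>u. u)) (at v)"
      using has_derivative_diff[OF has_derivative_ident has_derivative_const] by fastforce
    moreover have "(\<epsilon> has_derivative (\<lambda>u. u)) (at (v - v))" using expo_has_derivative_0 unfolding \<epsilon>_def by simp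
    ultimately have "((\<lambda>w. \<epsilon> (w - v)) has_derivative (\<lambda>u. u)) (at v)"
      by (rule has_derivative_compose)
    then have 1: "((\<lambda>w. (\<epsilon> v, \<epsilon> (w - v))) has_derivative (\<lambda>u. (0, u))) (at v)"
      by (intro has_derivative_Pair has_derivative_const)
    have "((\<lambda>w. gprod (\<epsilon> v, \<epsilon> (w - v))) has_derivative D v) (at v)"
      unfolding D_def
      by (rule has_derivative_compose[OF 1]) (use smooth_at_has_derivative[OF sm] \<epsilon>0 in simp)
    then show ?thesis
    proof (rule has_derivative_transform_within_open[of _ _ _ _ "ball v (r0 / 8)"])
      fix w assume "w \<in> ball v (r0 / 8)"
      then have "8 * norm (w - v) \<le> r0" by (simp add: dist_norm norm_minus_commute)
      from gprod_expo[OF vd(2) this] show "gprod (\<epsilon> v, \<epsilon> (w - v)) = \<epsilon> w" by (simp add: \<epsilon>_def)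
    qed (use C0 in auto)
  qed
  define S where "S = {x. smooth_at gprod (x, 0)}"
  have smH: "smooth_on S (\<lambda>x. frechet_derivative gprod (at (x, 0)) (0, u))" for u
  proof (rule smooth_on_smooth_at)
    fix x assume "x \<in> S"
    then have "smooth_at gprod (x, 0)" by (simp add: S_def)
    from smooth_at_frechet_derivative[OF this, of "(0, u)"]
    show "smooth_at (\<lambda>x. frechet_derivative gprod (at (x, 0)) (0, u)) x"
      by (intro smooth_at_compose[OF finite_dim_prod[OF fdB fdB], of "\<lambda>x. (x, 0)" x
            "\<lambda>z. frechet_derivative gprod (at z) (0, u)"] smooth_at_Pair) auto
  qed
  have "Ck_on k (ball 0 d) \<epsilon>" for k
  proof (induction k)
    case 0
    show ?case using has_derivative_continuous[OF der]
      by (auto intro!: continuous_at_imp_continuous_on)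
  next
    case (Suc k)
    show ?case
    proof (rule Ck_on_SucI[OF open_ball der])
      fix u
      have "Ck_on k S (\<lambda>x. frechet_derivative gprod (at (x, 0)) (0, u))"
        using smH smooth_on_def by blast
      then show "Ck_on k (ball 0 d) (\<lambda>v. D v u)" unfolding D_def
        by (rule Ck_on_compose[OF fdB open_ball Suc]) (use d1(2) in \<open>auto simp: S_def d_def\<close>)
    qed
  qed
  then have "smooth_on (ball 0 d) \<epsilon>" using smooth_on_def by blast
  then have "smooth_at \<epsilon> v" if "norm v < d" for v using smooth_at_smooth_on[of "ball 0 d"] that by simp
  then show ?thesis using that[of d] d unfolding \<epsilon>_def by blast
qed

lemma smooth_at_\<phi>_expo_0: "smooth_at (\<lambda>v. \<phi> (expo v)) 0"
proof -
  obtain d where "d > 0" "\<And>v. norm v < d \<Longrightarrow> smooth_at (\<lambda>v. \<phi> (expo v)) v" using smooth_at_\<phi>_expo by blast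
  then show ?thesis by simp
qed

lemma isCont_expo: "isCont expo v"
proof -
  have e0: "(expo \<longlongrightarrow> 0) (at 0)"
  proof (rule small_tendsto_0)
    show "\<forall>\<^sub>F v in at 0. small (norm (\<phi> (expo v))) (expo v)"
      unfolding eventually_at small_def using C0(2) expo_near_0(1)
      by (intro exI[of _ "r0 / 8"]) auto
    have "((\<lambda>v. \<phi> (expo v)) \<longlongrightarrow> \<phi> (expo 0)) (at 0)"
      using has_derivative_continuous[OF expo_has_derivative_0] by (simp add: isCont_def)
    then show "((\<lambda>v. norm (\<phi> (expo v))) \<longlongrightarrow> 0) (at 0)" by (simp add: tendsto_norm_zero)
  qed
  have "((\<lambda>h. expo v + expo h) \<longlongrightarrow> expo v + 0) (at 0)" by (intro tendsto_add_g e0 tendsto_const)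
  then have "((\<lambda>h. expo (v + h)) \<longlongrightarrow> expo v) (at 0)" by (simp add: expo_add)
  then show ?thesis by (simp add: isCont_iff)
qed

lemma smooth_at_translate:
  assumes c: "c \<in> B" "a \<in> fst c" and d: "d \<in> B" "a + g \<in> fst d" "g \<in> fst e" and e: "e \<in> B"
  shows "smooth_at (\<lambda>(x, y). snd d (chart_inv c x + chart_inv e y)) (snd c a, snd e g)"
proof -
  have "smooth_at (\<lambda>(x, y). snd d (case (chart_inv c x, chart_inv e y) of (a, b) \<Rightarrow> a + b)) (snd c a, snd e g)"
    by (rule smooth_map_from_prod[OF smooth_add])
       (use c d e smooth_manifold_is_chart[OF smooth_manifold_B] in auto)
  then show ?thesis by simp
qed

text \<open>Smoothness at \<open>v\<close> is transported from 0 by \<open>exp w = exp v + exp (w -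
  v)\<close>.\<close>

lemma smooth_at_expo:
  assumes d: "d \<in> B" "expo v \<in> fst d"
  shows "smooth_at (\<lambda>v. snd d (expo v)) v"
proof -
  obtain c where c: "c \<in> B" "expo v \<in> fst c" using atlas_chart_exists[OF smooth_manifold_B] .
  have ch: "is_chart c" using smooth_manifold_is_chart[OF smooth_manifold_B c(1)] .
  have 1: "smooth_at (\<lambda>(x, y). snd d (chart_inv c x + chart_inv c0 y)) (snd c (expo v), snd c0 0)"
    by (rule smooth_at_translate) (use c d c0 in auto)
  have "smooth_at (\<lambda>w. w - v) v" by (intro smooth_at_diff) auto
  then have "smooth_at (\<lambda>w. \<phi> (expo (w - v))) v"
    by (rule smooth_at_compose[OF fdB]) (simp add: smooth_at_\<phi>_expo_0)
  then have "smooth_at (\<lambda>w. (snd c (expo v), \<phi> (expo (w - v)) + snd c0 0)) v"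
    by (intro smooth_at_Pair smooth_at_add) auto
  from smooth_at_compose[OF finite_dim_prod[OF fdB fdB] this, of "\<lambda>(x, y). snd d (chart_inv c x + chart_inv c0 y)"] 1
  have "smooth_at (\<lambda>w. snd d (chart_inv c (snd c (expo v)) + chart_inv c0 (\<phi> (expo (w - v)) + snd c0 0))) v"
    by simp
  then show ?thesis
  proof (rule smooth_at_transform)
    have "\<forall>\<^sub>F w in nhds v. w \<in> ball v (r0 / 8)" using C0 by (intro eventually_nhds_in_open) auto
    then show "\<forall>\<^sub>F w in nhds v. snd d (chart_inv c (snd c (expo v)) + chart_inv c0 (\<phi> (expo (w - v)) + snd c0 0)) = snd d (expo w)"
    proof eventually_elim
      case (elim w)
      then have "expo (w - v) \<in> fst c0"
        by (intro expo_near_0) (simp add: dist_norm norm_minus_commute)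
      then show ?case by (simp add: chart_inv_left[OF ch c(2)] \<phi>_def chart_inv_left[OF c0(3)] expo_diff)
    qed
  qed
qed

lemma smooth_expo_line: "smooth_map vs_atlas B (\<lambda>t::real. expo (t *\<^sub>R \<zeta>))"
  unfolding smooth_map_def
proof (intro conjI ballI)
  show "continuous_on UNIV (\<lambda>t::real. expo (t *\<^sub>R \<zeta>))"
  proof (intro continuous_at_imp_continuous_on ballI)
    fix t :: real
    show "isCont (\<lambda>t. expo (t *\<^sub>R \<zeta>)) t"
      by (rule isCont_o2[OF _ isCont_expo]) (intro continuous_intros)
  qed
  fix c d assume "c \<in> (vs_atlas :: (real, real) chart set)" and d: "d \<in> B"
  then have c: "c = (UNIV, id)" by (simp add: vs_atlas_def)
  show "smooth_on (snd c ` (fst c \<inter> (\<lambda>t. expo (t *\<^sub>R \<zeta>)) -` fst d)) (in_charts c d (\<lambda>t. expo (t *\<^sub>R \<zeta>)))"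
  proof (rule smooth_on_smooth_at)
    fix t assume "t \<in> snd c ` (fst c \<inter> (\<lambda>t. expo (t *\<^sub>R \<zeta>)) -` fst d)"
    then have t: "expo (t *\<^sub>R \<zeta>) \<in> fst d" unfolding c by auto
    have "smooth_at (\<lambda>t::real. t *\<^sub>R \<zeta>) t" by (intro smooth_at_scaleR) auto
    from smooth_at_compose[OF fdB this smooth_at_expo[OF d t]]
    show "smooth_at (in_charts c d (\<lambda>t. expo (t *\<^sub>R \<zeta>))) t"
      unfolding c by (simp add: in_charts_def comp_def)
  qed
qed

lemma has_velocity_at_0_iff:
  assumes "c 0 = 0"
  shows "has_velocity B c \<zeta> 0 \<longleftrightarrow> isCont c 0 \<and> ((\<lambda>t. \<phi> (c t)) has_derivative (\<lambda>s. s *\<^sub>R \<zeta>)) (at 0)"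
proof -
  have "((\<lambda>t. \<phi> (c t)) has_derivative (\<lambda>s. s *\<^sub>R \<zeta>)) (at 0) \<longleftrightarrow>
      ((\<lambda>t. snd c0 (c t)) has_derivative (\<lambda>s. s *\<^sub>R \<zeta>)) (at 0)"
    (is "?l \<longleftrightarrow> ?r")
  proof
    assume ?r
    from has_derivative_diff[OF this has_derivative_const[of "snd c0 0"]] show ?l by (simp add: \<phi>_def)
  next
    assume ?l
    from has_derivative_add[OF this has_derivative_const[of "snd c0 0"]] show ?r by (simp add: \<phi>_def)
  qed
  then show ?thesis unfolding has_velocity_def has_mderiv_def
    by (simp add: assms c0_def[symmetric] in_charts_def comp_def)
qed

lemma expo_line_velocity: "has_velocity B (\<lambda>t. expo (t *\<^sub>R \<zeta>)) \<zeta> 0"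
proof -
  have l: "((\<lambda>t::real. t *\<^sub>R \<zeta>) has_derivative (\<lambda>s. s *\<^sub>R \<zeta>)) (at 0)"
    by (auto intro!: derivative_eq_intros)
  have "((\<lambda>v. \<phi> (expo v)) has_derivative (\<lambda>v. v)) (at (0 *\<^sub>R \<zeta>))" using expo_has_derivative_0 by simp
  from has_derivative_compose[OF l this]
  show ?thesis using smooth_map_isCont[OF smooth_expo_line] by (subst has_velocity_at_0_iff) auto
qed

lemma one_parameter_subgroup_expo: "one_parameter_subgroup B \<zeta> (\<lambda>t. expo (t *\<^sub>R \<zeta>))"
  unfolding one_parameter_subgroup_def
  using smooth_expo_line expo_line_velocity by (simp add: scaleR_add_left expo_add)

lemma homomorphism_nmul:
  fixes c :: "real \<Rightarrow> 'g"
  assumes "\<And>s t. c (s + t) = c s + c t" shows "nmul n (c t) = c (real n * t)"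
proof (induction n)
  case 0
  then show ?case using assms[of 0 0] by simp
next
  case (Suc n)
  then show ?case using assms[of "real n * t" t] by (simp add: algebra_simps)
qed

text \<open>The difference \<open>k\<close> of two one-parameter subgroups with the same velocity
  satisfies \<open>k(t) = n\<cdot>k(t/n)\<close> with \<open>|k(t/n)| = o(1/n)\<close>, so
  \<open>k(t)\<close> is arbitrarily small.\<close>

lemma one_parameter_subgroup_unique:
  assumes c: "one_parameter_subgroup B \<zeta> c"
  shows "c = (\<lambda>t. expo (t *\<^sub>R \<zeta>))"
proof
  fix t
  define e where "e s = expo (s *\<^sub>R \<zeta>)" for s :: real
  have add: "c (s + u) = c s + c u" "e (s + u) = e s + e u" for s u
    using c unfolding one_parameter_subgroup_def by (auto simp: e_def scaleR_add_left expo_add)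
  have c0': "c 0 = 0" "e 0 = 0" using add[of 0 0] by auto
  have vc: "isCont c 0" "((\<lambda>t. \<phi> (c t)) has_derivative (\<lambda>s. s *\<^sub>R \<zeta>)) (at 0)"
    using c has_velocity_at_0_iff[of c \<zeta>] c0'(1) unfolding one_parameter_subgroup_def by auto
  have ve: "isCont e 0" "((\<lambda>t. \<phi> (e t)) has_derivative (\<lambda>s. s *\<^sub>R \<zeta>)) (at 0)"
    using expo_line_velocity[of \<zeta>] has_velocity_at_0_iff[of e \<zeta>] c0'(2) unfolding e_def[abs_def] by auto
  define k where "k s = c s - e s" for s
  have kadd: "k (s + u) = k s + k u" for s u by (simp add: k_def add algebra_simps)
  have d0: "((\<lambda>s. \<phi> (c s) - \<phi> (e s)) has_derivative (\<lambda>s. 0)) (at 0)"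
    using has_derivative_diff[OF vc(2) ve(2)] by simp
  define N where "N = {g \<in> fst c0. norm (\<phi> g) < r0}"
  have oN: "open N" unfolding N_def by (rule open_small)
  have N0: "0 \<in> N" unfolding N_def using c0 C0 by simp
  have evN: "\<forall>\<^sub>F s in nhds 0. c s \<in> N" "\<forall>\<^sub>F s in nhds 0. e s \<in> N"
    using isCont_eventually_in[OF vc(1) oN] isCont_eventually_in[OF ve(1) oN] N0 c0' by auto
  have ks: "\<forall>\<^sub>F s in nhds 0. small (2 * norm (\<phi> (c s) - \<phi> (e s))) (k s)"
    using evN
  proof eventually_elim
    case (elim s)
    then have "small r0 (c s)" "small r0 (e s)" by (auto simp: N_def small_def)
    from diff_estimate[OF this] show ?case by (simp add: small_def k_def)
  qed
  define q where "q s = norm (\<phi> (c s) - \<phi> (e s)) / norm s" for s :: real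
  have q: "(q \<longlongrightarrow> 0) (at 0)"
    using d0 unfolding has_derivative_iff_norm q_def by (simp add: c0')
  show "c t = expo (t *\<^sub>R \<zeta>)"
  proof (cases "t = 0")
    case True
    then show ?thesis using c0' by (simp add: e_def)
  next
    case False
    define tn where "tn n = t / real (Suc n)" for n
    have "(\<lambda>n. t * inverse (real (Suc n))) \<longlonglongrightarrow> t * 0"
      by (intro tendsto_intros LIMSEQ_inverse_real_of_nat)
    then have tn0: "tn \<longlonglongrightarrow> 0" by (simp add: tn_def[abs_def] divide_inverse)
    then have fl: "filterlim tn (at 0) sequentially"
      using False by (intro filterlim_atI) (auto simp: tn_def)
    have q2: "(\<lambda>n. 4 * norm t * q (tn n)) \<longlonglongrightarrow> 4 * norm t * 0"
      by (intro tendsto_intros filterlim_compose[OF q fl])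
    have sc: "2 * real (Suc n) * (2 * norm (\<phi> (c (tn n)) - \<phi> (e (tn n)))) = 4 * norm t * q (tn n)" for n
      using False by (simp add: q_def tn_def field_simps)
    have ev1: "\<forall>\<^sub>F n in sequentially. small (2 * norm (\<phi> (c (tn n)) - \<phi> (e (tn n)))) (k (tn n))"
      using filterlim_iff[THEN iffD1, OF tn0] ks by blast
    have ev2: "\<forall>\<^sub>F n in sequentially. 4 * norm t * q (tn n) < r0"
      using order_tendstoD(2)[OF q2] C0(2) by simp
    have "\<forall>\<^sub>F n in sequentially. small (4 * norm t * q (tn n)) (k t)"
      using ev1 ev2
    proof eventually_elim
      case (elim n)
      have "nmul (Suc n) (k (tn n)) = k t"
        unfolding homomorphism_nmul[of k, OF kadd] by (simp add: tn_def)
      then show ?case using small_nmul[OF elim(1), of "Suc n"] elim(2) unfolding sc by simp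
    qed
    from small_tendsto_0[OF this] q2 have "(\<lambda>n::nat. k t) \<longlonglongrightarrow> 0" by simp
    then have "k t = 0" using LIMSEQ_unique tendsto_const by blast
    then show ?thesis by (simp add: k_def e_def)
  qed
qed

theorem lie_exp_eq: "lie_exp B \<zeta> = expo \<zeta>"
proof -
  have "(THE c. one_parameter_subgroup B \<zeta> c) = (\<lambda>t. expo (t *\<^sub>R \<zeta>))"
    using one_parameter_subgroup_expo one_parameter_subgroup_unique by (rule the_equality)
  then show ?thesis by (simp add: lie_exp_def)
qed

lemma smooth_map_translation: "smooth_map B B (\<lambda>g. a + g)"
  unfolding smooth_map_def
proof (intro conjI ballI)
  show "continuous_on UNIV (\<lambda>g. a + g)"
    unfolding continuous_on_def by (intro ballI tendsto_add_g tendsto_const tendsto_ident_at)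
  fix c d assume c: "c \<in> B" and d: "d \<in> B"
  show "smooth_on (snd c ` (fst c \<inter> (\<lambda>g. a + g) -` fst d)) (in_charts c d (\<lambda>g. a + g))"
  proof (rule smooth_on_smooth_at)
    fix x assume "x \<in> snd c ` (fst c \<inter> (\<lambda>g. a + g) -` fst d)"
    then obtain g where g: "g \<in> fst c" "a + g \<in> fst d" "x = snd c g" by auto
    obtain e where e: "e \<in> B" "a \<in> fst e" using atlas_chart_exists[OF smooth_manifold_B] .
    have ch: "is_chart e" using smooth_manifold_is_chart[OF smooth_manifold_B e(1)] .
    have 1: "smooth_at (\<lambda>(x, y). snd d (chart_inv e x + chart_inv c y)) (snd e a, snd c g)"
      by (rule smooth_at_translate) (use e c d g in auto)
    have 2: "smooth_at (\<lambda>y. (snd e a, y)) x" by (intro smooth_at_Pair) auto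
    from smooth_at_compose[OF finite_dim_prod[OF fdB fdB] 2, of "\<lambda>(x, y). snd d (chart_inv e x + chart_inv c y)"] 1
    show "smooth_at (in_charts c d (\<lambda>g. a + g)) x"
      by (simp add: g(3) in_charts_def comp_def chart_inv_left[OF ch e(2)])
  qed
qed

text \<open>Exponential coordinates are a chart of the maximal atlas: the inverse function theorem
  applies to the exponential in the chart at the unit.\<close>

lemma logarithmic_chart:
  assumes S0: "open S0" "0 \<in> S0"
  obtains c V where "c \<in> maximal_atlas B" "open V" "0 \<in> V" "V \<subseteq> S0" "fst c = expo ` V" "inj_on expo V"
    "\<And>v. v \<in> V \<Longrightarrow> snd c (expo v) = v"
proof -
  define \<epsilon> where "\<epsilon> v = snd c0 (expo v)" for v
  have \<epsilon>eq: "\<epsilon> = (\<lambda>v. \<phi> (expo v) + snd c0 0)" by (simp add: \<epsilon>_def \<phi>_def fun_eq_iff)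
  obtain d where d: "d > 0" "\<And>v. norm v < d \<Longrightarrow> smooth_at (\<lambda>v. \<phi> (expo v)) v" using smooth_at_\<phi>_expo by blast
  define S where "S = S0 \<inter> ball (0::'f) (min d (r0 / 8))"
  have S: "open S" "0 \<in> S" using S0 d C0 by (auto simp: S_def)
  have sm: "smooth_on S \<epsilon>" unfolding \<epsilon>eq
    by (rule smooth_on_smooth_at) (auto simp: S_def intro!: smooth_at_add d(2))
  have "(\<epsilon> has_derivative (\<lambda>v. v)) (at 0)"
    unfolding \<epsilon>eq using has_derivative_add[OF expo_has_derivative_0 has_derivative_const[of "snd c0 0"]] by simp
  then have der: "frechet_derivative \<epsilon> (at 0) = (\<lambda>v. v)" using frechet_derivative_at by metis
  obtain V g where V: "open V" "0 \<in> V" "V \<subseteq> S" "open (\<epsilon> ` V)" "homeomorphism V (\<epsilon> ` V) \<epsilon> g"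
    "smooth_on (\<epsilon> ` V) g"
    using smooth_local_inverse[OF fdB S sm der] by metis
  have inU: "expo v \<in> fst c0" if "v \<in> V" for v
    using that V(3) expo_near_0(1)[of v] by (auto simp: S_def)
  have g\<epsilon>: "g (\<epsilon> v) = v" if "v \<in> V" for v using that V(5) unfolding homeomorphism_def by blast
  have im: "g ` \<epsilon> ` V = V" using g\<epsilon> by (force simp: image_image)
  have sub: "\<epsilon> ` V \<subseteq> snd c0 ` fst c0" using inU by (auto simp: \<epsilon>_def)
  let ?c = "(chart_inv c0 ` \<epsilon> ` V, \<lambda>p. g (snd c0 p))"
  have "?c \<in> maximal_atlas B"
  proof (rule chart_change_coordinates(1)[OF smooth_manifold_B _ V(4) sub])
    show "c0 \<in> maximal_atlas B" using atlas_subset_maximal[OF smooth_manifold_B c0(1)] .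
    show "open (g ` \<epsilon> ` V)" using im V(1) by simp
    show "homeomorphism (\<epsilon> ` V) (g ` \<epsilon> ` V) g \<epsilon>" unfolding im using homeomorphism_symD[OF V(5)] .
    show "smooth_on (\<epsilon> ` V) g" using V(6) .
    show "smooth_on (g ` \<epsilon> ` V) \<epsilon>" unfolding im using smooth_on_subset[OF sm V(3)] .
  qed
  moreover have "chart_inv c0 ` \<epsilon> ` V = expo ` V"
    using inU chart_inv_left[OF c0(3)] by (force simp: \<epsilon>_def image_image)
  moreover have "g (snd c0 (expo v)) = v" if "v \<in> V" for v using g\<epsilon>[OF that] by (simp add: \<epsilon>_def)
  moreover from this have "inj_on expo V" by (metis inj_onI)
  ultimately show ?thesis using that[of ?c V] V(1-3) by (simp add: S_def)
qed

end

section \<open>Nondegenerate bilinear forms\<close>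

text \<open>The map \<open>v \<mapsto> \<Sum>i. \<beta>(v, i) i\<close> is injective on
  \<open>V\<close>, hence onto, and the preimages of the basis vectors form the dual basis.\<close>

lemma nondegenerate_dual_basis:
  fixes \<beta> :: "'e::real_vector \<Rightarrow> 'e \<Rightarrow> real"
  assumes fd: "finite_dim TYPE('e)" and \<beta>: "bilinear \<beta>" and nd: "nondegenerate_on V \<beta>"
    and b: "finite b" "independent b" "span b = V"
  obtains e where "\<And>j. j \<in> b \<Longrightarrow> e j \<in> V" "\<And>i j. i \<in> b \<Longrightarrow> j \<in> b \<Longrightarrow> \<beta> (e j) i = (if i = j then 1 else 0)"
proof -
  have lin: "linear (\<lambda>v. \<beta> v i)" "linear (\<beta> v)" for i v using \<beta> by (auto simp: bilinear_def)
  define N where "N v = (\<Sum>i\<in>b. \<beta> v i *\<^sub>R i)" for v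
  have linN: "linear N"
    by (rule linearI) (simp_all add: N_def linear_add[OF lin(1)] linear_scale[OF lin(1)]
        scaleR_add_left sum.distrib scaleR_sum_right)
  have V: "subspace V" using b(3) subspace_span by blast
  have NV: "N v \<in> V" for v unfolding N_def b(3)[symmetric] by (intro span_sum span_scale span_base)
  have coef: "f i = g i" if "(\<Sum>i\<in>b. f i *\<^sub>R i) = (\<Sum>i\<in>b. g i *\<^sub>R i)" "i \<in> b" for f g i
  proof -
    have "(\<Sum>i\<in>b. (f i - g i) *\<^sub>R i) = 0" using that by (simp add: scaleR_diff_left sum_subtractf)
    then have "f i - g i = 0" using independentD[OF b(2) b(1) subset_refl, of "\<lambda>i. f i - g i" i] that(2) by blast
    then show ?thesis by simp
  qed
  have inj: "v = 0" if "v \<in> V" "N v = 0" for v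
  proof -
    have z: "\<beta> v i = 0" if "i \<in> b" for i
      using coef[of "\<beta> v" "\<lambda>_. 0", OF _ that] \<open>N v = 0\<close> by (simp add: N_def)
    have "\<beta> v w = 0" if "w \<in> V" for w
      using linear_eq_0_on_span[OF lin(2), of b v w] z that b(3) by blast
    then show ?thesis using nd that(1) unfolding nondegenerate_on_def by blast
  qed
  have "N ` V = V" by (rule finite_dim_inj_surj_on[OF fd linN V _ inj]) (use NV in auto)
  then have "\<forall>j\<in>b. \<exists>v\<in>V. N v = j" using b(3) span_base by (metis image_iff)
  then obtain e where e: "\<And>j. j \<in> b \<Longrightarrow> e j \<in> V" "\<And>j. j \<in> b \<Longrightarrow> N (e j) = j" by metis
  have "\<beta> (e j) i = (if i = j then 1 else 0)" if "i \<in> b" "j \<in> b" for i j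
  proof -
    have "(\<Sum>i\<in>b. (if i = j then 1 else 0) *\<^sub>R i) = j"
      using that(2) b(1) by (simp add: if_distrib[of "\<lambda>c. c *\<^sub>R _"] sum.delta cong: if_cong)
    then show ?thesis using coef[of "\<beta> (e j)" "\<lambda>i. if i = j then 1 else 0" i] e(2)[OF that(2)] that(1)
      by (simp add: N_def)
  qed
  then show ?thesis using that e(1) by blast
qed

lemma nondegenerate_represents:
  fixes \<beta> :: "'e::real_vector \<Rightarrow> 'e \<Rightarrow> real"
  assumes fd: "finite_dim TYPE('e)" and \<beta>: "bilinear \<beta>" and nd: "nondegenerate_on UNIV \<beta>"
    and \<alpha>: "linear \<alpha>"
  shows "\<exists>!X. \<forall>v. \<beta> X v = \<alpha> v"
proof -
  have lin: "linear (\<lambda>v. \<beta> v i)" "linear (\<beta> v)" for i v using \<beta> by (auto simp: bilinear_def)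
  obtain b :: "'e set" where b: "finite b" "independent b" "span b = UNIV"
    using finite_dim_subspace_basis[OF fd subspace_UNIV] by metis
  obtain e where e: "\<And>i j. i \<in> b \<Longrightarrow> j \<in> b \<Longrightarrow> \<beta> (e j) i = (if i = j then 1 else 0)"
    using nondegenerate_dual_basis[OF fd \<beta> nd b] by metis
  define X where "X = (\<Sum>j\<in>b. \<alpha> j *\<^sub>R e j)"
  have X: "\<beta> X v = \<alpha> v" for v
  proof -
    have "\<beta> X i = \<alpha> i" if "i \<in> b" for i
      unfolding X_def using that b(1)
      by (simp add: linear_sum[OF lin(1)] linear_scale[OF lin(1)] e if_distrib[of "\<lambda>c. _ * c"] cong: if_cong)
    then show ?thesis using linear_eq_on[OF lin(2) \<alpha>, of v b] b(3) by blast
  qed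
  moreover have "Y = X" if "\<forall>v. \<beta> Y v = \<alpha> v" for Y
  proof -
    have "\<forall>v. \<beta> (Y - X) v = 0" using that X by (simp add: linear_diff[OF lin(1)])
    then show ?thesis using nd unfolding nondegenerate_on_def by (metis UNIV_I right_minus_eq)
  qed
  ultimately show ?thesis by blast
qed

section \<open>Velocities and critical points in charts\<close>

lemma chart_at_in:
  assumes "smooth_manifold A" shows "chart_at A p \<in> A" "p \<in> fst (chart_at A p)"
proof -
  have "\<exists>c. c \<in> A \<and> p \<in> fst c" using atlas_chart_exists[OF assms] by metis
  then have "chart_at A p \<in> A \<and> p \<in> fst (chart_at A p)" unfolding chart_at_def by (rule someI_ex)
  then show "chart_at A p \<in> A" "p \<in> fst (chart_at A p)" by auto
qed

lemma mderiv_vs: "mderiv A vs_atlas f p = frechet_derivative (\<lambda>x. f (chart_inv (chart_at A p) x)) (at (snd (chart_at A p) p))"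
  by (simp add: mderiv_def in_charts_def comp_def)

lemma has_velocity_chart_at:
  "has_velocity A c v t \<longleftrightarrow> isCont c t \<and> ((\<lambda>s. snd (chart_at A (c t)) (c s)) has_vector_derivative v) (at t)"
  by (simp add: has_velocity_def has_mderiv_def in_charts_def comp_def has_vector_derivative_def)

locale atlas_of_manifold =
  fixes A :: "('m::{t2_space, second_countable_topology}, 'e::real_normed_vector) chart set"
  assumes smooth_manifold_A: "smooth_manifold A"
begin

lemma fdA: "finite_dim TYPE('e)" by (rule smooth_manifold_finite_dim[OF smooth_manifold_A])

lemma at_in: "chart_at A p \<in> A" "p \<in> fst (chart_at A p)" "is_chart (chart_at A p)" "chart_at A p \<in> maximal_atlas A"
  using chart_at_in[OF smooth_manifold_A] smooth_manifold_is_chart[OF smooth_manifold_A]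
    atlas_subset_maximal[OF smooth_manifold_A] by blast+

text \<open>The change of tangent coordinates at \<open>p\<close> from \<open>c\<close> to
  \<open>d\<close>.  As tangent vectors at \<open>p\<close> are written in the chosen chart
  \<open>chart_at A p\<close>, it mediates between them and coordinates in a fixed chart.\<close>

definition dtrans :: "('m, 'e) chart \<Rightarrow> ('m, 'e) chart \<Rightarrow> 'm \<Rightarrow> 'e \<Rightarrow> 'e" where
  "dtrans c d p = frechet_derivative (in_charts c d id) (at (snd c p))"

lemma dtrans_smooth:
  assumes "c \<in> maximal_atlas A" "d \<in> maximal_atlas A" "p \<in> fst c" "p \<in> fst d"
  shows "smooth_at (in_charts c d id) (snd c p)" "linear (dtrans c d p)"
    "(in_charts c d id has_derivative dtrans c d p) (at (snd c p))"
    "dtrans d c p (dtrans c d p v) = v"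
  unfolding dtrans_def
  using smooth_transition[OF smooth_manifold_A assms] smooth_at_linear_derivative smooth_at_has_derivative
    transition_derivative_inverse[OF smooth_manifold_A assms] by blast+

lemma dtrans_self:
  assumes c: "c \<in> maximal_atlas A" "p \<in> fst c" shows "dtrans c c p = (\<lambda>v. v)"
proof -
  have ch: "is_chart c" using maximal_atlas_is_chart[OF c(1)] .
  have "\<forall>\<^sub>F x in nhds (snd c p). in_charts c c id x = x"
    using eventually_chart_image[OF ch c(2)]
    by eventually_elim (simp add: in_charts_apply chart_inv_right[OF ch])
  then obtain U where U: "open U" "snd c p \<in> U" "\<And>x. x \<in> U \<Longrightarrow> in_charts c c id x = x"
    unfolding eventually_nhds by blast
  have "((\<lambda>x. x) has_derivative dtrans c c p) (at (snd c p))"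
    by (rule has_derivative_transform_within_open[OF dtrans_smooth(3)[OF c(1) c(1) c(2) c(2)] U])
  then show ?thesis using has_derivative_unique has_derivative_ident by blast
qed

lemma velocity_change_chart:
  assumes c: "c \<in> maximal_atlas A" and d: "d \<in> maximal_atlas A" and p: "\<gamma> t \<in> fst c" "\<gamma> t \<in> fst d"
    and cont: "isCont \<gamma> t" and v: "((\<lambda>s. snd c (\<gamma> s)) has_vector_derivative v) (at t)"
  shows "((\<lambda>s. snd d (\<gamma> s)) has_vector_derivative dtrans c d (\<gamma> t) v) (at t)"
proof -
  have ch: "is_chart c" using maximal_atlas_is_chart[OF c] .
  have "((\<lambda>s. in_charts c d id (snd c (\<gamma> s))) has_derivative (\<lambda>s. dtrans c d (\<gamma> t) (s *\<^sub>R v))) (at t)"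
    by (rule has_derivative_compose[OF v[unfolded has_vector_derivative_def] dtrans_smooth(3)[OF c d p]])
  then have 1: "((\<lambda>s. in_charts c d id (snd c (\<gamma> s))) has_vector_derivative dtrans c d (\<gamma> t) v) (at t)"
    by (simp add: has_vector_derivative_def linear_scale[OF dtrans_smooth(2)[OF c d p]])
  obtain U where U: "open U" "t \<in> U" "\<And>s. s \<in> U \<Longrightarrow> \<gamma> s \<in> fst c"
    using isCont_eventually_in[OF cont chart_open[OF ch] p(1)] unfolding eventually_nhds by blast
  show ?thesis
    by (rule has_vector_derivative_transform_within_open[OF 1 U(1,2)])
       (simp add: in_charts_apply chart_inv_left[OF ch U(3)])
qed

lemma has_velocity_in_chart:
  assumes d: "d \<in> maximal_atlas A" "\<gamma> t \<in> fst d" and v: "has_velocity A \<gamma> v t"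
  shows "((\<lambda>s. snd d (\<gamma> s)) has_vector_derivative dtrans (chart_at A (\<gamma> t)) d (\<gamma> t) v) (at t)"
  using v velocity_change_chart[where \<gamma>=\<gamma> and t=t, OF at_in(4) d(1) at_in(2) d(2)]
  unfolding has_velocity_chart_at by blast

lemma has_velocity_from_chart:
  assumes d: "d \<in> maximal_atlas A" "\<gamma> t \<in> fst d" and cont: "isCont \<gamma> t"
    and v: "((\<lambda>s. snd d (\<gamma> s)) has_vector_derivative v) (at t)"
  shows "has_velocity A \<gamma> (dtrans d (chart_at A (\<gamma> t)) (\<gamma> t) v) t"
  using velocity_change_chart[where \<gamma>=\<gamma> and t=t, OF d(1) at_in(4) d(2) at_in(2) cont v] cont unfolding has_velocity_chart_at by blast

text \<open>The curve is locally constant in charts, so its fibres are open and the line is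
  connected.\<close>

lemma zero_velocity_constant:
  assumes v: "\<And>t. has_velocity A \<gamma> 0 t" shows "\<gamma> t = \<gamma> 0"
proof -
  have cont: "isCont \<gamma> t" for t using v has_velocity_chart_at by blast
  have loc: "\<forall>\<^sub>F s in nhds t. \<gamma> s = \<gamma> t" for t
  proof -
    let ?d = "chart_at A (\<gamma> t)"
    have "\<forall>\<^sub>F s in nhds t. \<gamma> s \<in> fst ?d"
      by (rule isCont_eventually_in[OF cont chart_open[OF at_in(3)] at_in(2)])
    then obtain r where r: "r > 0" "\<And>s. dist s t < r \<Longrightarrow> \<gamma> s \<in> fst ?d" unfolding eventually_nhds_metric by blast
    have dz: "((\<lambda>s. snd ?d (\<gamma> s)) has_derivative (\<lambda>h. 0)) (at s within ball t r)" if "s \<in> ball t r" for s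
    proof -
      have s: "\<gamma> s \<in> fst ?d" using r(2) that by (simp add: dist_commute)
      have "((\<lambda>s. snd ?d (\<gamma> s)) has_vector_derivative dtrans (chart_at A (\<gamma> s)) ?d (\<gamma> s) 0) (at s)"
        by (rule has_velocity_in_chart[OF at_in(4) s v])
      then show ?thesis
        using linear_0[OF dtrans_smooth(2)[OF at_in(4) at_in(4) at_in(2) s]]
        by (simp add: has_vector_derivative_def has_derivative_at_withinI)
    qed
    have "snd ?d (\<gamma> s) = snd ?d (\<gamma> t)" if "s \<in> ball t r" for s
    proof -
      obtain k where "\<And>x. x \<in> ball t r \<Longrightarrow> snd ?d (\<gamma> x) = k"
        using has_derivative_zero_constant[OF convex_ball dz] by blast
      then show ?thesis using that r(1) by simp
    qed
    then have eq: "snd ?d (\<gamma> s) = snd ?d (\<gamma> t)" if "dist s t < r" for s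
      using that by (simp only: mem_ball dist_commute)
    have "\<gamma> s = \<gamma> t" if "dist s t < r" for s
    proof -
      have "\<gamma> s = chart_inv ?d (snd ?d (\<gamma> s))" by (rule chart_inv_left[OF at_in(3) r(2)[OF that], symmetric])
      also have "\<dots> = chart_inv ?d (snd ?d (\<gamma> t))" by (simp only: eq[OF that])
      also have "\<dots> = \<gamma> t" by (rule chart_inv_left[OF at_in(3) at_in(2)])
      finally show ?thesis .
    qed
    then show ?thesis unfolding eventually_nhds_metric using r(1) by blast
  qed
  let ?S = "{s. \<gamma> s = \<gamma> 0}"
  have op: "open {s. \<gamma> s = q}" for q
    unfolding open_subopen[of "{s. \<gamma> s = q}"]
  proof
    fix s assume s: "s \<in> {s. \<gamma> s = q}"
    obtain T where T: "open T" "s \<in> T" "\<And>u. u \<in> T \<Longrightarrow> \<gamma> u = \<gamma> s"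
      using loc[of s] unfolding eventually_nhds by blast
    have "T \<subseteq> {s. \<gamma> s = q}" using T(3) s by blast
    then show "\<exists>T. open T \<and> s \<in> T \<and> T \<subseteq> {s. \<gamma> s = q}" using T(1,2) by blast
  qed
  have "- ?S = (\<Union>q\<in>- {\<gamma> 0}. {s. \<gamma> s = q})" by auto
  moreover have "open (\<Union>q\<in>- {\<gamma> 0}. {s. \<gamma> s = q})" by (intro open_UN ballI op)
  ultimately have "open (- ?S)" by (simp only:)
  then have "closed ?S" unfolding closed_def .
  with op[of "\<gamma> 0"] have "?S = {} \<or> ?S = UNIV" unfolding clopen[symmetric] by (intro conjI)
  then show ?thesis by (elim disjE) (simp_all add: set_eq_iff, metis)
qed

lemma mderiv_in_chart:
  assumes f: "smooth_map A vs_atlas f" and c: "c \<in> maximal_atlas A" and d: "d \<in> maximal_atlas A"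
    and p: "p \<in> fst c" "p \<in> fst d"
  shows "frechet_derivative (\<lambda>x. f (chart_inv c x)) (at (snd c p)) v =
    frechet_derivative (\<lambda>x. f (chart_inv d x)) (at (snd d p)) (dtrans c d p v)"
proof -
  have ch: "is_chart c" "is_chart d" using maximal_atlas_is_chart c d by blast+
  have eq: "in_charts c d id (snd c p) = snd d p" by (simp add: in_charts_apply chart_inv_left[OF ch(1) p(1)])
  have D: "((\<lambda>x. f (chart_inv d x)) has_derivative frechet_derivative (\<lambda>x. f (chart_inv d x)) (at (snd d p)))
      (at (in_charts c d id (snd c p)))"
    unfolding eq by (rule smooth_at_has_derivative[OF smooth_map_to_vs[OF smooth_manifold_A f d p(2)]])
  have 1: "((\<lambda>x. f (chart_inv d (in_charts c d id x))) has_derivative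
     (\<lambda>v. frechet_derivative (\<lambda>x. f (chart_inv d x)) (at (snd d p)) (dtrans c d p v))) (at (snd c p))"
    by (rule has_derivative_compose[OF dtrans_smooth(3)[OF c d p] D])
  have "\<forall>\<^sub>F x in nhds (snd c p). chart_inv c x \<in> fst d"
    by (rule eventually_chart_inv_in[OF ch(1) p(1) chart_open[OF ch(2)] p(2)])
  then obtain U where U: "open U" "snd c p \<in> U" "\<And>x. x \<in> U \<Longrightarrow> chart_inv c x \<in> fst d"
    unfolding eventually_nhds by blast
  have "((\<lambda>x. f (chart_inv c x)) has_derivative
     (\<lambda>v. frechet_derivative (\<lambda>x. f (chart_inv d x)) (at (snd d p)) (dtrans c d p v))) (at (snd c p))"
    by (rule has_derivative_transform_within_open[OF 1 U(1,2)])
       (simp add: in_charts_apply chart_inv_left[OF ch(2) U(3)])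
  then show ?thesis using frechet_derivative_at by metis
qed

definition critical :: "('m \<Rightarrow> real) \<Rightarrow> 'm \<Rightarrow> bool" where
  "critical f p \<longleftrightarrow> (\<forall>v. mderiv A vs_atlas f p v = 0)"

lemma critical_in_chart:
  assumes f: "smooth_map A vs_atlas f" and c: "c \<in> maximal_atlas A" and p: "p \<in> fst c"
  shows "critical f p \<longleftrightarrow> (\<forall>v. frechet_derivative (\<lambda>x. f (chart_inv c x)) (at (snd c p)) v = 0)"
  using mderiv_in_chart[OF f c at_in(4) p at_in(2)] mderiv_in_chart[OF f at_in(4) c at_in(2) p]
  unfolding critical_def mderiv_vs by metis

end

section \<open>Hamiltonian vector fields and their integral curves\<close>

locale symplectic = atlas_of_manifold A
  for A :: "('m::{t2_space, second_countable_topology}, 'e::real_normed_vector) chart set" +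
  fixes \<omega> :: "'m \<Rightarrow> 'e \<Rightarrow> 'e \<Rightarrow> real"
  assumes symplectic_A: "symplectic_manifold A \<omega>"
begin

lemma bilinear_\<omega>: "bilinear (\<omega> p)"
  and \<omega>_alternating: "\<omega> p v v = 0"
  and \<omega>_nondegenerate: "nondegenerate_on UNIV (\<omega> p)"
  and smooth_\<omega>: "c \<in> A \<Longrightarrow> smooth_on (snd c ` fst c) (\<lambda>x. form_in_chart A \<omega> c x v w)"
  using symplectic_A unfolding symplectic_manifold_def smooth_two_form_def by blast+

lemma form_in_chart_eq:
  assumes "is_chart c" "p \<in> fst c"
  shows "form_in_chart A \<omega> c (snd c p) v w = \<omega> p (dtrans c (chart_at A p) p v) (dtrans c (chart_at A p) p w)"
  using assms by (simp add: form_in_chart_def dtrans_def chart_inv_left Let_def)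

lemma bilinear_form_in_chart:
  assumes c: "c \<in> A" and p: "p \<in> fst c"
  shows "bilinear (form_in_chart A \<omega> c (snd c p))"
proof -
  have ch: "is_chart c" "c \<in> maximal_atlas A"
    using smooth_manifold_is_chart atlas_subset_maximal smooth_manifold_A c by blast+
  have lin: "linear (dtrans c (chart_at A p) p)" by (rule dtrans_smooth(2)[OF ch(2) at_in(4) p at_in(2)])
  have l: "linear (\<omega> p v)" "linear (\<lambda>u. \<omega> p u v)" for v using bilinear_\<omega> by (auto simp: bilinear_def)
  show ?thesis unfolding bilinear_def form_in_chart_eq[OF ch(1) p]
    using linear_compose[OF lin l(1)] linear_compose[OF lin l(2)] by (simp add: comp_def)
qed

lemma dtrans_bij:
  assumes "c \<in> maximal_atlas A" "d \<in> maximal_atlas A" "p \<in> fst c" "p \<in> fst d"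
  shows "\<exists>u. dtrans c d p u = v" "dtrans c d p u = 0 \<Longrightarrow> u = 0"
  using dtrans_smooth(4)[OF assms(2,1,4,3)] dtrans_smooth(4)[OF assms] 
    linear_0[OF dtrans_smooth(2)[OF assms(2,1,4,3)]] by metis+

lemma nondegenerate_form_in_chart:
  assumes c: "c \<in> A" and p: "p \<in> fst c"
  shows "nondegenerate_on UNIV (form_in_chart A \<omega> c (snd c p))"
  unfolding nondegenerate_on_def
proof (intro ballI impI)
  fix v assume v: "\<forall>w\<in>UNIV. form_in_chart A \<omega> c (snd c p) v w = 0"
  have ch: "is_chart c" "c \<in> maximal_atlas A"
    using smooth_manifold_is_chart atlas_subset_maximal smooth_manifold_A c by blast+
  have "\<omega> p (dtrans c (chart_at A p) p v) w = 0" for w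
    using v dtrans_bij(1)[OF ch(2) at_in(4) p at_in(2), of w] unfolding form_in_chart_eq[OF ch(1) p] by auto
  then have "dtrans c (chart_at A p) p v = 0"
    using \<omega>_nondegenerate unfolding nondegenerate_on_def by blast
  then show "v = 0" using dtrans_bij(2)[OF ch(2) at_in(4) p at_in(2)] by blast
qed

lemma hamiltonian_vf_spec:
  assumes f: "smooth_map A vs_atlas f"
  shows "\<omega> p (hamiltonian_vf A \<omega> f p) v = mderiv A vs_atlas f p v"
proof -
  have "linear (mderiv A vs_atlas f p)"
    unfolding mderiv_vs
    by (rule smooth_at_linear_derivative[OF smooth_map_to_vs[OF smooth_manifold_A f at_in(4) at_in(2)]])
  from theI'[OF nondegenerate_represents[OF fdA bilinear_\<omega> \<omega>_nondegenerate this], of p]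
  show ?thesis unfolding hamiltonian_vf_def by blast
qed

lemma \<omega>_cancel: "(\<And>v. \<omega> p X v = \<omega> p Y v) \<Longrightarrow> X = Y"
proof -
  assume a: "\<And>v. \<omega> p X v = \<omega> p Y v"
  have "\<forall>v\<in>UNIV. \<omega> p (X - Y) v = 0" using a by (simp add: bilinear_lsub[OF bilinear_\<omega>])
  then show "X = Y" using \<omega>_nondegenerate unfolding nondegenerate_on_def by (metis UNIV_I right_minus_eq)
qed

text \<open>In a fixed chart the vector field is the solution of a linear equation whose
  coefficients, those of the form and of \<open>df\<close>, are smooth.\<close>

lemma hamiltonian_vf_in_chart_continuous:
  assumes f: "smooth_map A vs_atlas f" and c: "c \<in> A" and p: "p \<in> fst c"
  shows "isCont (\<lambda>x. let q = chart_inv c x in dtrans (chart_at A q) c q (hamiltonian_vf A \<omega> f q)) (snd c p)"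
proof -
  have ch: "is_chart c" "c \<in> maximal_atlas A"
    using smooth_manifold_is_chart atlas_subset_maximal smooth_manifold_A c by blast+
  obtain b :: "'e set" and k where b: "finite b" "independent b" "span b = UNIV"
    using finite_dim_coordinates[OF fdA] by metis
  define L where "L x u = (\<Sum>i\<in>b. form_in_chart A \<omega> c x u i *\<^sub>R i)" for x u
  define g where "g x = (\<Sum>i\<in>b. frechet_derivative (\<lambda>x. f (chart_inv c x)) (at x) i *\<^sub>R i)" for x
  define Y where "Y x = (let q = chart_inv c x in dtrans (chart_at A q) c q (hamiltonian_vf A \<omega> f q))" for x
  have im: "\<forall>\<^sub>F x in nhds (snd c p). x \<in> snd c ` fst c" by (rule eventually_chart_image[OF ch(1) p])
  have linL: "linear (L x)" if x: "x \<in> snd c ` fst c" for x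
  proof -
    obtain q where q: "q \<in> fst c" "x = snd c q" using x by blast
    have l: "linear (\<lambda>u. form_in_chart A \<omega> c x u i)" for i
      using bilinear_form_in_chart[OF c q(1)] by (simp add: q(2) bilinear_def)
    show ?thesis unfolding L_def
      by (rule linearI) (simp_all add: linear_add[OF l] linear_scale[OF l] scaleR_add_left sum.distrib scaleR_sum_right)
  qed
  have smL: "smooth_at (\<lambda>x. L x u) (snd c p)" for u
    unfolding L_def
    by (intro smooth_at_sum smooth_at_scaleR smooth_at_const
        smooth_at_smooth_on[OF smooth_\<omega>[OF c] chart_open_image[OF ch(1)]]) (use p in blast)
  have inj: "u = 0" if "L (snd c p) u = 0" for u
  proof -
    have "form_in_chart A \<omega> c (snd c p) u i = 0" if "i \<in> b" for i
      using independentD[OF b(2) b(1) subset_refl, of "\<lambda>i. form_in_chart A \<omega> c (snd c p) u i" i] that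
        \<open>L (snd c p) u = 0\<close> unfolding L_def by blast
    then have "form_in_chart A \<omega> c (snd c p) u w = 0" for w
      using linear_eq_0_on_span[of "form_in_chart A \<omega> c (snd c p) u" b w] bilinear_form_in_chart[OF c p] b(3)
      unfolding bilinear_def by blast
    then show ?thesis using nondegenerate_form_in_chart[OF c p] unfolding nondegenerate_on_def by blast
  qed
  have bijL: "bij (L (snd c p))"
    by (rule finite_dim_inj_bij[OF fdA linL inj]) (use p in blast)
  have evl: "\<forall>\<^sub>F x in nhds (snd c p). linear (L x)" using im by eventually_elim (rule linL)
  have smi: "smooth_at (\<lambda>x. inv (L x) v) (snd c p)" for v
    by (rule smooth_at_linear_inverse[OF fdA evl smL bijL])
  have smf: "smooth_at (\<lambda>x. f (chart_inv c x)) (snd c p)"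
    by (rule smooth_map_to_vs[OF smooth_manifold_A f ch(2) p])
  have smg: "smooth_at g (snd c p)" unfolding g_def
    by (intro smooth_at_sum smooth_at_scaleR smooth_at_const smooth_at_frechet_derivative smf)
  have evbij: "\<forall>\<^sub>F x in nhds (snd c p). bij (L x)"
    by (rule linear_family_eventually_bij[OF fdA evl smooth_at_isCont[OF smL] bijL])
  then have evli: "\<forall>\<^sub>F x in nhds (snd c p). linear (inv (L x))"
    using evl by eventually_elim (rule finite_dim_linear_inv)
  have sm: "smooth_at (\<lambda>x. inv (L x) (g x)) (snd c p)"
    by (rule smooth_at_family_apply[OF fdA evli smi smg])
  have "\<forall>\<^sub>F x in nhds (snd c p). inv (L x) (g x) = Y x"
    using evbij im
  proof eventually_elim
    case (elim x)
    then obtain q where q: "q \<in> fst c" "x = snd c q" by blast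
    have qx: "chart_inv c x = q" using chart_inv_left[OF ch(1) q(1)] q(2) by simp
    have "form_in_chart A \<omega> c x (Y x) i = frechet_derivative (\<lambda>x. f (chart_inv c x)) (at x) i" for i
    proof -
      have "form_in_chart A \<omega> c x (Y x) i = \<omega> q (hamiltonian_vf A \<omega> f q) (dtrans c (chart_at A q) q i)"
        unfolding q(2) form_in_chart_eq[OF ch(1) q(1)] Y_def Let_def chart_inv_left[OF ch(1) q(1)]
          dtrans_smooth(4)[OF at_in(4) ch(2) at_in(2) q(1)] ..
      also have "\<dots> = mderiv A vs_atlas f q (dtrans c (chart_at A q) q i)"
        by (rule hamiltonian_vf_spec[OF f])
      also have "\<dots> = frechet_derivative (\<lambda>x. f (chart_inv c x)) (at x) i"
        unfolding q(2) mderiv_vs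
        by (rule mderiv_in_chart[OF f ch(2) at_in(4) q(1) at_in(2), symmetric])
      finally show ?thesis .
    qed
    then have "L x (Y x) = g x" by (simp add: L_def g_def)
    then show ?case using elim(1) by (metis bij_is_inj inv_f_f)
  qed
  then have "smooth_at Y (snd c p)" using smooth_at_transform[OF sm] by blast
  then have "isCont Y (snd c p)" by (rule smooth_at_isCont)
  then show ?thesis unfolding Y_def .
qed

text \<open>Each time \<open>t\<close> comes with its own integral curve, so the estimate has to be
  uniform in the curve.  Where the field stays within \<open>e\<close> of its value \<open>Y\<close>
  at the start, a curve moves with speed at most \<open>|Y| + e\<close> and cannot leave the
  coordinate ball before time \<open>r / (|Y| + e)\<close>; until then its velocity differs from
  \<open>Y\<close> by at most \<open>e\<close>.\<close>

lemma flow_to_first_order: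
  fixes X :: "'m \<Rightarrow> 'e"
  assumes c: "c \<in> A" "p \<in> fst c"
    and cont: "isCont (\<lambda>x. let q = chart_inv c x in dtrans (chart_at A q) c q (X q)) (snd c p)"
      (is "isCont ?Y _")
    and e: "e > 0"
  obtains T where "T > 0"
    "\<And>t q. 0 < t \<Longrightarrow> t < T \<Longrightarrow> flow_to A X t p q \<Longrightarrow>
       norm (snd c q - snd c p - t *\<^sub>R ?Y (snd c p)) \<le> e * t"
proof -
  have ch: "is_chart c" "c \<in> maximal_atlas A"
    using smooth_manifold_is_chart atlas_subset_maximal smooth_manifold_A c by blast+
  define Y where "Y = ?Y"
  define x0 where "x0 = snd c p"
  have "\<forall>\<^sub>F x in nhds x0. Y x \<in> ball (Y x0) e"
    using cont e unfolding Y_def x0_def by (intro isCont_eventually_in) auto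
  then have "\<forall>\<^sub>F x in nhds x0. x \<in> snd c ` fst c \<and> norm (Y x - Y x0) \<le> e"
    using eventually_chart_image[OF ch(1) c(2)] unfolding x0_def
    by eventually_elim (auto simp: dist_norm norm_minus_commute)
  then obtain r where r: "r > 0" "\<And>x. dist x x0 < r \<Longrightarrow> x \<in> snd c ` fst c \<and> norm (Y x - Y x0) \<le> e"
    unfolding eventually_nhds_metric by blast
  define M where "M = norm (Y x0) + e"
  have M: "M > 0" unfolding M_def using e by (simp add: add_nonneg_pos)
  define N where "N = chart_inv c ` ball x0 r"
  have sub: "ball x0 r \<subseteq> snd c ` fst c" using r(2) by (auto simp: dist_commute)
  have oN: "open N" unfolding N_def by (rule open_chart_inv_image[OF ch(1) open_ball sub])
  have N_iff: "q \<in> N \<longleftrightarrow> q \<in> fst c \<and> dist (snd c q) x0 < r" for q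
  proof
    assume "q \<in> N"
    then obtain x where "x \<in> ball x0 r" "q = chart_inv c x" unfolding N_def by blast
    then show "q \<in> fst c \<and> dist (snd c q) x0 < r"
      using sub chart_inv_in[OF ch(1)] chart_inv_right[OF ch(1)] by (auto simp: dist_commute)
  next
    assume "q \<in> fst c \<and> dist (snd c q) x0 < r"
    then show "q \<in> N" unfolding N_def using chart_inv_left[OF ch(1), of q]
      by (auto simp: dist_commute intro!: image_eqI[of q _ "snd c q"])
  qed
  have est: "norm (snd c q - x0 - t *\<^sub>R Y x0) \<le> e * t" if t: "0 < t" "t < r / M" and fl: "flow_to A X t p q" for t q
  proof -
    obtain \<gamma> I where \<gamma>: "open I" "is_interval I" "0 \<in> I" "t \<in> I"
      "\<And>s. s \<in> I \<Longrightarrow> has_velocity A \<gamma> (X (\<gamma> s)) s" "\<gamma> 0 = p" "\<gamma> t = q"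
      using fl unfolding flow_to_def by blast
    have sI: "s \<in> I" if "0 \<le> s" "s \<le> t" for s
      using \<gamma>(2,3,4) that unfolding is_interval_1 by blast
    have tM: "t * M < r" using t(2) M by (simp add: pos_less_divide_eq)
    have contI: "isCont \<gamma> s" if "s \<in> I" for s using \<gamma>(5)[OF that] has_velocity_chart_at by blast
    have der: "((\<lambda>s. snd c (\<gamma> s)) has_vector_derivative Y (snd c (\<gamma> s))) (at s)"
      if "s \<in> I" "\<gamma> s \<in> N" for s
    proof -
      have g: "\<gamma> s \<in> fst c" using that N_iff by blast
      show ?thesis using has_velocity_in_chart[OF ch(2) g \<gamma>(5)[OF that(1)]]
        unfolding Y_def Let_def by (simp only: chart_inv_left[OF ch(1) g])
    qed
    have N0: "\<gamma> 0 \<in> N" unfolding N_iff using \<gamma>(6) c(2) r(1) by (simp add: x0_def)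
    have step: "norm (snd c (\<gamma> b) - snd c (\<gamma> a)) \<le> M * \<bar>b - a\<bar>"
      if ab: "a \<in> J" "b \<in> J" and J: "convex J" "J \<subseteq> {0..t}" "\<And>s. s \<in> J \<Longrightarrow> \<gamma> s \<in> N" for a b J
    proof -
      have "norm (snd c (\<gamma> b) - snd c (\<gamma> a)) \<le> M * norm (b - a)"
      proof (rule differentiable_bound[OF J(1)])
        fix s assume s: "s \<in> J"
        then have sN: "\<gamma> s \<in> N" and si: "s \<in> I" using J sI by auto
        show "((\<lambda>s. snd c (\<gamma> s)) has_derivative (\<lambda>h. h *\<^sub>R Y (snd c (\<gamma> s)))) (at s within J)"
          using der[OF si sN] by (simp add: has_vector_derivative_def has_derivative_at_withinI)
        have "norm (Y (snd c (\<gamma> s))) \<le> M"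
          using r(2)[of "snd c (\<gamma> s)"] sN norm_triangle_ineq2[of "Y (snd c (\<gamma> s))" "Y x0"]
          unfolding N_iff M_def by auto
        then show "onorm (\<lambda>h. h *\<^sub>R Y (snd c (\<gamma> s))) \<le> M"
          by (intro onorm_bound) (use M in \<open>simp_all add: mult.commute[of M] mult_left_mono\<close>)
      qed (use ab in auto)
      then show ?thesis by simp
    qed
    \<comment> \<open>At the first exit time the coordinates still converge, to a point inside the ball; the curve
      would be there by uniqueness of limits.\<close>
    have allN: "\<gamma> s \<in> N" if "0 \<le> s" "s \<le> t" for s
    proof (rule ccontr)
      assume nN: "\<gamma> s \<notin> N"
      define K where "K = {s \<in> {0..t}. \<gamma> s \<notin> N}"
      have contc: "continuous_on {0..t} \<gamma>"
        by (intro continuous_at_imp_continuous_on ballI contI sI) auto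
      have "closed ({0..t} \<inter> \<gamma> -` (- N))"
        by (intro continuous_closed_preimage contc) (use oN in \<open>auto simp: closed_Compl\<close>)
      moreover have "K = {0..t} \<inter> \<gamma> -` (- N)" by (auto simp: K_def)
      ultimately have Kc: "closed K" by simp
      have Kne: "K \<noteq> {}" using nN that unfolding K_def by auto
      have Kb: "bdd_below K" unfolding K_def by (rule bdd_belowI[of _ 0]) auto
      define s1 where "s1 = Inf K"
      have s1K: "s1 \<in> K" unfolding s1_def by (rule closed_contains_Inf[OF Kne Kb Kc])
      then have s1: "0 < s1" "s1 \<le> t" "\<gamma> s1 \<notin> N" using N0 unfolding K_def by (auto simp: less_le)
      have before: "\<gamma> s \<in> N" if "0 \<le> s" "s < s1" for s
      proof (rule ccontr)
        assume "\<gamma> s \<notin> N"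
        then have "s \<in> K" using that s1 by (simp add: K_def)
        then have "s1 \<le> s" unfolding s1_def by (rule cInf_lower[OF _ Kb])
        then show False using that by simp
      qed
      define sn where "sn n = s1 - s1 / real (Suc n)" for n
      have sn: "0 \<le> sn n" "sn n < s1" for n
        using s1(1) unfolding sn_def by (auto simp: field_simps)
      have "(\<lambda>n. s1 - s1 * inverse (real (Suc n))) \<longlonglongrightarrow> s1 - s1 * 0"
        by (intro tendsto_intros LIMSEQ_inverse_real_of_nat)
      then have snl: "sn \<longlonglongrightarrow> s1" by (simp add: sn_def[abs_def] divide_inverse)
      let ?J = "{0..<s1}"
      have J: "convex ?J" "?J \<subseteq> {0..t}" "\<And>s. s \<in> ?J \<Longrightarrow> \<gamma> s \<in> N" using before s1 by auto
      have stp: "norm (snd c (\<gamma> b) - snd c (\<gamma> a)) \<le> M * \<bar>b - a\<bar>" if "a \<in> ?J" "b \<in> ?J" for a b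
        by (rule step[OF that J])
      have "Cauchy (\<lambda>n. snd c (\<gamma> (sn n)))"
      proof (rule metric_CauchyI)
        fix d :: real assume d: "d > 0"
        obtain m0 where m0: "\<And>m n. m \<ge> m0 \<Longrightarrow> n \<ge> m0 \<Longrightarrow> dist (sn m) (sn n) < d / M"
          using metric_CauchyD[OF LIMSEQ_imp_Cauchy[OF snl], of "d / M"] d M by auto
        have "dist (snd c (\<gamma> (sn m))) (snd c (\<gamma> (sn n))) < d" if "m \<ge> m0" "n \<ge> m0" for m n
        proof -
          have "dist (snd c (\<gamma> (sn m))) (snd c (\<gamma> (sn n))) \<le> M * dist (sn m) (sn n)"
            using stp[of "sn n" "sn m"] sn by (simp add: dist_norm)
          also have "\<dots> < M * (d / M)" using m0[OF that] M by (intro mult_strict_left_mono) auto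
          finally show ?thesis using M by simp
        qed
        then show "\<exists>m0. \<forall>m\<ge>m0. \<forall>n\<ge>m0. dist (snd c (\<gamma> (sn m))) (snd c (\<gamma> (sn n))) < d" by blast
      qed
      then obtain y where y: "(\<lambda>n. snd c (\<gamma> (sn n))) \<longlonglongrightarrow> y"
        using finite_dim_complete[OF fdA] unfolding complete_def by blast
      have "norm (y - x0) \<le> M * s1"
      proof (rule LIMSEQ_le_const2)
        show "(\<lambda>n. norm (snd c (\<gamma> (sn n)) - x0)) \<longlonglongrightarrow> norm (y - x0)" by (intro tendsto_intros y)
        have "norm (snd c (\<gamma> (sn n)) - x0) \<le> M * s1" for n
        proof -
          have "norm (snd c (\<gamma> (sn n)) - x0) \<le> M * \<bar>sn n - 0\<bar>"
            using stp[of 0 "sn n"] sn[of n] s1 \<gamma>(6) by (simp add: x0_def)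
          also have "\<dots> \<le> M * s1" using sn[of n] M by (intro mult_left_mono) auto
          finally show ?thesis .
        qed
        then show "\<exists>N. \<forall>n\<ge>N. norm (snd c (\<gamma> (sn n)) - x0) \<le> M * s1" by blast
      qed
      also have "\<dots> \<le> M * t" using s1 M by (intro mult_left_mono) auto
      also have "\<dots> < r" using tM by (simp add: mult.commute)
      finally have yr: "dist y x0 < r" by (simp add: dist_norm)
      have "(\<lambda>n. chart_inv c (snd c (\<gamma> (sn n)))) \<longlonglongrightarrow> chart_inv c y"
        by (rule isCont_tendsto_compose[OF isCont_chart_inv[OF ch(1)] y]) (use r(2)[OF yr] in blast)
      moreover have "chart_inv c (snd c (\<gamma> (sn n))) = \<gamma> (sn n)" for n
        using before[of "sn n"] sn[of n] N_iff chart_inv_left[OF ch(1)] by blast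
      ultimately have 1: "(\<lambda>n. \<gamma> (sn n)) \<longlonglongrightarrow> chart_inv c y" by simp
      have "(\<lambda>n. \<gamma> (sn n)) \<longlonglongrightarrow> \<gamma> s1"
        by (rule isCont_tendsto_compose[OF contI[OF sI] snl]) (use s1 in auto)
      then have "\<gamma> s1 = chart_inv c y" using 1 LIMSEQ_unique by blast
      then have "\<gamma> s1 \<in> N" unfolding N_def using yr by (auto simp: dist_commute)
      then show False using s1(3) by blast
    qed
    have "norm ((snd c (\<gamma> t) - t *\<^sub>R Y x0) - (snd c (\<gamma> 0) - 0 *\<^sub>R Y x0)) \<le> e * norm (t - 0)"
    proof (rule differentiable_bound[of "{0..t}"])
      fix s assume s: "s \<in> {0..t}"
      then have sN: "\<gamma> s \<in> N" and si: "s \<in> I" using allN sI by auto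
      have 1: "((\<lambda>s. snd c (\<gamma> s)) has_derivative (\<lambda>h. h *\<^sub>R Y (snd c (\<gamma> s)))) (at s within {0..t})"
        using der[OF si sN] by (simp add: has_vector_derivative_def has_derivative_at_withinI)
      have 2: "((\<lambda>s. s *\<^sub>R Y x0) has_derivative (\<lambda>h. h *\<^sub>R Y x0)) (at s within {0..t})"
        by (auto intro!: derivative_eq_intros)
      show "((\<lambda>s. snd c (\<gamma> s) - s *\<^sub>R Y x0) has_derivative (\<lambda>h. h *\<^sub>R (Y (snd c (\<gamma> s)) - Y x0))) (at s within {0..t})"
        using has_derivative_diff[OF 1 2] by (simp add: scaleR_diff_right)
      have "norm (Y (snd c (\<gamma> s)) - Y x0) \<le> e" using r(2) sN N_iff by blast
      then show "onorm (\<lambda>h. h *\<^sub>R (Y (snd c (\<gamma> s)) - Y x0)) \<le> e"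
        by (intro onorm_bound) (use e in \<open>simp_all add: mult.commute[of e] mult_left_mono\<close>)
    qed (use t in auto)
    then show ?thesis using t \<gamma>(6,7) by (simp add: x0_def algebra_simps)
  qed
  show ?thesis
    by (rule that[of "r / M"]) (use r(1) M est in \<open>auto simp: Y_def x0_def\<close>)
qed

end

section \<open>Generators, momentum maps and relative equilibria\<close>

locale hamiltonian_action = symplectic A \<omega> + abelian_lie B
  for A :: "('m::{t2_space, second_countable_topology}, 'e::real_normed_vector) chart set"
    and \<omega> :: "'m \<Rightarrow> 'e \<Rightarrow> 'e \<Rightarrow> real"
    and B :: "('g::{ab_group_add, t2_space, second_countable_topology}, 'f::real_normed_vector) chart set" +
  fixes act :: "'g \<Rightarrow> 'm \<Rightarrow> 'm" and J :: "'m \<Rightarrow> 'f \<Rightarrow>\<^sub>L real"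
  assumes action: "smooth_action B A act"
    and momentum: "momentum_map B A \<omega> act J"
    and J_invariant: "J (act g m) = J m"
begin

lemma act_0 [simp]: "act 0 m = m"
  and act_add: "act (a + b) m = act a (act b m)"
  and smooth_act: "smooth_map (prod_atlas B A) A (\<lambda>(g, m). act g m)"
  using action unfolding smooth_action_def by auto

lemma smooth_act_in_charts:
  assumes b: "b \<in> B" "g \<in> fst b" and c: "c \<in> A" "p \<in> fst c" and d: "d \<in> A" "act g p \<in> fst d"
  shows "smooth_at (\<lambda>(x, y). snd d (act (chart_inv b x) (chart_inv c y))) (snd b g, snd c p)"
proof -
  have "smooth_at (\<lambda>(x, y). snd d (case (chart_inv b x, chart_inv c y) of (g, m) \<Rightarrow> act g m)) (snd b g, snd c p)"
    by (rule smooth_map_from_prod[OF smooth_act])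
       (use b c d smooth_manifold_is_chart[OF smooth_manifold_B] smooth_manifold_is_chart[OF smooth_manifold_A] in auto)
  then show ?thesis by simp
qed

lemma isCont_act: "isCont (\<lambda>(g, m). act g m) z"
  using smooth_act continuous_on_eq_continuous_at[of UNIV] unfolding smooth_map_def by auto

lemma tendsto_act: "(a \<longlongrightarrow> g) F \<Longrightarrow> (q \<longlongrightarrow> p) F \<Longrightarrow> ((\<lambda>n. act (a n) (q n)) \<longlongrightarrow> act g p) F"
  using isCont_tendsto_compose[OF isCont_act[of "(g, p)"] tendsto_Pair[of a g F q p]] by simp

text \<open>The action in the coordinates of a chart of the manifold and exponential coordinates of
  the group.\<close>

definition flow :: "('m, 'e) chart \<Rightarrow> 'f \<times> 'e \<Rightarrow> 'e" where
  "flow c = (\<lambda>(v, x). snd c (act (expo v) (chart_inv c x)))"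

text \<open>The infinitesimal generator in the coordinates of a fixed chart, where it can be
  differentiated.\<close>

definition gen :: "('m, 'e) chart \<Rightarrow> 'f \<Rightarrow> 'e \<Rightarrow> 'e" where
  "gen c \<zeta> x = frechet_derivative (flow c) (at (0, x)) (\<zeta>, 0)"

lemma smooth_flow:
  assumes c: "c \<in> A" "p \<in> fst c"
  shows "smooth_at (flow c) (0, snd c p)"
proof -
  have 1: "smooth_at (\<lambda>(x, y). snd c (act (chart_inv c0 x) (chart_inv c y))) (snd c0 0, snd c p)"
    by (rule smooth_act_in_charts) (use c c0 in auto)
  have "smooth_at (\<lambda>z. \<phi> (expo (fst z))) (0 :: 'f, snd c p)"
    by (rule smooth_at_compose[OF fdB, of fst]) (simp_all add: smooth_at_\<phi>_expo_0 smooth_at_bounded_linear bounded_linear_fst)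
  then have 2: "smooth_at (\<lambda>z. (\<phi> (expo (fst z)) + snd c0 0, snd z)) (0 :: 'f, snd c p)"
    by (intro smooth_at_Pair smooth_at_add smooth_at_const) (simp_all add: smooth_at_bounded_linear bounded_linear_snd)
  have "smooth_at (\<lambda>z. (\<lambda>(x, y). snd c (act (chart_inv c0 x) (chart_inv c y))) (\<phi> (expo (fst z)) + snd c0 0, snd z)) (0 :: 'f, snd c p)"
    by (rule smooth_at_compose[OF finite_dim_prod[OF fdB fdA] 2]) (use 1 in simp)
  then show ?thesis
  proof (rule smooth_at_transform)
    have "\<forall>\<^sub>F z in nhds (0 :: 'f, snd c p). fst z \<in> ball 0 (r0 / 8)"
      by (rule isCont_eventually_in) (use C0 in \<open>auto intro: continuous_intros\<close>)
    then show "\<forall>\<^sub>F z in nhds (0, snd c p). (\<lambda>(x, y). snd c (act (chart_inv c0 x) (chart_inv c y))) (\<phi> (expo (fst z)) + snd c0 0, snd z) = flow c z"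
    proof eventually_elim
      case (elim z)
      then have "expo (fst z) \<in> fst c0" by (intro expo_near_0) simp
      then show ?case by (simp add: flow_def \<phi>_def chart_inv_left[OF c0(3)] case_prod_beta')
    qed
  qed
qed

lemma linear_gen:
  assumes c: "c \<in> A" "p \<in> fst c" shows "linear (\<lambda>\<zeta>. gen c \<zeta> (snd c p))"
proof -
  have l: "linear (frechet_derivative (flow c) (at (0, snd c p)))"
    by (rule smooth_at_linear_derivative[OF smooth_flow[OF c]])
  have "linear (\<lambda>\<zeta>::'f. (\<zeta>, 0::'e))" by (rule linearI) auto
  from linear_compose[OF this l] show ?thesis unfolding gen_def comp_def .
qed

lemma smooth_gen:
  assumes c: "c \<in> A" "p \<in> fst c" shows "smooth_at (gen c \<zeta>) (snd c p)"
proof -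
  have "smooth_at (\<lambda>x::'e. (0::'f, x)) (snd c p)" by (intro smooth_at_Pair) auto
  from smooth_at_compose[OF finite_dim_prod[OF fdB fdA] this smooth_at_frechet_derivative[OF smooth_flow[OF c]]]
  show ?thesis unfolding gen_def .
qed

lemma orbit_derivative:
  assumes c: "c \<in> A" "p \<in> fst c"
  shows "((\<lambda>v. snd c (act (expo v) p)) has_derivative (\<lambda>\<zeta>. gen c \<zeta> (snd c p))) (at 0)"
proof -
  have ch: "is_chart c" using smooth_manifold_is_chart[OF smooth_manifold_A c(1)] .
  have "((\<lambda>v::'f. (v, snd c p)) has_derivative (\<lambda>\<zeta>. (\<zeta>, 0))) (at 0)"
    by (intro has_derivative_Pair has_derivative_ident has_derivative_const)
  from has_derivative_compose[OF this smooth_at_has_derivative[OF smooth_flow[OF c]]]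
  show ?thesis by (simp add: flow_def gen_def chart_inv_left[OF ch c(2)])
qed

lemma orbit_line_derivative:
  assumes c: "c \<in> A" "p \<in> fst c"
  shows "((\<lambda>t. snd c (act (expo (t *\<^sub>R \<zeta>)) p)) has_vector_derivative gen c \<zeta> (snd c p)) (at 0)"
proof -
  have l: "((\<lambda>t::real. t *\<^sub>R \<zeta>) has_derivative (\<lambda>s. s *\<^sub>R \<zeta>)) (at 0)"
    by (auto intro!: derivative_eq_intros)
  have "((\<lambda>v. snd c (act (expo v) p)) has_derivative (\<lambda>\<zeta>. gen c \<zeta> (snd c p))) (at (0 *\<^sub>R \<zeta>))"
    using orbit_derivative[OF c] by simp
  from has_derivative_compose[OF l this]
  show ?thesis by (simp add: has_vector_derivative_def linear_scale[OF linear_gen[OF c]])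
qed

lemma isCont_orbit: "isCont (\<lambda>t. act (expo (t *\<^sub>R \<zeta>)) p) t"
proof -
  have "((\<lambda>t. expo (t *\<^sub>R \<zeta>)) \<longlongrightarrow> expo (t *\<^sub>R \<zeta>)) (at t)"
    using smooth_map_isCont[OF smooth_expo_line] by (simp add: isCont_def)
  then show ?thesis unfolding isCont_def by (intro tendsto_act tendsto_const)
qed

abbreviation infg where "infg \<equiv> inf_generator B A act"

lemma inf_generator_eq: "infg \<zeta> p = gen (chart_at A p) \<zeta> (snd (chart_at A p) p)"
proof -
  have "infg \<zeta> p = frechet_derivative (\<lambda>t. snd (chart_at A p) (act (expo (t *\<^sub>R \<zeta>)) p)) (at 0) 1"
    by (simp add: inf_generator_def mderiv_def lie_exp_eq in_charts_def comp_def)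
  also have "\<dots> = 1 *\<^sub>R gen (chart_at A p) \<zeta> (snd (chart_at A p) p)"
    by (rule frechet_derivative_apply)
       (use orbit_line_derivative[OF at_in(1,2)] in \<open>simp add: has_vector_derivative_def\<close>)
  finally show ?thesis by simp
qed

text \<open>The curve continues from time \<open>t\<close> as the orbit curve of the point reached,
  so the derivative at 0 determines all velocities.\<close>

lemma orbit_velocity: "has_velocity A (\<lambda>t. act (expo (t *\<^sub>R \<zeta>)) p) (infg \<zeta> (act (expo (t *\<^sub>R \<zeta>)) p)) t"
  unfolding has_velocity_chart_at
proof
  show "isCont (\<lambda>t. act (expo (t *\<^sub>R \<zeta>)) p) t" by (rule isCont_orbit)
  define q where "q = act (expo (t *\<^sub>R \<zeta>)) p"
  have eq: "act (expo (s *\<^sub>R \<zeta>)) p = act (expo ((s - t) *\<^sub>R \<zeta>)) q" for s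
    unfolding q_def act_add[symmetric] expo_add[symmetric] by (simp add: scaleR_add_left[symmetric])
  have "((\<lambda>s. snd (chart_at A q) (act (expo (s *\<^sub>R \<zeta>)) q)) has_vector_derivative infg \<zeta> q) (at (t - t))"
    using orbit_line_derivative[OF at_in(1,2)] by (simp add: inf_generator_eq)
  moreover have "((\<lambda>s. s - t) has_vector_derivative 1) (at t)"
    by (auto intro!: derivative_eq_intros)
  ultimately have "((\<lambda>s. snd (chart_at A q) (act (expo ((s - t) *\<^sub>R \<zeta>)) q)) has_vector_derivative 1 *\<^sub>R infg \<zeta> q) (at t)"
    using vector_diff_chain_at[of "\<lambda>s. s - t" 1 t "\<lambda>s. snd (chart_at A q) (act (expo (s *\<^sub>R \<zeta>)) q)" "infg \<zeta> q"]
    by (simp add: comp_def)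
  then show "((\<lambda>s. snd (chart_at A (act (expo (t *\<^sub>R \<zeta>)) p)) (act (expo (s *\<^sub>R \<zeta>)) p))
      has_vector_derivative infg \<zeta> (act (expo (t *\<^sub>R \<zeta>)) p)) (at t)"
    unfolding q_def[symmetric] eq by simp
qed

lemma smooth_J: "smooth_map A vs_atlas J"
  using momentum unfolding momentum_map_def by blast

lemma smooth_map_vsI:
  fixes f :: "'m \<Rightarrow> 'z::real_normed_vector"
  assumes "continuous_on UNIV f" "\<And>c p. c \<in> A \<Longrightarrow> p \<in> fst c \<Longrightarrow> smooth_at (\<lambda>x. f (chart_inv c x)) (snd c p)"
  shows "smooth_map A vs_atlas f"
  unfolding smooth_map_def
proof (intro conjI ballI assms(1) smooth_on_smooth_at)
  fix c x and d :: "('z, 'z) chart" assume c: "c \<in> A" and d: "d \<in> vs_atlas" and x: "x \<in> snd c ` (fst c \<inter> f -` fst d)"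
  have "d = (UNIV, id)" using d by (simp add: vs_atlas_def)
  then show "smooth_at (in_charts c d f) x" using assms(2)[OF c] x by (auto simp: in_charts_def comp_def)
qed

lemma smooth_vs_in_atlas:
  assumes f: "smooth_map A vs_atlas f" and c: "c \<in> A" "p \<in> fst c"
  shows "smooth_at (\<lambda>x. f (chart_inv c x)) (snd c p)"
  by (rule smooth_map_to_vs[OF smooth_manifold_A f atlas_subset_maximal[OF smooth_manifold_A c(1)] c(2)])

lemma smooth_J_component: "smooth_map A vs_atlas (\<lambda>m. blinfun_apply (J m) \<eta>)"
proof (rule smooth_map_vsI)
  have "continuous_on UNIV J" using smooth_J unfolding smooth_map_def by blast
  then show "continuous_on UNIV (\<lambda>m. blinfun_apply (J m) \<eta>)" by (intro continuous_intros)
  show "smooth_at (\<lambda>x. blinfun_apply (J (chart_inv c x)) \<eta>) (snd c p)" if "c \<in> A" "p \<in> fst c" for c p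
    by (rule smooth_at_bounded_linear_compose[OF _ smooth_vs_in_atlas[OF smooth_J that], of "\<lambda>a. blinfun_apply a \<eta>"])
       (rule blinfun.bounded_linear_left)
qed

lemma smooth_minus_J:
  assumes "smooth_map A vs_atlas h"
  shows "smooth_map A vs_atlas (\<lambda>m. h m - blinfun_apply (J m) \<eta>)"
proof (rule smooth_map_vsI)
  show "continuous_on UNIV (\<lambda>m. h m - blinfun_apply (J m) \<eta>)"
    using assms smooth_J_component[of \<eta>] unfolding smooth_map_def by (intro continuous_on_diff) blast+
  show "smooth_at (\<lambda>x. h (chart_inv c x) - blinfun_apply (J (chart_inv c x)) \<eta>) (snd c p)" if "c \<in> A" "p \<in> fst c" for c p
    by (intro smooth_at_diff smooth_vs_in_atlas[OF _ that] assms smooth_J_component)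
qed

lemma momentum_derivative:
  "\<omega> p (infg \<zeta> p) v = mderiv A vs_atlas (\<lambda>m. blinfun_apply (J m) \<zeta>) p v"
proof -
  have "infg \<zeta> p = hamiltonian_vf A \<omega> (\<lambda>m. blinfun_apply (J m) \<zeta>) p"
    using momentum unfolding momentum_map_def by blast
  then show ?thesis using hamiltonian_vf_spec[OF smooth_J_component] by simp
qed

text \<open>\<open>J\<^sup>\<zeta>\<close> is a Hamiltonian for the generator, and the form is
  nondegenerate.\<close>

lemma infg_0_iff: "infg \<zeta> p = 0 \<longleftrightarrow> critical (\<lambda>m. blinfun_apply (J m) \<zeta>) p"
  unfolding critical_def momentum_derivative[symmetric]
  using \<omega>_cancel[of p "infg \<zeta> p" 0] by (auto simp: bilinear_lzero[OF bilinear_\<omega>])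

lemma invariant_derivative_along_orbit:
  assumes f: "smooth_map A vs_atlas f" and inv: "\<And>g m. f (act g m) = f m" and c: "c \<in> A" "p \<in> fst c"
  shows "frechet_derivative (\<lambda>x. f (chart_inv c x)) (at (snd c p)) (gen c \<zeta> (snd c p)) = 0"
proof -
  have ch: "is_chart c" using smooth_manifold_is_chart[OF smooth_manifold_A c(1)] .
  let ?f = "\<lambda>x. f (chart_inv c x)" and ?\<gamma> = "\<lambda>t. act (expo (t *\<^sub>R \<zeta>)) p"
  have "(?f has_derivative frechet_derivative ?f (at (snd c p))) (at (snd c (?\<gamma> 0)))"
    using smooth_at_has_derivative[OF smooth_vs_in_atlas[OF f c]] by simp
  from has_derivative_compose[OF orbit_line_derivative[OF c, unfolded has_vector_derivative_def] this]
  have 1: "((\<lambda>t. ?f (snd c (?\<gamma> t))) has_derivative (\<lambda>t. frechet_derivative ?f (at (snd c p)) (t *\<^sub>R gen c \<zeta> (snd c p)))) (at 0)" .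
  have "\<forall>\<^sub>F t in nhds 0. ?\<gamma> t \<in> fst c"
    by (rule isCont_eventually_in[OF isCont_orbit chart_open[OF ch]]) (use c in simp)
  then obtain U where U: "open U" "0 \<in> U" "\<And>t. t \<in> U \<Longrightarrow> ?\<gamma> t \<in> fst c"
    unfolding eventually_nhds by blast
  have "((\<lambda>t. f p) has_derivative (\<lambda>t. frechet_derivative ?f (at (snd c p)) (t *\<^sub>R gen c \<zeta> (snd c p)))) (at (0::real))"
    by (rule has_derivative_transform_within_open[OF 1 U(1,2)])
       (simp add: chart_inv_left[OF ch U(3)] inv)
  then have "(\<lambda>t::real. frechet_derivative ?f (at (snd c p)) (t *\<^sub>R gen c \<zeta> (snd c p))) = (\<lambda>t. 0)"
    using has_derivative_unique has_derivative_const by blast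
  from fun_cong[OF this, of 1] show ?thesis by simp
qed

text \<open>The function equals its composition with the diffeomorphism \<open>act (- g)\<close>,
  and the chain rule moves the vanishing derivative from \<open>p\<close> to \<open>act g
  p\<close>.\<close>

lemma critical_act:
  assumes f: "smooth_map A vs_atlas f" and inv: "\<And>g m. f (act g m) = f m" and p: "critical f p"
  shows "critical f (act g p)"
proof -
  let ?q = "act g p"
  let ?c = "chart_at A p" and ?d = "chart_at A ?q"
  obtain b where b: "b \<in> B" "- g \<in> fst b" using atlas_chart_exists[OF smooth_manifold_B] .
  have chb: "is_chart b" using smooth_manifold_is_chart[OF smooth_manifold_B b(1)] .
  have ret: "act (- g) ?q = p" by (simp add: act_add[symmetric])
  have 1: "smooth_at (\<lambda>(x, y). snd ?c (act (chart_inv b x) (chart_inv ?d y))) (snd b (- g), snd ?d ?q)"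
    by (rule smooth_act_in_charts[OF b at_in(1,2) at_in(1)]) (simp add: ret at_in(2))
  have "smooth_at (\<lambda>y. (snd b (- g), y)) (snd ?d ?q)" by (intro smooth_at_Pair) auto
  from smooth_at_compose[OF finite_dim_prod[OF fdB fdA] this 1]
  have sT: "smooth_at (\<lambda>y. snd ?c (act (- g) (chart_inv ?d y))) (snd ?d ?q)"
    by (simp add: chart_inv_left[OF chb b(2)])
  let ?T = "\<lambda>y. snd ?c (act (- g) (chart_inv ?d y))"
  let ?f = "\<lambda>x. f (chart_inv ?c x)"
  have Tq: "?T (snd ?d ?q) = snd ?c p" by (simp add: chart_inv_left[OF at_in(3,2)] ret)
  have fz: "frechet_derivative ?f (at (snd ?c p)) = (\<lambda>v. 0)"
    using p unfolding critical_def mderiv_vs by blast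
  have "(?f has_derivative (\<lambda>v. 0)) (at (?T (snd ?d ?q)))"
    unfolding Tq using smooth_at_has_derivative[OF smooth_vs_in_atlas[OF f at_in(1,2)], of p] fz by simp
  from has_derivative_compose[OF smooth_at_has_derivative[OF sT] this]
  have 2: "((\<lambda>y. ?f (?T y)) has_derivative (\<lambda>v. 0)) (at (snd ?d ?q))" .
  have "isCont (\<lambda>y. act (- g) (chart_inv ?d y)) (snd ?d ?q)"
    using isCont_chart_inv[OF at_in(3), of "snd ?d ?q" ?q] at_in(2)
    unfolding isCont_def by (intro tendsto_act tendsto_const) blast
  from isCont_eventually_in[OF this chart_open[OF at_in(3)], of p]
  have "\<forall>\<^sub>F y in nhds (snd ?d ?q). act (- g) (chart_inv ?d y) \<in> fst ?c"
    by (simp add: chart_inv_left[OF at_in(3,2)] ret at_in(2))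
  then obtain U where U: "open U" "snd ?d ?q \<in> U" "\<And>y. y \<in> U \<Longrightarrow> act (- g) (chart_inv ?d y) \<in> fst ?c"
    unfolding eventually_nhds by blast
  have "((\<lambda>y. f (chart_inv ?d y)) has_derivative (\<lambda>v. 0)) (at (snd ?d ?q))"
    by (rule has_derivative_transform_within_open[OF 2 U(1,2)])
       (simp add: chart_inv_left[OF at_in(3) U(3)] inv)
  then show ?thesis unfolding critical_def mderiv_vs using frechet_derivative_apply by blast
qed

lemma mderiv_minus_J:
  assumes h: "smooth_map A vs_atlas h"
  shows "mderiv A vs_atlas (\<lambda>m. h m - blinfun_apply (J m) \<eta>) p v =
    mderiv A vs_atlas h p v - mderiv A vs_atlas (\<lambda>m. blinfun_apply (J m) \<eta>) p v"
  unfolding mderiv_vs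
  by (rule frechet_derivative_apply)
     (intro has_derivative_diff smooth_at_has_derivative smooth_vs_in_atlas[OF _ at_in(1,2)] h smooth_J_component)

lemma critical_iff_vf:
  assumes h: "smooth_map A vs_atlas h"
  shows "critical (\<lambda>m. h m - blinfun_apply (J m) \<eta>) p \<longleftrightarrow> hamiltonian_vf A \<omega> h p = infg \<eta> p"
proof -
  have "critical (\<lambda>m. h m - blinfun_apply (J m) \<eta>) p \<longleftrightarrow> (\<forall>v. \<omega> p (hamiltonian_vf A \<omega> h p) v = \<omega> p (infg \<eta> p) v)"
    unfolding critical_def mderiv_minus_J[OF h] hamiltonian_vf_spec[OF h] momentum_derivative by simp
  then show ?thesis using \<omega>_cancel by metis
qed

text \<open>The whole orbit consists of critical points of \<open>h - J\<^sup>\<eta>\<close>, so the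
  Hamiltonian vector field agrees along it with the generator, and \<open>exp(t\<eta>) p\<close> is
  an integral curve.\<close>

lemma critical_imp_relative_equilibrium:
  assumes h: "smooth_map A vs_atlas h" and inv: "\<And>g m. h (act g m) = h m"
    and p: "critical (\<lambda>m. h m - blinfun_apply (J m) \<eta>) p"
  shows "relative_equilibrium B A \<omega> act h \<eta> p"
  unfolding relative_equilibrium_def lie_exp_eq
proof
  fix t
  have "has_velocity A (\<lambda>t. act (expo (t *\<^sub>R \<eta>)) p) (hamiltonian_vf A \<omega> h (act (expo (s *\<^sub>R \<eta>)) p)) s" for s
  proof -
    have "critical (\<lambda>m. h m - blinfun_apply (J m) \<eta>) (act (expo (s *\<^sub>R \<eta>)) p)"
      by (rule critical_act[OF smooth_minus_J[OF h] _ p]) (simp add: inv J_invariant)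
    then show ?thesis using orbit_velocity[of \<eta> p s] unfolding critical_iff_vf[OF h] by simp
  qed
  then show "flow_to A (hamiltonian_vf A \<omega> h) t p (act (expo (t *\<^sub>R \<eta>)) p)"
    unfolding flow_to_def
    by (intro exI[of _ "\<lambda>t. act (expo (t *\<^sub>R \<eta>)) p"] exI[of _ UNIV]) simp
qed

text \<open>Both \<open>\<xi>\<^sub>M(p)\<close> and \<open>X\<^sub>h(p)\<close> are the initial
  velocity of \<open>t \<mapsto> exp(t\<xi>) p\<close>: the former by definition of the generator,
  the latter because each point of this curve is reached from \<open>p\<close> by the flow.\<close>

lemma relative_equilibrium_imp_critical:
  assumes h: "smooth_map A vs_atlas h" and re: "relative_equilibrium B A \<omega> act h \<xi> p"
  shows "critical (\<lambda>m. h m - blinfun_apply (J m) \<xi>) p"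
proof -
  let ?c = "chart_at A p"
  let ?X = "hamiltonian_vf A \<omega> h"
  let ?\<gamma> = "\<lambda>t. act (expo (t *\<^sub>R \<xi>)) p"
  define Y where "Y = dtrans ?c ?c p (?X p)"
  have Yeq: "Y = ?X p" unfolding Y_def dtrans_self[OF at_in(4) at_in(2)] ..
  have fl: "flow_to A ?X t p (?\<gamma> t)" for t
    using re unfolding relative_equilibrium_def lie_exp_eq by blast
  have der: "((\<lambda>t. snd ?c (?\<gamma> t)) has_vector_derivative infg \<xi> p) (at 0)"
    using orbit_line_derivative[OF at_in(1,2)] by (simp add: inf_generator_eq)
  have close: "norm (infg \<xi> p - Y) \<le> 2 * e" if e: "e > 0" for e
  proof -
    obtain T where T: "T > 0" "\<And>t q. 0 < t \<Longrightarrow> t < T \<Longrightarrow> flow_to A ?X t p q \<Longrightarrow> norm (snd ?c q - snd ?c p - t *\<^sub>R Y) \<le> e * t"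
      using flow_to_first_order[OF at_in(1,2)[of p] hamiltonian_vf_in_chart_continuous[OF h at_in(1,2)[of p]] e]
      unfolding Let_def chart_inv_left[OF at_in(3,2)] Y_def[symmetric] by metis
    obtain d where d: "d > 0" "\<And>t. norm (t - 0) < d \<Longrightarrow>
        norm (snd ?c (?\<gamma> t) - snd ?c (?\<gamma> 0) - (t - 0) *\<^sub>R infg \<xi> p) \<le> e * norm (t - 0)"
      using der e unfolding has_vector_derivative_def has_derivative_at_alt by blast
    define t where "t = min T d / 2"
    have t: "0 < t" "t < T" "norm (t - 0) < d" using T(1) d(1) by (auto simp: t_def)
    have 1: "norm (snd ?c (?\<gamma> t) - snd ?c p - t *\<^sub>R Y) \<le> e * t" by (rule T(2)[OF t(1,2) fl])
    have 2: "norm (snd ?c (?\<gamma> t) - snd ?c p - t *\<^sub>R infg \<xi> p) \<le> e * t" using d(2)[OF t(3)] t(1) by simp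
    have eq: "t *\<^sub>R (infg \<xi> p - Y) = (snd ?c (?\<gamma> t) - snd ?c p - t *\<^sub>R Y) - (snd ?c (?\<gamma> t) - snd ?c p - t *\<^sub>R infg \<xi> p)"
      by (simp add: scaleR_diff_right)
    have "norm (t *\<^sub>R (infg \<xi> p - Y)) \<le> e * t + e * t"
      unfolding eq using norm_triangle_ineq4 1 2 by (meson add_mono order_trans)
    moreover have "norm (t *\<^sub>R (infg \<xi> p - Y)) = t * norm (infg \<xi> p - Y)" using t(1) by simp
    ultimately have "t * norm (infg \<xi> p - Y) \<le> t * (2 * e)" by (simp add: algebra_simps del: norm_scaleR)
    then show ?thesis using t(1) by simp
  qed
  have "norm (infg \<xi> p - Y) \<le> 0 + e" if "e > 0" for e using close[of "e / 2"] that by simp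
  then have "norm (infg \<xi> p - Y) \<le> 0" by (rule field_le_epsilon)
  then show ?thesis unfolding critical_iff_vf[OF h] using Yeq by simp
qed


subsection \<open>The isotropy group as a submanifold\<close>

lemma linear_infg: "linear (\<lambda>\<zeta>. infg \<zeta> p)"
  unfolding inf_generator_eq by (rule linear_gen[OF at_in(1,2)])

text \<open>If \<open>J\<^sup>\<zeta>\<close> is critical at \<open>p\<close>, it is critical along
  the orbit, so the curve \<open>exp(t\<zeta>) p\<close> has zero velocity throughout.\<close>

lemma stabilizer_algebra:
  assumes "infg \<zeta> p = 0" shows "act (expo (t *\<^sub>R \<zeta>)) p = p"
proof -
  have "infg \<zeta> (act (expo (s *\<^sub>R \<zeta>)) p) = 0" for s
    using critical_act[OF smooth_J_component _ assms[unfolded infg_0_iff]] unfolding infg_0_iff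
    by (simp add: J_invariant)
  then have "has_velocity A (\<lambda>t. act (expo (t *\<^sub>R \<zeta>)) p) 0 s" for s
    using orbit_velocity[of \<zeta> p s] by simp
  from zero_velocity_constant[of "\<lambda>t. act (expo (t *\<^sub>R \<zeta>)) p", OF this] show ?thesis by simp
qed

text \<open>Split \<open>v = P v + u\<close> with \<open>P v\<close> in the isotropy algebra.  Then
  \<open>exp u\<close> also fixes \<open>p\<close>.  On the complement the map \<open>u \<mapsto>
  exp(u) p\<close> is an immersion at 0, so \<open>u = 0\<close> when \<open>u\<close> is
  small.\<close>

lemma stabilizer_locally_exponential:
  obtains \<delta> where "\<delta> > 0" "\<And>v. norm v < \<delta> \<Longrightarrow> act (expo v) p = p \<Longrightarrow> infg v p = 0"
proof -
  let ?c = "chart_at A p"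
  let ?h = "{\<zeta>. infg \<zeta> p = 0}"
  have h: "subspace ?h" 
    by (auto simp: subspace_def linear_0[OF linear_infg] linear_add[OF linear_infg] linear_scale[OF linear_infg])
  obtain P where P: "bounded_linear P" "range P \<subseteq> ?h" "\<And>v. P v = v \<longleftrightarrow> v \<in> ?h"
    using subspace_projection[OF fdB h] by blast
  let ?k = "{v. P v = 0}"
  have k: "subspace ?k"
    using bounded_linear.linear[OF P(1)] by (auto simp: subspace_def linear_0 linear_add linear_scale)
  have inj: "inj_on (\<lambda>\<zeta>. infg \<zeta> p) ?k"
  proof (rule inj_onI)
    fix v w assume vw: "v \<in> ?k" "w \<in> ?k" "infg v p = infg w p"
    then have "v - w \<in> ?h" by (simp add: linear_diff[OF linear_infg])
    then have "P (v - w) = v - w" using P(3) by blast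
    then show "v = w" using vw linear_diff[OF bounded_linear.linear[OF P(1)]] by simp
  qed
  obtain l where l: "linear l" "\<And>v. v \<in> ?k \<Longrightarrow> l (infg v p) = v"
    using linear_exists_left_inverse_on[OF linear_infg k inj] by metis
  obtain C where C: "C > 0" "\<And>v. norm (l v) \<le> norm v * C"
    using bounded_linear.pos_bounded[OF finite_dim_linear_bounded[OF fdA l(1)]] by blast
  have der: "((\<lambda>v. snd ?c (act (expo v) p)) has_derivative (\<lambda>\<zeta>. infg \<zeta> p)) (at 0)"
    using orbit_derivative[OF at_in(1,2)] unfolding inf_generator_eq .
  obtain d where d: "d > 0" "\<And>v. norm (v - 0) < d \<Longrightarrow>
      norm (snd ?c (act (expo v) p) - snd ?c (act (expo 0) p) - infg (v - 0) p) \<le> 1 / (2 * C) * norm (v - 0)"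
    using der C(1) unfolding has_derivative_at_alt by (metis zero_less_divide_1_iff zero_less_mult_iff zero_less_numeral)
  have "isCont (\<lambda>v. v - P v) 0" by (intro continuous_intros linear_continuous_at P(1))
  then have "\<forall>\<^sub>F v in nhds 0. v - P v \<in> ball 0 d"
    using d(1) linear_0[OF bounded_linear.linear[OF P(1)]] by (intro isCont_eventually_in) auto
  then obtain \<delta> where \<delta>: "\<delta> > 0" "\<And>v. dist v 0 < \<delta> \<Longrightarrow> v - P v \<in> ball 0 d"
    unfolding eventually_nhds_metric by blast
  have "infg v p = 0" if v: "norm v < \<delta>" "act (expo v) p = p" for v
  proof -
    define u where "u = v - P v"
    have PP: "P (P v) = P v" using P(2,3) by blast
    have uk: "u \<in> ?k" unfolding u_def using linear_diff[OF bounded_linear.linear[OF P(1)]] PP by simp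
    have "infg (P v) p = 0" using P(2) by blast
    from stabilizer_algebra[OF this, of "-1"] have "act (expo (- P v)) p = p" by simp
    then have fx: "act (expo u) p = p"
      unfolding u_def using v(2) by (simp add: expo_add act_add diff_conv_add_uminus del: add_uminus_conv_diff)
    have "norm (u - 0) < d" using \<delta>(2)[of v] v(1) by (simp add: u_def)
    from d(2)[OF this] have "norm (infg u p) \<le> 1 / (2 * C) * norm u" by (simp add: fx)
    then have "norm (infg u p) * C \<le> 1 / (2 * C) * norm u * C" using C(1) by (intro mult_right_mono) auto
    then have "norm (l (infg u p)) \<le> 1/2 * norm u" using C(2)[of "infg u p"] C(1) by simp
    then have "u = 0" unfolding l(2)[OF uk] by simp
    then show ?thesis using P(3)[of v] unfolding u_def by simp
  qed
  then show ?thesis using that \<delta>(1) by blast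
qed

text \<open>Exponential coordinates, translated to a point \<open>a\<close> of the isotropy group,
  turn a neighbourhood of \<open>a\<close> in it into a neighbourhood of 0 in its Lie
  algebra.\<close>

theorem isotropy_submanifold:
  "submanifold B (dim {\<zeta>. infg \<zeta> p = 0}) (isotropy act p)"
  unfolding submanifold_def
proof
  let ?h = "{\<zeta>. infg \<zeta> p = 0}" and ?H = "isotropy act p"
  have h: "subspace ?h" 
    by (auto simp: subspace_def linear_0[OF linear_infg] linear_add[OF linear_infg] linear_scale[OF linear_infg])
  fix a assume a: "a \<in> ?H"
  obtain \<delta> where \<delta>: "\<delta> > 0" "\<And>v. norm v < \<delta> \<Longrightarrow> act (expo v) p = p \<Longrightarrow> infg v p = 0"
    using stabilizer_locally_exponential by metis
  obtain c V where c: "c \<in> maximal_atlas B" and V: "open V" "0 \<in> V" "V \<subseteq> ball 0 \<delta>" "fst c = expo ` V"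
    "inj_on expo V" "\<And>v. v \<in> V \<Longrightarrow> snd c (expo v) = v"
    using logarithmic_chart[of "ball 0 \<delta>", OF open_ball] \<delta>(1) by (metis centre_in_ball)
  let ?d = "((\<lambda>g. a + g) ` fst c, \<lambda>g. snd c (- a + g))"
  have im: "snd c ` fst c = V" using V(4,6) by (force simp: image_image)
  have d: "?d \<in> maximal_atlas B" "snd ?d ` fst ?d = V"
    using chart_transport[OF smooth_manifold_B c smooth_map_translation smooth_map_translation, of a "- a"] im
    by simp_all
  have pa: "act a p = p" using a unfolding isotropy_def by simp
  have mem: "a + expo v \<in> ?H \<longleftrightarrow> v \<in> ?h" if v: "v \<in> V" for v
  proof -
    have "act (a + expo v) p = p \<longleftrightarrow> act (expo v) p = p"
      using act_add[of a "expo v" p] act_add[of "expo v" a p] pa by (simp add: add.commute)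
    moreover have "act (expo v) p = p \<longleftrightarrow> infg v p = 0"
      using \<delta>(2)[of v] v V(3) stabilizer_algebra[of v p 1] by auto
    ultimately show ?thesis unfolding isotropy_def by simp
  qed
  have "snd ?d ` (fst ?d \<inter> ?H) = V \<inter> ?h"
  proof
    show "snd ?d ` (fst ?d \<inter> ?H) \<subseteq> V \<inter> ?h"
    proof
      fix x assume "x \<in> snd ?d ` (fst ?d \<inter> ?H)"
      then obtain v where "v \<in> V" "a + expo v \<in> ?H" "x = snd c (- a + (a + expo v))" unfolding V(4) by auto
      then show "x \<in> V \<inter> ?h" using mem V(6) by simp
    qed
    show "V \<inter> ?h \<subseteq> snd ?d ` (fst ?d \<inter> ?H)"
    proof
      fix v assume v: "v \<in> V \<inter> ?h"
      then have "a + expo v \<in> fst ?d \<inter> ?H" using mem V(4) by auto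
      moreover have "snd ?d (a + expo v) = v" using V(6) v by simp
      ultimately show "v \<in> snd ?d ` (fst ?d \<inter> ?H)" by (metis imageI)
    qed
  qed
  moreover have "a \<in> fst ?d"
    unfolding V(4) using V(2) by (auto simp: image_iff intro!: bexI[of _ "0::'f"])
  ultimately show "\<exists>c\<in>maximal_atlas B. a \<in> fst c \<and>
      (\<exists>L. subspace L \<and> dim L = dim ?h \<and> snd c ` (fst c \<inter> ?H) = snd c ` fst c \<inter> L)"
    using d h by (intro bexI[of _ ?d] conjI exI[of _ ?h]) auto
qed

theorem isotropy_codimension:
  "model_dim B - submanifold_dim B (isotropy act p) = dim (range (\<lambda>\<zeta>. infg \<zeta> p))"
proof -
  have "0 \<in> isotropy act p" by (simp add: isotropy_def)
  from submanifold_dim_eq[OF smooth_manifold_B isotropy_submanifold this]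
  have "submanifold_dim B (isotropy act p) = dim {\<zeta>. infg \<zeta> p = 0}" .
  moreover have "dim (range (\<lambda>\<zeta>. infg \<zeta> p)) + dim {\<zeta>. infg \<zeta> p = 0} = model_dim B"
    using rank_nullity[OF fdB linear_infg subspace_UNIV, of p] by (simp add: model_dim_def)
  ultimately show ?thesis by simp
qed

end

section \<open>Critical points of a family with symmetry\<close>

text \<open>Nondegeneracy on moving subspaces \<open>{u. D x u \<in> W}\<close>.  Pull the form back
  to \<open>W\<close> by \<open>M = (D x)\<inverse>\<close>; the map \<open>N x\<close> compares its
  Gram matrix with that at \<open>x0\<close>.  It is the identity at \<open>x0\<close>, hence
  injective nearby, and it kills every vector of the radical.\<close>

lemma nondegenerate_near:
  fixes \<beta> :: "'x::real_normed_vector \<Rightarrow> 'e::real_normed_vector \<Rightarrow> 'e \<Rightarrow> real"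
  assumes fd: "finite_dim TYPE('e)"
    and bil: "\<forall>\<^sub>F x in nhds x0. bilinear (\<beta> x)" and sm: "\<And>v w. smooth_at (\<lambda>x. \<beta> x v w) x0"
    and D: "\<forall>\<^sub>F x in nhds x0. linear (D x)" "\<And>v. smooth_at (\<lambda>x. D x v) x0" "D x0 = (\<lambda>v. v)"
    and W: "subspace W" and nd: "nondegenerate_on W (\<beta> x0)"
  shows "\<forall>\<^sub>F x in nhds x0. \<forall>u. D x u \<in> W \<longrightarrow> (\<forall>u'. D x u' \<in> W \<longrightarrow> \<beta> x u u' = 0) \<longrightarrow> u = 0"
proof -
  have bil0: "bilinear (\<beta> x0)" using bil by (rule eventually_nhds_x_imp_x)
  have lin0: "linear (\<lambda>v. \<beta> x0 v i)" "linear (\<beta> x0 v)" for i v using bil0 by (auto simp: bilinear_def)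
  obtain b where b: "finite b" "independent b" "span b = W"
    using finite_dim_subspace_basis[OF fd W] by metis
  obtain e where e: "\<And>j. j \<in> b \<Longrightarrow> e j \<in> W" "\<And>i j. i \<in> b \<Longrightarrow> j \<in> b \<Longrightarrow> \<beta> x0 (e j) i = (if i = j then 1 else 0)"
    using nondegenerate_dual_basis[OF fd bil0 nd b] by metis
  have rep: "w = (\<Sum>i\<in>b. \<beta> x0 w i *\<^sub>R e i)" if w: "w \<in> W" for w
  proof -
    let ?u = "w - (\<Sum>i\<in>b. \<beta> x0 w i *\<^sub>R e i)"
    have "\<beta> x0 ?u k = 0" if "k \<in> b" for k
      using that b(1) by (simp add: linear_diff[OF lin0(1)] linear_sum[OF lin0(1)] linear_scale[OF lin0(1)] e(2)
          if_distrib[of "\<lambda>c. _ * c"] cong: if_cong)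
    then have "\<beta> x0 ?u k = 0" if "k \<in> W" for k
      using linear_eq_0_on_span[OF lin0(2), of b ?u k] that b(3) by blast
    moreover have "?u \<in> W" using w e(1) W by (intro subspace_diff subspace_sum subspace_scale) auto
    ultimately have "?u = 0" using nd unfolding nondegenerate_on_def by blast
    then show ?thesis by simp
  qed
  have Dbij0: "bij (D x0)" unfolding D(3) using bij_id unfolding id_def .
  define M where "M x = inv (D x)" for x
  have M0: "M x0 w = w" for w unfolding M_def D(3) using inv_id[unfolded id_def] by metis
  have Mbij: "\<forall>\<^sub>F x in nhds x0. bij (D x)"
    by (rule linear_family_eventually_bij[OF fd D(1) smooth_at_isCont[OF D(2)] Dbij0])
  have Mlin: "\<forall>\<^sub>F x in nhds x0. linear (M x)"
    using Mbij D(1) unfolding M_def by eventually_elim (rule finite_dim_linear_inv)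
  have Msm: "smooth_at (\<lambda>x. M x w) x0" for w
    unfolding M_def by (rule smooth_at_linear_inverse[OF fd D(1,2) Dbij0])
  have l1: "\<forall>\<^sub>F x in nhds x0. linear (\<lambda>v. \<beta> x v k)" for k
    using bil by eventually_elim (simp add: bilinear_def)
  have s1: "smooth_at (\<lambda>x. \<beta> x (M x w) k) x0" for w k
    by (rule smooth_at_family_apply[OF fd l1 sm Msm])
  have l2: "\<forall>\<^sub>F x in nhds x0. linear (\<beta> x (M x w))" for w
    using bil by eventually_elim (simp add: bilinear_def)
  have s2: "smooth_at (\<lambda>x. \<beta> x (M x w) (M x i)) x0" for w i
    by (rule smooth_at_family_apply[OF fd l2 s1 Msm])
  define N where "N x w = w + (\<Sum>i\<in>b. (\<beta> x (M x w) (M x i) - \<beta> x0 w i) *\<^sub>R e i)" for x w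
  have N0: "N x0 = (\<lambda>w. w)" unfolding N_def M0 by simp
  have Nbij0: "bij (N x0)" unfolding N0 using bij_id unfolding id_def .
  have Nlin: "\<forall>\<^sub>F x in nhds x0. linear (N x)"
    using bil Mlin
  proof eventually_elim
    case (elim x)
    have l: "linear (\<lambda>v. \<beta> x v k)" for k using elim(1) by (simp add: bilinear_def)
    show ?case
      by (rule linearI) (simp_all add: N_def linear_add[OF elim(2)] linear_scale[OF elim(2)] linear_add[OF l]
          linear_scale[OF l] linear_add[OF lin0(1)] linear_scale[OF lin0(1)] algebra_simps sum.distrib
          sum_subtractf scaleR_sum_right)
  qed
  have Ns: "smooth_at (\<lambda>x. N x w) x0" for w
    unfolding N_def by (intro smooth_at_add smooth_at_const smooth_at_sum smooth_at_scaleR smooth_at_diff s2)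
  have "\<forall>\<^sub>F x in nhds x0. bij (N x)"
    by (rule linear_family_eventually_bij[OF fd Nlin smooth_at_isCont[OF Ns] Nbij0])
  then show ?thesis using Mbij Nlin Mlin
  proof eventually_elim
    case (elim x)
    have DM: "D x (M x w) = w" "M x (D x w) = w" for w
      using elim(2) unfolding M_def by (simp_all add: bij_is_surj bij_is_inj surj_f_inv_f)
    show ?case
    proof (intro allI impI)
      fix u assume u: "D x u \<in> W" "\<forall>u'. D x u' \<in> W \<longrightarrow> \<beta> x u u' = 0"
      have "i \<in> W" if "i \<in> b" for i using that b(3) span_base by blast
      then have "\<beta> x u (M x i) = 0" if "i \<in> b" for i using u(2) DM(1) that by simp
      then have "N x (D x u) = D x u - (\<Sum>i\<in>b. \<beta> x0 (D x u) i *\<^sub>R e i)"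
        unfolding N_def DM by (simp add: sum_negf)
      also have "\<dots> = 0" using rep[OF u(1)] by simp
      finally have "D x u = 0" using elim(1) linear_0[OF elim(3)] by (metis bij_pointE)
      then show "u = 0" using DM(2)[of u] linear_0[OF elim(4)] by simp
    qed
  qed
qed

lemma second_derivative_bilinear:
  fixes F :: "'e::real_normed_vector \<Rightarrow> real"
  assumes F: "smooth_at F x0"
  shows "bilinear (\<lambda>v w. frechet_derivative (\<lambda>x. frechet_derivative F (at x) w) (at x0) v)"
proof -
  let ?g = "\<lambda>w x. frechet_derivative F (at x) w"
  have sg: "smooth_at (?g w) x0" for w by (rule smooth_at_frechet_derivative[OF F])
  have dg: "(?g w has_derivative frechet_derivative (?g w) (at x0)) (at x0)" for w
    by (rule smooth_at_has_derivative[OF sg])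
  obtain U where U: "open U" "x0 \<in> U" "\<And>x. x \<in> U \<Longrightarrow> smooth_at F x"
    using smooth_at_eventually[OF F] unfolding eventually_nhds by blast
  have lin: "linear (frechet_derivative F (at x))" if "x \<in> U" for x
    using smooth_at_linear_derivative[OF U(3)[OF that]] .
  have add: "frechet_derivative (?g (v + w)) (at x0) u = frechet_derivative (?g v) (at x0) u + frechet_derivative (?g w) (at x0) u" for u v w
  proof (rule frechet_derivative_apply)
    show "(?g (v + w) has_derivative (\<lambda>u. frechet_derivative (?g v) (at x0) u + frechet_derivative (?g w) (at x0) u)) (at x0)"
      by (rule has_derivative_transform_within_open[OF has_derivative_add[OF dg[of v] dg[of w]] U(1,2)])
         (simp add: linear_add[OF lin])
  qed
  have scale: "frechet_derivative (?g (r *\<^sub>R w)) (at x0) u = r *\<^sub>R frechet_derivative (?g w) (at x0) u" for u r w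
  proof (rule frechet_derivative_apply)
    show "(?g (r *\<^sub>R w) has_derivative (\<lambda>u. r *\<^sub>R frechet_derivative (?g w) (at x0) u)) (at x0)"
      by (rule has_derivative_transform_within_open[OF has_derivative_scaleR_right[OF dg[of w]] U(1,2)])
         (simp add: linear_scale[OF lin])
  qed
  show ?thesis unfolding bilinear_def
  proof (intro conjI allI)
    show "linear (\<lambda>w. frechet_derivative (?g w) (at x0) v)" for v by (rule linearI) (simp_all add: add scale)
    show "linear (\<lambda>v. frechet_derivative (?g w) (at x0) v)" for w using smooth_at_linear_derivative[OF sg] .
  qed
qed

lemma bilinear_flip: "bilinear \<beta> \<Longrightarrow> bilinear (\<lambda>v w. \<beta> w v)"
  by (auto simp: bilinear_def)

text \<open>Used at a critical point, where the derivatives of the generators drop out, and for the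
  multiplier, which vanishes there.\<close>

lemma derivative_vanishing_pairing:
  fixes g :: "'i \<Rightarrow> 'x::real_normed_vector \<Rightarrow> real" and c :: "'i \<Rightarrow> 'x \<Rightarrow> 'b::real_normed_vector"
  assumes "\<And>i. i \<in> I \<Longrightarrow> smooth_at (g i) x" "\<And>i. i \<in> I \<Longrightarrow> g i x = 0" "\<And>i. i \<in> I \<Longrightarrow> isCont (c i) x"
  shows "((\<lambda>y. \<Sum>i\<in>I. g i y *\<^sub>R c i y) has_derivative (\<lambda>h. \<Sum>i\<in>I. frechet_derivative (g i) (at x) h *\<^sub>R c i x)) (at x)"
  by (intro has_derivative_sum has_derivative_scaleR_vanishing smooth_at_has_derivative assms)

text \<open>The reduction described at the beginning, for a function \<open>f\<close> (the
  Hamiltonian), functions \<open>j \<zeta>\<close> (the components of the momentum map) and vector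
  fields \<open>Z \<zeta>\<close> (the generators) near a point \<open>x0\<close> of a vector space.
  The solutions are delivered in straightened form: near \<open>x0\<close> every point of the
  \<open>\<Phi>\<close>-preimage of the subspace \<open>W\<close> is critical for some \<open>f - j
  \<eta>\<close>, and \<open>\<Phi>\<close> has derivative 1 at \<open>x0\<close>, so
  \<open>W\<close> is the tangent space there.\<close>

theorem critical_slice:
  fixes f :: "'e::real_normed_vector \<Rightarrow> real" and j :: "'f::real_normed_vector \<Rightarrow> 'e \<Rightarrow> real"
    and Z :: "'f \<Rightarrow> 'e \<Rightarrow> 'e" and \<omega> :: "'e \<Rightarrow> 'e \<Rightarrow> real"
  assumes fdE: "finite_dim TYPE('e)" and fdF: "finite_dim TYPE('f)"
    and f: "smooth_at f x0" and j: "\<forall>\<^sub>F x in nhds x0. \<forall>\<zeta>. smooth_at (j \<zeta>) x"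
    and jlin: "\<And>x. linear (\<lambda>\<zeta>. j \<zeta> x)"
    and Zlin: "\<forall>\<^sub>F x in nhds x0. linear (\<lambda>\<zeta>. Z \<zeta> x)" and Zs: "\<And>\<zeta>. smooth_at (Z \<zeta>) x0"
    and fZ: "\<forall>\<^sub>F x in nhds x0. \<forall>\<zeta>. frechet_derivative f (at x) (Z \<zeta> x) = 0"
    and jZ: "\<forall>\<^sub>F x in nhds x0. \<forall>\<eta> \<zeta>. frechet_derivative (j \<eta>) (at x) (Z \<zeta> x) = 0"
    and \<omega>: "bilinear \<omega>" "\<And>v. \<omega> v v = 0" "nondegenerate_on UNIV \<omega>"
    and mom: "\<And>\<zeta> v. \<omega> (Z \<zeta> x0) v = frechet_derivative (j \<zeta>) (at x0) v"
    and crit: "\<And>v. frechet_derivative (\<lambda>x. f x - j \<xi> x) (at x0) v = 0"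
    and K_def: "K = {v. \<forall>\<zeta>. frechet_derivative (j \<zeta>) (at x0) v = 0}"
    and Q_def: "Q = (\<lambda>v w. frechet_derivative (\<lambda>x. frechet_derivative (\<lambda>x. f x - j \<xi> x) (at x) w) (at x0) v)"
    and nondeg: "{v \<in> K. \<forall>w\<in>K. Q v w = 0} = range (\<lambda>\<zeta>. Z \<zeta> x0)"
  obtains W \<Phi> where "subspace W" "dim W = 2 * dim (range (\<lambda>\<zeta>. Z \<zeta> x0))" "nondegenerate_on W \<omega>"
    "smooth_at \<Phi> x0" "frechet_derivative \<Phi> (at x0) = (\<lambda>v. v)" "\<Phi> x0 \<in> W"
    "\<forall>\<^sub>F x in nhds x0. \<Phi> x \<in> W \<longrightarrow> (\<exists>\<eta>. \<forall>v. frechet_derivative (\<lambda>x. f x - j \<eta> x) (at x) v = 0)"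
proof -
  define Orb where "Orb = range (\<lambda>\<zeta>. Z \<zeta> x0)"
  have skew: "\<omega> v w = - \<omega> w v" for v w
  proof -
    have "\<omega> (v + w) (v + w) = (\<omega> v v + \<omega> w v) + (\<omega> v w + \<omega> w w)"
      by (simp add: bilinear_ladd[OF \<omega>(1)] bilinear_radd[OF \<omega>(1)])
    then have "\<omega> v w + \<omega> w v = 0" unfolding \<omega>(2) by simp
    then show ?thesis by linarith
  qed
  have l\<omega>: "linear (\<lambda>v. \<omega> v w)" "linear (\<omega> v)" for v w using \<omega>(1) by (auto simp: bilinear_def)
  have j0: "smooth_at (j \<zeta>) x0" for \<zeta> using eventually_nhds_x_imp_x[OF j] by blast
  have Zl0: "linear (\<lambda>\<zeta>. Z \<zeta> x0)" using eventually_nhds_x_imp_x[OF Zlin] .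
  have Orb: "subspace Orb" unfolding Orb_def using linear_subspace_image[OF Zl0 subspace_UNIV] .
  have K_iff: "v \<in> K \<longleftrightarrow> (\<forall>u\<in>Orb. \<omega> u v = 0)" for v
    unfolding K_def Orb_def by (auto simp: mom)
  have K: "subspace K"
  proof (rule subspaceI)
    show "0 \<in> K" unfolding K_iff by (simp add: linear_0[OF l\<omega>(2)])
    show "v + w \<in> K" if "v \<in> K" "w \<in> K" for v w
      using that unfolding K_iff by (simp add: linear_add[OF l\<omega>(2)])
    show "c *\<^sub>R v \<in> K" if "v \<in> K" for c v
      using that unfolding K_iff by (simp add: linear_scale[OF l\<omega>(2)])
  qed
  have OK: "Orb \<subseteq> K"
    using eventually_nhds_x_imp_x[OF jZ] unfolding Orb_def K_def by auto
  \<comment> \<open>The basis of the orbit direction is extended so that \<open>d\<close> can be dual to it with respect to \<open>\<omega>\<close>.\<close>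
  obtain bO where bO: "finite bO" "independent bO" "span bO = Orb"
    using finite_dim_subspace_basis[OF fdE Orb] by metis
  obtain bE where bE: "bO \<subseteq> bE" "independent bE" "UNIV \<subseteq> span bE"
    using maximal_independent_subset_extend[OF subset_UNIV bO(2)] by metis
  have fbE: "finite bE" using finite_dim_independent_finite[OF fdE bE(2)] .
  have nd': "nondegenerate_on UNIV (\<lambda>v w. \<omega> w v)"
    using \<omega>(3) skew unfolding nondegenerate_on_def by (metis neg_equal_0_iff_equal)
  obtain d where d: "\<And>i k. i \<in> bE \<Longrightarrow> k \<in> bE \<Longrightarrow> \<omega> i (d k) = (if i = k then 1 else 0)"
    using nondegenerate_dual_basis[OF fdE bilinear_flip[OF \<omega>(1)] nd' fbE bE(2)] bE(3) by (metis top.extremum_uniqueI)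
  have dO: "\<omega> i (d k) = (if i = k then 1 else 0)" if "i \<in> bO" "k \<in> bO" for i k
    using d that bE(1) by blast
  have "\<forall>i\<in>bO. \<exists>\<zeta>. Z \<zeta> x0 = i" using span_base[of _ bO] bO(3) unfolding Orb_def by (metis imageE)
  then obtain z where z: "\<And>i. i \<in> bO \<Longrightarrow> Z (z i) x0 = i" by metis
  have repO: "(\<Sum>i\<in>bO. \<omega> u (d i) *\<^sub>R i) = u" if u: "u \<in> Orb" for u
  proof -
    have l: "linear (\<lambda>u. \<Sum>i\<in>bO. \<omega> u (d i) *\<^sub>R i)"
      by (rule linearI) (simp_all add: linear_add[OF l\<omega>(1)] linear_scale[OF l\<omega>(1)] scaleR_add_left sum.distrib scaleR_sum_right)
    have "(\<Sum>i\<in>bO. \<omega> k (d i) *\<^sub>R i) = k" if "k \<in> bO" for k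
      using that bO(1) by (simp add: dO if_distrib[of "\<lambda>c. c *\<^sub>R _"] cong: if_cong)
    then show ?thesis using linear_eq_on[OF l linear_ident, of u bO] u bO(3) by blast
  qed
  define F where "F x = f x - j \<xi> x" for x
  define g where "g w x = frechet_derivative F (at x) w" for w x
  have F: "smooth_at F x0" unfolding F_def by (intro smooth_at_diff f j0)
  have evF: "\<forall>\<^sub>F x in nhds x0. smooth_at F x" by (rule smooth_at_eventually[OF F])
  have sg: "smooth_at (g w) x0" for w unfolding g_def by (rule smooth_at_frechet_derivative[OF F])
  have g0: "g w x0 = 0" for w using crit unfolding g_def F_def by blast
  have Q: "Q = (\<lambda>v w. frechet_derivative (g w) (at x0) v)"
    unfolding Q_def g_def F_def ..
  have bilQ: "bilinear Q" unfolding Q g_def by (rule second_derivative_bilinear[OF F])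
  have lQ: "linear (\<lambda>v. Q v w)" "linear (Q v)" for v w using bilQ by (auto simp: bilinear_def)
  have evfj: "\<forall>\<^sub>F x in nhds x0. (\<forall>w. g w x = frechet_derivative f (at x) w - frechet_derivative (j \<xi>) (at x) w)"
    using smooth_at_eventually[OF f] j
  proof eventually_elim
    case (elim x)
    show ?case unfolding g_def F_def
      by (intro allI frechet_derivative_apply has_derivative_diff smooth_at_has_derivative) (use elim in auto)
  qed
  have evgZ: "\<forall>\<^sub>F x in nhds x0. \<forall>\<zeta>. g (Z \<zeta> x) x = 0"
    using evfj fZ jZ by eventually_elim simp
  \<comment> \<open>Differentiate the identity \<open>dF(Z \<zeta>) = 0\<close>; the term with the derivative of \<open>Z\<close> carries the
    factor \<open>dF(x0) = 0\<close>.\<close>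
  have QO: "Q v u = 0" if u: "u \<in> Orb" for u v
  proof -
    obtain \<zeta> where \<zeta>: "u = Z \<zeta> x0" using u unfolding Orb_def by blast
    obtain b :: "'e set" and c where b: "finite b" "\<And>i. i \<in> b \<Longrightarrow> bounded_linear (c i)"
      "\<And>v. (\<Sum>i\<in>b. c i v *\<^sub>R i) = v"
      using finite_dim_coordinates[OF fdE] by metis
    have 1: "((\<lambda>x. \<Sum>i\<in>b. g i x *\<^sub>R c i (Z \<zeta> x)) has_derivative (\<lambda>h. \<Sum>i\<in>b. Q h i *\<^sub>R c i (Z \<zeta> x0))) (at x0)"
      unfolding Q by (rule derivative_vanishing_pairing[OF sg g0])
        (rule smooth_at_isCont[OF smooth_at_bounded_linear_compose[OF b(2) Zs]])
    have "\<forall>\<^sub>F x in nhds x0. (\<Sum>i\<in>b. g i x *\<^sub>R c i (Z \<zeta> x)) = 0"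
      using evgZ evF
    proof eventually_elim
      case (elim x)
      have l: "linear (\<lambda>w. g w x)" unfolding g_def by (rule smooth_at_linear_derivative[OF elim(2)])
      have "(\<Sum>i\<in>b. g i x *\<^sub>R c i (Z \<zeta> x)) = g (\<Sum>i\<in>b. c i (Z \<zeta> x) *\<^sub>R i) x"
        by (simp add: linear_sum[OF l] linear_scale[OF l] mult.commute)
      then show ?case using elim(1) by (simp add: b(3))
    qed
    then obtain U where U: "open U" "x0 \<in> U" "\<And>x. x \<in> U \<Longrightarrow> (\<Sum>i\<in>b. g i x *\<^sub>R c i (Z \<zeta> x)) = 0"
      unfolding eventually_nhds by blast
    have "((\<lambda>x. 0) has_derivative (\<lambda>h. \<Sum>i\<in>b. Q h i *\<^sub>R c i (Z \<zeta> x0))) (at x0)"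
      by (rule has_derivative_transform_within_open[OF 1 U])
    then have "(\<lambda>h. \<Sum>i\<in>b. Q h i *\<^sub>R c i (Z \<zeta> x0)) = (\<lambda>h. 0)"
      using has_derivative_unique has_derivative_const by blast
    then have "(\<Sum>i\<in>b. Q v i *\<^sub>R c i (Z \<zeta> x0)) = 0" by (rule fun_cong)
    moreover have "Q v (Z \<zeta> x0) = (\<Sum>i\<in>b. Q v i *\<^sub>R c i (Z \<zeta> x0))"
      using linear_sum[OF lQ(2), of v "\<lambda>i. c i (Z \<zeta> x0) *\<^sub>R i" b]
      by (simp add: b(3) linear_scale[OF lQ(2)] mult.commute)
    ultimately show ?thesis unfolding \<zeta> by simp
  qed
  have nondeg': "v \<in> Orb \<longleftrightarrow> v \<in> K \<and> (\<forall>w\<in>K. Q v w = 0)" for v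
    using nondeg unfolding Orb_def by blast
  \<comment> \<open>\<open>K'\<close> is the complement of the orbit direction in \<open>K\<close> given by the kernel of a projection \<open>P\<close>.\<close>
  obtain P where P: "bounded_linear P" "range P \<subseteq> Orb" "\<And>v. P v = v \<longleftrightarrow> v \<in> Orb"
    using subspace_projection[OF fdE Orb] by blast
  have lP: "linear P" using bounded_linear.linear[OF P(1)] .
  define K' where "K' = {v \<in> K. P v = 0}"
  have K': "subspace K'"
    using K unfolding K'_def subspace_def by (auto simp: linear_0[OF lP] linear_add[OF lP] linear_scale[OF lP])
  have split: "P w \<in> Orb" "P w \<in> K" "w \<in> K \<Longrightarrow> w - P w \<in> K'" for w
  proof -
    show PO: "P w \<in> Orb" using P(2) by blast
    then show PK: "P w \<in> K" using OK by blast
    have "P (P w) = P w" using P(3) PO by blast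
    then show "w - P w \<in> K'" if "w \<in> K"
      unfolding K'_def using subspace_diff[OF K that PK] by (simp add: linear_diff[OF lP])
  qed
  have QK': "v \<in> Orb" if "v \<in> K" "\<And>w. w \<in> K' \<Longrightarrow> Q v w = 0" for v
  proof -
    have "Q v w = 0" if "w \<in> K" for w
      using \<open>\<And>w. w \<in> K' \<Longrightarrow> Q v w = 0\<close>[OF split(3)[OF that]] QO[OF split(1), of v w]
      by (simp add: linear_diff[OF lQ(2)])
    then show ?thesis using nondeg' that(1) by blast
  qed
  have ndK': "nondegenerate_on K' Q"
    unfolding nondegenerate_on_def
  proof (intro ballI impI)
    fix v assume v: "v \<in> K'" "\<forall>w\<in>K'. Q v w = 0"
    then have "v \<in> Orb" using QK' unfolding K'_def by blast
    then have "P v = v" using P(3) by blast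
    then show "v = 0" using v(1) unfolding K'_def by simp
  qed
  obtain b where b: "finite b" "independent b" "span b = K'"
    using finite_dim_subspace_basis[OF fdE K'] by metis
  have bK': "i \<in> K'" if "i \<in> b" for i using that b(3) span_base by blast
  have bK: "i \<in> K" if "i \<in> b" for i using bK'[OF that] unfolding K'_def by blast
  obtain e where e: "\<And>k. k \<in> b \<Longrightarrow> e k \<in> K'" "\<And>i k. i \<in> b \<Longrightarrow> k \<in> b \<Longrightarrow> Q (e k) i = (if i = k then 1 else 0)"
    using nondegenerate_dual_basis[OF fdE bilQ ndK' b] by metis
  have spanb: "Q v w = 0" if "\<And>i. i \<in> b \<Longrightarrow> Q v i = 0" "w \<in> K'" for v w
    using linear_eq_0_on_span[OF lQ(2), of b v w] that b(3) by blast
  define W where "W = {v. \<forall>i\<in>b. Q v i = 0}"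
  have W: "subspace W"
    unfolding W_def subspace_def by (auto simp: linear_0[OF lQ(1)] linear_add[OF lQ(1)] linear_scale[OF lQ(1)])
  \<comment> \<open>\<open>\<pi>\<close> is the projection onto \<open>K'\<close> along \<open>W\<close>.\<close>
  define \<pi> where "\<pi> v = (\<Sum>i\<in>b. Q v i *\<^sub>R e i)" for v
  have l\<pi>: "linear \<pi>"
    by (rule linearI) (simp_all add: \<pi>_def linear_add[OF lQ(1)] linear_scale[OF lQ(1)] scaleR_add_left sum.distrib scaleR_sum_right)
  have Qsum: "Q (\<Sum>i\<in>b. a i *\<^sub>R e i) k = a k" if "k \<in> b" for a k
    using that b(1) by (simp add: linear_sum[OF lQ(1)] linear_scale[OF lQ(1)] e(2) if_distrib[of "\<lambda>c. _ * c"] cong: if_cong)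
  have Q\<pi>: "Q (\<pi> v) k = Q v k" if "k \<in> b" for v k unfolding \<pi>_def by (rule Qsum[OF that])
  have \<pi>K': "\<pi> v \<in> K'" for v unfolding \<pi>_def by (intro subspace_sum[OF K'] subspace_scale[OF K'] e(1))
  have \<pi>W: "v - \<pi> v \<in> W" for v unfolding W_def by (simp add: linear_diff[OF lQ(1)] Q\<pi>)
  have OW: "Orb \<subseteq> W" unfolding W_def using nondeg' bK by auto
  have WK: "v \<in> Orb" if "v \<in> W" "v \<in> K" for v
    by (rule QK'[OF that(2) spanb]) (use that(1) in \<open>auto simp: W_def\<close>)
  have ker\<pi>: "{v \<in> UNIV. \<pi> v = 0} = W"
  proof
    show "{v \<in> UNIV. \<pi> v = 0} \<subseteq> W"
    proof
      fix v assume "v \<in> {v \<in> UNIV. \<pi> v = 0}"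
      then have "Q v k = 0" if "k \<in> b" for k using Q\<pi>[OF that, of v] by (simp add: linear_0[OF lQ(1)])
      then show "v \<in> W" unfolding W_def by blast
    qed
    show "W \<subseteq> {v \<in> UNIV. \<pi> v = 0}" unfolding W_def \<pi>_def by (auto intro: sum.neutral)
  qed
  have ran\<pi>: "range \<pi> = K'"
  proof
    show "range \<pi> \<subseteq> K'" using \<pi>K' by blast
    show "K' \<subseteq> range \<pi>"
    proof
      fix v assume v: "v \<in> K'"
      have "v - \<pi> v \<in> K'" by (rule subspace_diff[OF K' v \<pi>K'])
      moreover have "Q (v - \<pi> v) w = 0" if "w \<in> K'" for w
        by (rule spanb[OF _ that]) (use \<pi>W in \<open>auto simp: W_def\<close>)
      ultimately have "v - \<pi> v = 0" using ndK' unfolding nondegenerate_on_def by blast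
      then show "v \<in> range \<pi>" by (metis rangeI right_minus_eq)
    qed
  qed
  \<comment> \<open>Three applications of rank-nullity: \<open>K\<close> is the \<open>\<omega>\<close>-orthogonal of the orbit direction, \<open>K'\<close> its
    complement in \<open>K\<close>, and \<open>W\<close> the kernel of \<open>\<pi>\<close>.\<close>
  have dimW: "dim W = 2 * dim Orb"
  proof -
    let ?N = "\<lambda>v. \<Sum>i\<in>bO. \<omega> i v *\<^sub>R i"
    have lN: "linear ?N"
      by (rule linearI) (simp_all add: linear_add[OF l\<omega>(2)] linear_scale[OF l\<omega>(2)] scaleR_add_left sum.distrib scaleR_sum_right)
    have kN: "{v \<in> UNIV. ?N v = 0} = K"
    proof
      show "K \<subseteq> {v \<in> UNIV. ?N v = 0}"
        unfolding K_iff[THEN iffD1, THEN bspec] using bO(3) span_base[of _ bO] by (auto simp: K_iff intro!: sum.neutral)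
      show "{v \<in> UNIV. ?N v = 0} \<subseteq> K"
      proof
        fix v assume "v \<in> {v \<in> UNIV. ?N v = 0}"
        then have "\<omega> i v = 0" if "i \<in> bO" for i
          using independentD[OF bO(2,1) subset_refl, of "\<lambda>i. \<omega> i v" i] that by simp
        then have "\<omega> u v = 0" if "u \<in> Orb" for u
          using linear_eq_0_on_span[OF l\<omega>(1), of bO v u] that bO(3) by blast
        then show "v \<in> K" unfolding K_iff by blast
      qed
    qed
    have rN: "range ?N = Orb"
    proof
      show "range ?N \<subseteq> Orb" 
        unfolding bO(3)[symmetric] by (intro image_subsetI span_sum span_scale span_base)
      show "Orb \<subseteq> range ?N"
      proof
        fix u assume u: "u \<in> Orb"
        define w where "w = (\<Sum>k\<in>bO. \<omega> u (d k) *\<^sub>R d k)"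
        have w: "\<omega> i w = \<omega> u (d i)" if "i \<in> bO" for i
          using that bO(1) unfolding w_def
          by (simp add: linear_sum[OF l\<omega>(2)] linear_scale[OF l\<omega>(2)] dO if_distrib[of "\<lambda>c. _ * c"] cong: if_cong)
        have "?N w = (\<Sum>i\<in>bO. \<omega> u (d i) *\<^sub>R i)"
          by (rule sum.cong[OF refl]) (simp only: w)
        then have "u = ?N w" unfolding repO[OF u] by (rule sym)
        then show "u \<in> range ?N" by (rule image_eqI) simp
      qed
    qed
    have 1: "dim Orb + dim K = dim (UNIV :: 'e set)"
      using rank_nullity[OF fdE lN subspace_UNIV] unfolding kN rN .
    have PK: "P ` K = Orb"
    proof
      show "P ` K \<subseteq> Orb" using split(1) by blast
      show "Orb \<subseteq> P ` K"
      proof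
        fix u assume "u \<in> Orb"
        then have "P u = u" "u \<in> K" using P(3) OK by blast+
        then show "u \<in> P ` K" by (metis imageI)
      qed
    qed
    have 2: "dim Orb + dim K' = dim K"
      using rank_nullity[OF fdE lP K] unfolding PK K'_def .
    have 3: "dim K' + dim W = dim (UNIV :: 'e set)"
      using rank_nullity[OF fdE l\<pi> subspace_UNIV] unfolding ker\<pi> ran\<pi> .
    show ?thesis using 1 2 3 by linarith
  qed
  have ndW: "nondegenerate_on W \<omega>"
    unfolding nondegenerate_on_def
  proof (intro ballI impI)
    fix v assume v: "v \<in> W" "\<forall>w\<in>W. \<omega> v w = 0"
    have "\<omega> u v = 0" if "u \<in> Orb" for u using v(2) OW that skew[of u v] by auto
    then have vK: "v \<in> K" unfolding K_iff by blast
    then have vO: "v \<in> Orb" using WK v(1) by blast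
    have "\<omega> v u = 0" for u
    proof -
      have "\<pi> u \<in> K" using \<pi>K' unfolding K'_def by blast
      then have "\<omega> v (\<pi> u) = 0" using vO unfolding K_iff by blast
      moreover have "\<omega> v (u - \<pi> u) = 0" using v(2) \<pi>W by blast
      ultimately show ?thesis by (simp add: linear_diff[OF l\<omega>(2)])
    qed
    then show "v = 0" using \<omega>(3) unfolding nondegenerate_on_def by blast
  qed
  define dj where "dj \<zeta> x v = frechet_derivative (j \<zeta>) (at x) v" for \<zeta> x v
  have sdj: "smooth_at (\<lambda>x. dj \<zeta> x v) x0" for \<zeta> v
    unfolding dj_def by (rule smooth_at_frechet_derivative[OF j0])
  have evdj: "\<forall>\<^sub>F x in nhds x0. (\<forall>v. linear (\<lambda>\<zeta>. dj \<zeta> x v)) \<and> (\<forall>\<zeta>. linear (dj \<zeta> x))"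
    using j
  proof eventually_elim
    case (elim x)
    have D: "(j \<zeta> has_derivative dj \<zeta> x) (at x)" for \<zeta>
      unfolding dj_def using elim smooth_at_has_derivative by blast
    have "dj (a + c) x v = dj a x v + dj c x v" for a c v
    proof -
      have "j (a + c) = (\<lambda>x. j a x + j c x)" using linear_add[OF jlin] by blast
      then show ?thesis unfolding dj_def[of "a + c"]
        using frechet_derivative_apply[OF has_derivative_add[OF D[of a] D[of c]]] by simp
    qed
    moreover have "dj (r *\<^sub>R a) x v = r *\<^sub>R dj a x v" for r a v
    proof -
      have "j (r *\<^sub>R a) = (\<lambda>x. r *\<^sub>R j a x)" using linear_scale[OF jlin] by blast
      then show ?thesis unfolding dj_def[of "r *\<^sub>R a"]
        using frechet_derivative_apply[OF has_derivative_scaleR_right[OF D[of a], of r]] by simp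
    qed
    moreover have "linear (dj \<zeta> x)" for \<zeta> using has_derivative_linear[OF D] .
    ultimately show ?case by (auto intro!: linearI)
  qed
  have dj0: "dj \<zeta> x0 v = \<omega> (Z \<zeta> x0) v" for \<zeta> v unfolding dj_def mom ..
  \<comment> \<open>The equations \<open>dj \<eta> x (d i) = g (d i) x\<close> for \<open>\<eta>\<close> are completed to a system \<open>L x \<eta> = r x\<close> which is
    square and has \<open>L x0 = 1\<close>; pairing it with \<open>\<zeta> \<mapsto> dj \<zeta> x0 (d i)\<close> gives them back.\<close>
  define L where "L x \<eta> = \<eta> + (\<Sum>i\<in>bO. (dj \<eta> x (d i) - dj \<eta> x0 (d i)) *\<^sub>R z i)" for x \<eta>
  have ldj0: "linear (\<lambda>\<zeta>. dj \<zeta> x0 v)" for v using eventually_nhds_x_imp_x[OF evdj] by blast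
  have evL: "\<forall>\<^sub>F x in nhds x0. linear (L x)"
    using evdj
  proof eventually_elim
    case (elim x)
    then have l: "linear (\<lambda>\<zeta>. dj \<zeta> x v)" for v by blast
    show ?case
      by (rule linearI) (simp_all add: L_def linear_add[OF l] linear_scale[OF l] linear_add[OF ldj0]
          linear_scale[OF ldj0] algebra_simps sum.distrib sum_subtractf scaleR_sum_right)
  qed
  have sL: "smooth_at (\<lambda>x. L x \<eta>) x0" for \<eta>
    unfolding L_def by (intro smooth_at_add smooth_at_const smooth_at_sum smooth_at_scaleR smooth_at_diff sdj)
  have L0: "L x0 = (\<lambda>\<eta>. \<eta>)" unfolding L_def by simp
  have Lbij0: "bij (L x0)" unfolding L0 using bij_id unfolding id_def .
  have evLbij: "\<forall>\<^sub>F x in nhds x0. bij (L x)"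
    by (rule linear_family_eventually_bij[OF fdF evL smooth_at_isCont[OF sL] Lbij0])
  define r where "r x = (\<Sum>i\<in>bO. g (d i) x *\<^sub>R z i)" for x
  have sr: "smooth_at r x0"
    unfolding r_def by (intro smooth_at_sum smooth_at_scaleR smooth_at_const sg)
  define \<eta> where "\<eta> x = inv (L x) (r x)" for x
  have evLi: "\<forall>\<^sub>F x in nhds x0. linear (inv (L x))"
    using evLbij evL by eventually_elim (rule finite_dim_linear_inv)
  have s\<eta>: "smooth_at \<eta> x0"
    unfolding \<eta>_def by (rule smooth_at_family_apply[OF fdF evLi smooth_at_linear_inverse[OF fdF evL sL Lbij0] sr])
  have \<eta>0: "\<eta> x0 = 0"
  proof -
    have "r x0 = 0" by (simp add: r_def g0)
    then show ?thesis unfolding \<eta>_def using linear_0[OF eventually_nhds_x_imp_x[OF evLi]] by simp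
  qed
  have ev\<eta>: "\<forall>\<^sub>F x in nhds x0. \<forall>i\<in>bO. dj (\<eta> x) x (d i) = g (d i) x"
    using evLbij
  proof eventually_elim
    case (elim x)
    show ?case
    proof
      fix i assume i: "i \<in> bO"
      have L\<eta>: "L x (\<eta> x) = r x" unfolding \<eta>_def using elim by (simp add: bij_is_surj surj_f_inv_f)
      have zz: "dj (\<Sum>k\<in>bO. a k *\<^sub>R z k) x0 (d i) = a i" for a
      proof -
        have "dj (\<Sum>k\<in>bO. a k *\<^sub>R z k) x0 (d i) = (\<Sum>k\<in>bO. a k * dj (z k) x0 (d i))"
          by (simp add: linear_sum[OF ldj0] linear_scale[OF ldj0])
        also have "\<dots> = a i"
          using i bO(1) by (simp add: dj0 z dO if_distrib[of "\<lambda>c. _ * c"] cong: if_cong)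
        finally show ?thesis .
      qed
      have "dj (L x (\<eta> x)) x0 (d i) = dj (\<eta> x) x (d i)"
        unfolding L_def linear_add[OF ldj0] zz by simp
      moreover have "dj (r x) x0 (d i) = g (d i) x" unfolding r_def zz ..
      ultimately show "dj (\<eta> x) x (d i) = g (d i) x" using L\<eta> by simp
    qed
  qed
  \<comment> \<open>\<open>R x\<close> is the differential at \<open>x\<close> of \<open>f - j (\<xi> + \<eta>)\<close> with \<open>\<eta>\<close> frozen at \<open>\<eta> x\<close>.  The map \<open>\<Phi>\<close> replaces
    the \<open>K'\<close>-component of \<open>x - x0\<close>, read off by \<open>Q\<close>, by that of \<open>R\<close>, which agrees with it to first order.\<close>
  define R where "R x w = g w x - dj (\<eta> x) x w" for x w
  define \<Phi> where "\<Phi> x = (x - x0) + (\<Sum>i\<in>b. (R x i - Q (x - x0) i) *\<^sub>R e i)" for x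
  have evl: "\<forall>\<^sub>F x in nhds x0. linear (\<lambda>\<zeta>. dj \<zeta> x w)" for w using evdj by eventually_elim blast
  have sR: "smooth_at (\<lambda>x. R x w) x0" for w
    unfolding R_def by (intro smooth_at_diff sg smooth_at_family_apply[OF fdF evl sdj s\<eta>])
  have sxx: "smooth_at (\<lambda>x. x - x0) x0" by (intro smooth_at_diff smooth_at_ident smooth_at_const)
  have sQ: "smooth_at (\<lambda>x. Q (x - x0) w) x0" for w
    by (rule smooth_at_bounded_linear_compose[OF finite_dim_linear_bounded[OF fdE lQ(1)] sxx])
  have s\<Phi>: "smooth_at \<Phi> x0"
    unfolding \<Phi>_def by (intro smooth_at_add smooth_at_sum smooth_at_scaleR smooth_at_const smooth_at_diff[OF sR sQ] sxx)
  have dR: "((\<lambda>x. R x i) has_derivative (\<lambda>h. Q h i)) (at x0)" if i: "i \<in> b" for i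
  proof -
    obtain bF :: "'f set" and c where bF: "finite bF" "\<And>k. k \<in> bF \<Longrightarrow> bounded_linear (c k)"
      "\<And>v. (\<Sum>k\<in>bF. c k v *\<^sub>R k) = v"
      using finite_dim_coordinates[OF fdF] by metis
    have di0: "dj k x0 i = 0" for k using bK[OF i] unfolding K_def dj_def by blast
    have "((\<lambda>x. \<Sum>k\<in>bF. c k (\<eta> x) *\<^sub>R dj k x i) has_derivative
        (\<lambda>h. \<Sum>k\<in>bF. frechet_derivative (\<lambda>x. c k (\<eta> x)) (at x0) h *\<^sub>R dj k x0 i)) (at x0)"
      by (rule derivative_vanishing_pairing)
         (use smooth_at_bounded_linear_compose[OF bF(2) s\<eta>] linear_0[OF bounded_linear.linear[OF bF(2)]]
           smooth_at_isCont[OF sdj] \<eta>0 in auto)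
    then have 1: "((\<lambda>x. \<Sum>k\<in>bF. c k (\<eta> x) *\<^sub>R dj k x i) has_derivative (\<lambda>h. 0)) (at x0)"
      by (simp add: di0)
    obtain U where U: "open U" "x0 \<in> U" "\<And>x. x \<in> U \<Longrightarrow> linear (\<lambda>\<zeta>. dj \<zeta> x i)"
      using evl[of i] unfolding eventually_nhds by blast
    have eq: "(\<Sum>k\<in>bF. c k (\<eta> x) *\<^sub>R dj k x i) = dj (\<eta> x) x i" if "x \<in> U" for x
      using linear_sum[OF U(3)[OF that], of "\<lambda>k. c k (\<eta> x) *\<^sub>R k" bF]
      by (simp add: bF(3) linear_scale[OF U(3)[OF that]])
    have 2: "((\<lambda>x. dj (\<eta> x) x i) has_derivative (\<lambda>h. 0)) (at x0)"
      by (rule has_derivative_transform_within_open[OF 1 U(1,2)]) (rule eq)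
    have "(g i has_derivative (\<lambda>h. Q h i)) (at x0)"
      unfolding Q using smooth_at_has_derivative[OF sg] .
    from has_derivative_diff[OF this 2] show ?thesis unfolding R_def by simp
  qed
  have d\<Phi>: "(\<Phi> has_derivative (\<lambda>h. h)) (at x0)"
  proof -
    have 1: "((\<lambda>x. x - x0) has_derivative (\<lambda>h. h)) (at x0)"
      using has_derivative_diff[OF has_derivative_ident has_derivative_const[of x0]] by simp
    have 2: "((\<lambda>x. Q (x - x0) i) has_derivative (\<lambda>h. Q h i)) (at x0)" for i
      by (rule bounded_linear.has_derivative[OF finite_dim_linear_bounded[OF fdE lQ(1)] 1])
    have "((\<lambda>x. (R x i - Q (x - x0) i) *\<^sub>R e i) has_derivative (\<lambda>h. (Q h i - Q h i) *\<^sub>R e i)) (at x0)" if "i \<in> b" for i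
      by (rule has_derivative_scaleR_left[OF has_derivative_diff[OF dR[OF that] 2]])
    then have "(\<Phi> has_derivative (\<lambda>h. h + (\<Sum>i\<in>b. (Q h i - Q h i) *\<^sub>R e i))) (at x0)"
      unfolding \<Phi>_def by (intro has_derivative_add[OF 1] has_derivative_sum)
    then show ?thesis by simp
  qed
  have \<Phi>W: "\<Phi> x \<in> W \<longleftrightarrow> (\<forall>i\<in>b. R x i = 0)" for x
    unfolding W_def \<Phi>_def by (simp add: linear_add[OF lQ(1)] Qsum)
  have R0: "R x0 i = 0" if "i \<in> b" for i
    using bK[OF that] g0 by (simp add: R_def K_def dj_def)
  \<comment> \<open>At \<open>x0\<close> every vector is the sum of \<open>Z (\<theta> v) x0\<close> and of elements of \<open>K'\<close> and of the span of \<open>d\<close>.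
    Moving the first summand along with \<open>x\<close> gives maps \<open>M x\<close>, which are onto near \<open>x0\<close>; on their images the
    reduced equation implies the full one.\<close>
  define \<rho> where "\<rho> v = v - (\<Sum>i\<in>bO. \<omega> i v *\<^sub>R d i)" for v
  define \<theta> where "\<theta> v = (\<Sum>i\<in>bO. \<omega> (\<rho> v - \<pi> (\<rho> v)) (d i) *\<^sub>R z i)" for v
  have l\<rho>: "linear \<rho>"
    by (rule linearI) (simp_all add: \<rho>_def linear_add[OF l\<omega>(2)] linear_scale[OF l\<omega>(2)] algebra_simps sum.distrib scaleR_sum_right)
  have l\<theta>: "linear \<theta>"
    by (rule linearI) (simp_all add: \<theta>_def linear_add[OF l\<rho>] linear_scale[OF l\<rho>] linear_add[OF l\<pi>] linear_scale[OF l\<pi>]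
        linear_diff[OF l\<omega>(1)] linear_add[OF l\<omega>(1)] linear_scale[OF l\<omega>(1)] algebra_simps sum.distrib sum_subtractf scaleR_sum_right)
  have \<rho>K: "\<rho> v \<in> K" for v
  proof -
    have "\<omega> k (\<rho> v) = 0" if "k \<in> bO" for k
      using that bO(1) unfolding \<rho>_def
      by (simp add: linear_diff[OF l\<omega>(2)] linear_sum[OF l\<omega>(2)] linear_scale[OF l\<omega>(2)] dO if_distrib[of "\<lambda>c. _ * c"] cong: if_cong)
    then have "\<omega> u (\<rho> v) = 0" if "u \<in> Orb" for u
      using linear_eq_0_on_span[OF l\<omega>(1), of bO "\<rho> v" u] that bO(3) by blast
    then show ?thesis unfolding K_iff by blast
  qed
  have Z\<theta>: "Z (\<theta> v) x0 = \<rho> v - \<pi> (\<rho> v)" for v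
  proof -
    have "\<pi> (\<rho> v) \<in> K" using \<pi>K' unfolding K'_def by blast
    then have "\<rho> v - \<pi> (\<rho> v) \<in> Orb" using WK \<pi>W subspace_diff[OF K \<rho>K] by blast
    from repO[OF this] show ?thesis
      unfolding \<theta>_def using z by (simp add: linear_sum[OF Zl0] linear_scale[OF Zl0])
  qed
  define M where "M x v = v - Z (\<theta> v) x0 + Z (\<theta> v) x" for x v
  have M0: "M x0 = (\<lambda>v. v)" unfolding M_def by simp
  have evM: "\<forall>\<^sub>F x in nhds x0. linear (M x)"
    using Zlin
  proof eventually_elim
    case (elim x)
    show ?case
      by (rule linearI) (simp_all add: M_def linear_add[OF l\<theta>] linear_scale[OF l\<theta>] linear_add[OF Zl0]
          linear_scale[OF Zl0] linear_add[OF elim] linear_scale[OF elim] algebra_simps)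
  qed
  have sM: "smooth_at (\<lambda>x. M x v) x0" for v
    unfolding M_def by (intro smooth_at_add smooth_at_const Zs)
  have Mbij0: "bij (M x0)" unfolding M0 using bij_id unfolding id_def .
  have "\<forall>\<^sub>F x in nhds x0. bij (M x)"
    by (rule linear_family_eventually_bij[OF fdE evM smooth_at_isCont[OF sM] Mbij0])
  then have evcrit: "\<forall>\<^sub>F x in nhds x0. \<Phi> x \<in> W \<longrightarrow> (\<exists>\<eta>. \<forall>v. frechet_derivative (\<lambda>x. f x - j \<eta> x) (at x) v = 0)"
    using evF evdj ev\<eta> evgZ jZ evfj smooth_at_eventually[OF f] j
  proof eventually_elim
    case (elim x)
    show ?case
    proof
      assume "\<Phi> x \<in> W"
      then have Rb: "R x i = 0" if "i \<in> b" for i using \<Phi>W that by blast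
      have lg: "linear (\<lambda>w. g w x)" unfolding g_def by (rule smooth_at_linear_derivative[OF elim(2)])
      have lR: "linear (R x)" unfolding R_def using elim(3) by (intro linear_compose_sub lg) blast
      have RK: "R x w = 0" if "w \<in> K'" for w
        using linear_eq_0_on_span[OF lR, of b w] Rb that b(3) by blast
      have Rd: "R x (d i) = 0" if "i \<in> bO" for i using elim(4) that unfolding R_def by simp
      have RZ: "R x (Z \<zeta> x) = 0" for \<zeta> using elim(5,6) unfolding R_def dj_def by simp
      have "R x (M x v) = 0" for v
      proof -
        have eq: "v - Z (\<theta> v) x0 = (\<Sum>i\<in>bO. \<omega> i v *\<^sub>R d i) + \<pi> (\<rho> v)"
          unfolding Z\<theta> \<rho>_def[of v] by simp
        have "R x (v - Z (\<theta> v) x0) = 0"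
          unfolding eq linear_add[OF lR] linear_sum[OF lR] linear_scale[OF lR] using Rd RK[OF \<pi>K'] by simp
        then show ?thesis unfolding M_def linear_add[OF lR] using RZ by simp
      qed
      then have Rz: "R x v = 0" for v using elim(1) by (metis bij_pointE)
      have jadd: "dj (\<xi> + \<eta> x) x v = dj \<xi> x v + dj (\<eta> x) x v" for v using elim(3) linear_add by blast
      have "frechet_derivative (\<lambda>x. f x - j (\<xi> + \<eta> x') x) (at x) v = 0" if "x' = x" for v x'
      proof -
        have "frechet_derivative (\<lambda>x. f x - j (\<xi> + \<eta> x') x) (at x) v = frechet_derivative f (at x) v - dj (\<xi> + \<eta> x') x v"
          unfolding dj_def
          by (intro frechet_derivative_apply has_derivative_diff smooth_at_has_derivative) (use elim in auto)
        also have "\<dots> = g v x - dj (\<eta> x) x v" using elim(7) unfolding that jadd by (simp add: dj_def)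
        also have "\<dots> = 0" using Rz[of v] unfolding R_def .
        finally show ?thesis .
      qed
      then show "\<exists>\<eta>. \<forall>v. frechet_derivative (\<lambda>x. f x - j \<eta> x) (at x) v = 0" by blast
    qed
  qed
  show ?thesis
  proof (rule that[OF W _ ndW s\<Phi> _ _ evcrit])
    show "dim W = 2 * dim (range (\<lambda>\<zeta>. Z \<zeta> x0))" using dimW unfolding Orb_def .
    show "frechet_derivative \<Phi> (at x0) = (\<lambda>v. v)" using frechet_derivative_at[OF d\<Phi>] by simp
    show "\<Phi> x0 \<in> W" unfolding \<Phi>W using R0 by blast
  qed
qed

section \<open>Submanifolds cut out by straightening maps\<close>

context atlas_of_manifold
begin

text \<open>In the chart \<open>\<Phi> \<circ> c\<close> the set is an open part of the subspace
  \<open>W\<close>.  Its tangent vectors are the velocities of curves which stay in the set, so each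
  of them is tangent to \<open>W\<close>; conversely a straight line in \<open>W\<close>, cut off
  where it leaves the chart, realises every vector of \<open>W\<close>.\<close>

lemma straightened_submanifold:
  fixes \<Phi> g :: "'e \<Rightarrow> 'e"
  assumes c: "c \<in> maximal_atlas A" and V: "open V" "V \<subseteq> snd c ` fst c"
    and oW: "open (\<Phi> ` V)" and hom: "homeomorphism V (\<Phi> ` V) \<Phi> g"
    and sm: "smooth_on V \<Phi>" "smooth_on (\<Phi> ` V) g" and bij: "\<And>x. x \<in> V \<Longrightarrow> bij (frechet_derivative \<Phi> (at x))"
    and W: "subspace W"
  defines "S \<equiv> {p \<in> fst c. snd c p \<in> V \<and> \<Phi> (snd c p) \<in> W}"
  shows "submanifold A (dim W) S"
    and "\<And>p. p \<in> S \<Longrightarrow> tangent_space A S p =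
      dtrans c (chart_at A p) p ` {u. frechet_derivative \<Phi> (at (snd c p)) u \<in> W}"
proof -
  have ch: "is_chart c" using maximal_atlas_is_chart[OF c] .
  define d where "d = (chart_inv c ` V, \<lambda>p. \<Phi> (snd c p))"
  have d: "d \<in> maximal_atlas A" "\<And>x. x \<in> \<Phi> ` V \<Longrightarrow> chart_inv d x = chart_inv c (g x)" "snd d ` fst d = \<Phi> ` V"
    unfolding d_def using chart_change_coordinates[OF smooth_manifold_A c V oW hom sm] by blast+
  have fd: "p \<in> fst d \<longleftrightarrow> p \<in> fst c \<and> snd c p \<in> V" for p
  proof
    assume "p \<in> fst d"
    then obtain x where "x \<in> V" "p = chart_inv c x" unfolding d_def by auto
    then show "p \<in> fst c \<and> snd c p \<in> V"
      using V(2) chart_inv_in[OF ch] chart_inv_right[OF ch] by (metis subsetD)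
  next
    assume "p \<in> fst c \<and> snd c p \<in> V"
    then show "p \<in> fst d" unfolding d_def using chart_inv_left[OF ch] by (metis fst_conv imageI)
  qed
  have S: "S = {p \<in> fst d. snd d p \<in> W}" unfolding S_def using fd by (auto simp: d_def)
  show "submanifold A (dim W) S"
    unfolding submanifold_def
  proof
    fix p assume "p \<in> S"
    then have "p \<in> fst d" unfolding S by blast
    moreover have "snd d ` (fst d \<inter> S) = snd d ` fst d \<inter> W" unfolding S by blast
    ultimately show "\<exists>c\<in>maximal_atlas A. p \<in> fst c \<and>
        (\<exists>L. subspace L \<and> dim L = dim W \<and> snd c ` (fst c \<inter> S) = snd c ` fst c \<inter> L)"
      using d(1) W by blast
  qed
  fix p assume p: "p \<in> S"
  have pd: "p \<in> fst d" and pc: "p \<in> fst c" and pV: "snd c p \<in> V" and pW: "\<Phi> (snd c p) \<in> W"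
    using p fd unfolding S_def by blast+
  let ?a = "chart_at A p"
  define x where "x = snd c p"
  define D where "D = frechet_derivative \<Phi> (at x)"
  have s\<Phi>: "smooth_at \<Phi> x" using smooth_at_smooth_on[OF sm(1) V(1)] pV unfolding x_def by blast
  have dD: "(\<Phi> has_derivative D) (at x)" unfolding D_def by (rule smooth_at_has_derivative[OF s\<Phi>])
  have lD: "linear D" using has_derivative_linear[OF dD] .
  have comp: "((\<lambda>s. \<Phi> (snd c (\<gamma> s))) has_vector_derivative D u) (at (0::real))"
    if "\<gamma> 0 = p" "((\<lambda>s. snd c (\<gamma> s)) has_vector_derivative u) (at 0)" for \<gamma> u
  proof -
    have "(\<Phi> has_derivative D) (at (snd c (\<gamma> 0)))" using dD that(1) by (simp add: x_def)
    from has_derivative_compose[OF that(2)[unfolded has_vector_derivative_def] this]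
    show ?thesis by (simp add: has_vector_derivative_def linear_scale[OF lD])
  qed
  show "tangent_space A S p = dtrans c ?a p ` {u. D u \<in> W}"
  proof
    show "tangent_space A S p \<subseteq> dtrans c ?a p ` {u. D u \<in> W}"
    proof
      fix v assume "v \<in> tangent_space A S p"
      then obtain \<gamma> where \<gamma>: "range \<gamma> \<subseteq> S" "\<gamma> 0 = p" "has_velocity A \<gamma> v 0"
        unfolding tangent_space_def by blast
      define u where "u = dtrans ?a c p v"
      have "((\<lambda>s. snd c (\<gamma> s)) has_vector_derivative u) (at 0)"
        using has_velocity_in_chart[OF c _ \<gamma>(3)] pc \<gamma>(2) unfolding u_def by simp
      from comp[OF \<gamma>(2) this] have "((\<lambda>s. \<Phi> (snd c (\<gamma> s))) has_vector_derivative D u) (at 0)" .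
      moreover have "\<forall>\<^sub>F s in nhds 0. \<Phi> (snd c (\<gamma> s)) \<in> W"
        using \<gamma>(1) unfolding S_def by (intro always_eventually allI) blast
      ultimately have "D u \<in> W" by (rule vector_derivative_in_subspace[OF fdA W])
      moreover have "v = dtrans c ?a p u"
        unfolding u_def by (rule dtrans_smooth(4)[OF at_in(4) c at_in(2) pc, symmetric])
      ultimately show "v \<in> dtrans c ?a p ` {u. D u \<in> W}" by blast
    qed
  next
    show "dtrans c ?a p ` {u. D u \<in> W} \<subseteq> tangent_space A S p"
    proof (intro image_subsetI)
      fix u assume "u \<in> {u. D u \<in> W}"
      then have u: "D u \<in> W" by blast
      have chd: "is_chart d" using maximal_atlas_is_chart[OF d(1)] .
      define l where "l s = snd d p + s *\<^sub>R D u" for s :: real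
      have lc: "isCont l s" for s unfolding l_def by (intro continuous_intros)
      have l0: "l 0 = snd d p" by (simp add: l_def)
      have lW: "l s \<in> W" for s
        unfolding l_def using pW u by (intro subspace_add[OF W] subspace_scale[OF W]) (simp_all add: d_def)
      \<comment> \<open>The definition of the tangent space asks for a curve on the whole line; only its germ at 0 matters.\<close>
      define \<gamma> where "\<gamma> s = (if l s \<in> snd d ` fst d then chart_inv d (l s) else p)" for s
      have rng: "range \<gamma> \<subseteq> S"
      proof (rule image_subsetI)
        fix s
        show "\<gamma> s \<in> S"
        proof (cases "l s \<in> snd d ` fst d")
          case True
          then show ?thesis
            unfolding S \<gamma>_def using chart_inv_in[OF chd True] chart_inv_right[OF chd True] lW[of s] by simp
        qed (simp add: \<gamma>_def p)
      qed
      have im0: "snd d p \<in> snd d ` fst d" using pd by blast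
      have \<gamma>0: "\<gamma> 0 = p" unfolding \<gamma>_def l0 using im0 by (simp add: chart_inv_left[OF chd pd])
      have "\<forall>\<^sub>F s in nhds 0. l s \<in> snd d ` fst d"
        by (rule isCont_eventually_in[OF lc chart_open_image[OF chd]]) (simp add: l0 im0)
      then obtain U where U: "open U" "0 \<in> U" "\<And>s. s \<in> U \<Longrightarrow> l s \<in> snd d ` fst d"
        unfolding eventually_nhds by blast
      have "isCont (\<lambda>s. chart_inv d (l s)) 0"
        by (rule isCont_o2[OF lc]) (use isCont_chart_inv[OF chd im0] l0 in simp)
      moreover have "\<forall>\<^sub>F s in nhds 0. chart_inv d (l s) = \<gamma> s"
        using eventually_nhds_in_open[OF U(1,2)] by eventually_elim (simp add: \<gamma>_def U(3))
      ultimately have \<gamma>c: "isCont \<gamma> 0" using isCont_cong[of "\<lambda>s. chart_inv d (l s)" \<gamma> 0] by blast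
      have dl: "(l has_vector_derivative D u) (at 0)"
        unfolding l_def by (auto intro!: derivative_eq_intros)
      have "((\<lambda>s. snd d (\<gamma> s)) has_vector_derivative D u) (at 0)"
        by (rule has_vector_derivative_transform_within_open[OF dl U(1,2)])
           (simp add: \<gamma>_def U(3) chart_inv_right[OF chd])
      then have dd: "((\<lambda>s. \<Phi> (snd c (\<gamma> s))) has_vector_derivative D u) (at 0)" by (simp add: d_def)
      define u' where "u' = dtrans d c p (D u)"
      have dc: "((\<lambda>s. snd c (\<gamma> s)) has_vector_derivative u') (at 0)"
        unfolding u'_def \<gamma>0[symmetric]
        by (rule velocity_change_chart[OF d(1) c]) (use pd pc \<gamma>0 \<gamma>c dd in \<open>simp_all add: d_def\<close>)
      have "D u' = D u" using comp[OF \<gamma>0 dc] dd vector_derivative_unique_at by blast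
      then have "u' = u" using bij[OF pV] unfolding D_def x_def by (metis bij_is_inj injD)
      then have "has_velocity A \<gamma> (dtrans c ?a p u) 0"
        using has_velocity_from_chart[OF c _ \<gamma>c dc] \<gamma>0 pc by simp
      then show "dtrans c ?a p u \<in> tangent_space A S p"
        unfolding tangent_space_def using rng \<gamma>0 by blast
    qed
  qed
qed

end

section \<open>The family of relative equilibria\<close>

context hamiltonian_action
begin

text \<open>\<open>critical_slice\<close> is applied in the chart chosen at \<open>m\<close>, in
  which the hypotheses on the Hessian and on \<open>DJ(m)\<close> are expressed; the resulting map
  \<open>\<Phi>\<close> is then restricted to a neighbourhood on which it is invertible and all the
  conditions that hold near \<open>m\<close> hold.\<close>

theorem symplectic_family_of_relative_equilibria:
  assumes h: "smooth_map A vs_atlas h" and inv: "\<And>g m. h (act g m) = h m"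
    and nre: "nondegenerate_relative_equilibrium B A \<omega> act J h \<xi> m"
  shows "\<exists>S. symplectic_submanifold A \<omega> (2 * (model_dim B - submanifold_dim B (isotropy act m))) S \<and>
           m \<in> S \<and> (\<forall>p\<in>S. \<exists>\<eta>. relative_equilibrium B A \<omega> act h \<eta> p)"
proof -
  define c where "c = chart_at A m"
  define x0 where "x0 = snd c m"
  have c: "c \<in> A" "m \<in> fst c" "is_chart c" "c \<in> maximal_atlas A" unfolding c_def by (rule at_in)+
  define f where "f x = h (chart_inv c x)" for x
  define j where "j \<zeta> x = blinfun_apply (J (chart_inv c x)) \<zeta>" for \<zeta> x
  define Q where "Q = (\<lambda>v w. frechet_derivative (\<lambda>x. frechet_derivative (\<lambda>x. f x - j \<xi> x) (at x) w) (at x0) v)"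
  define K where "K = {v. \<forall>\<zeta>. frechet_derivative (j \<zeta>) (at x0) v = 0}"
  have pt: "\<exists>p. p \<in> fst c \<and> x = snd c p" if "x \<in> snd c ` fst c" for x using that by blast
  have im: "\<forall>\<^sub>F x in nhds x0. x \<in> snd c ` fst c"
    unfolding x0_def by (rule eventually_chart_image[OF c(3,2)])
  have sf: "smooth_at f x" if "x \<in> snd c ` fst c" for x
    using pt[OF that] smooth_vs_in_atlas[OF h c(1)] unfolding f_def by blast
  have sj: "smooth_at (j \<zeta>) x" if "x \<in> snd c ` fst c" for x \<zeta>
    using pt[OF that] smooth_vs_in_atlas[OF smooth_J_component c(1)] unfolding j_def by blast
  have x0: "x0 \<in> snd c ` fst c" unfolding x0_def using c(2) by blast
  have infg: "infg \<zeta> m = gen c \<zeta> x0" for \<zeta> unfolding inf_generator_eq c_def x0_def ..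
  have md: "mderiv A vs_atlas k m v = frechet_derivative (\<lambda>x. k (chart_inv c x)) (at x0) v" for k :: "'m \<Rightarrow> real" and v
    unfolding mderiv_vs c_def x0_def ..
  have K_eq: "{v. mderiv A vs_atlas J m v = 0} = K"
  proof -
    have dJ: "((\<lambda>x. J (chart_inv c x)) has_derivative mderiv A vs_atlas J m) (at x0)"
      unfolding mderiv_vs c_def[symmetric] x0_def
      by (rule smooth_at_has_derivative[OF smooth_vs_in_atlas[OF smooth_J c(1,2)]])
    have "frechet_derivative (j \<zeta>) (at x0) v = blinfun_apply (mderiv A vs_atlas J m v) \<zeta>" for \<zeta> v
      unfolding j_def
      by (intro frechet_derivative_apply bounded_linear.has_derivative[OF blinfun.bounded_linear_left] dJ)
    then show ?thesis unfolding K_def by (auto intro: blinfun_eqI)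
  qed
  have crit: "frechet_derivative (\<lambda>x. f x - j \<xi> x) (at x0) v = 0" for v
    using relative_equilibrium_imp_critical[OF h, of \<xi> m] nre
    unfolding nondegenerate_relative_equilibrium_def critical_def md f_def j_def by blast
  have Qh: "Q = hessian A (\<lambda>p. h p - blinfun_apply (J p) \<xi>) m"
    by (simp add: fun_eq_iff Q_def hessian_def f_def j_def c_def x0_def comp_def)
  have nondeg: "{v \<in> K. \<forall>w\<in>K. Q v w = 0} = range (\<lambda>\<zeta>. gen c \<zeta> x0)"
    using nre unfolding nondegenerate_relative_equilibrium_def Let_def K_eq Qh infg by blast
  obtain W \<Phi> where W: "subspace W" "dim W = 2 * dim (range (\<lambda>\<zeta>. gen c \<zeta> x0))" "nondegenerate_on W (\<omega> m)"
    and \<Phi>: "smooth_at \<Phi> x0" "frechet_derivative \<Phi> (at x0) = (\<lambda>v. v)" "\<Phi> x0 \<in> W"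
    and ev: "\<forall>\<^sub>F x in nhds x0. \<Phi> x \<in> W \<longrightarrow> (\<exists>\<eta>. \<forall>v. frechet_derivative (\<lambda>x. f x - j \<eta> x) (at x) v = 0)"
  proof (rule critical_slice[where f = f and j = j and Z = "gen c" and \<omega> = "\<omega> m" and \<xi> = \<xi>,
        OF fdA fdB _ _ _ _ _ _ _ bilinear_\<omega> \<omega>_alternating \<omega>_nondegenerate _ crit K_def Q_def nondeg])
    show "smooth_at f x0" by (rule sf[OF x0])
    show "\<forall>\<^sub>F x in nhds x0. \<forall>\<zeta>. smooth_at (j \<zeta>) x" using im by eventually_elim (use sj in blast)
    show "linear (\<lambda>\<zeta>. j \<zeta> x)" for x unfolding j_def by (rule bounded_linear.linear[OF blinfun.bounded_linear_right])
    show "\<forall>\<^sub>F x in nhds x0. linear (\<lambda>\<zeta>. gen c \<zeta> x)"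
      using im by eventually_elim (use linear_gen[OF c(1)] in blast)
    show "smooth_at (gen c \<zeta>) x0" for \<zeta> unfolding x0_def by (rule smooth_gen[OF c(1,2)])
    show "\<forall>\<^sub>F x in nhds x0. \<forall>\<zeta>. frechet_derivative f (at x) (gen c \<zeta> x) = 0"
      using im
    proof eventually_elim
      case (elim x)
      then show ?case using invariant_derivative_along_orbit[OF h inv c(1)] unfolding f_def by blast
    qed
    show "\<forall>\<^sub>F x in nhds x0. \<forall>\<eta> \<zeta>. frechet_derivative (j \<eta>) (at x) (gen c \<zeta> x) = 0"
      using im
    proof eventually_elim
      case (elim x)
      have "blinfun_apply (J (act g p)) \<eta> = blinfun_apply (J p) \<eta>" for g p \<eta> by (simp add: J_invariant)
      from invariant_derivative_along_orbit[OF smooth_J_component this c(1)] elim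
      show ?case unfolding j_def by blast
    qed
    show "\<omega> m (gen c \<zeta> x0) v = frechet_derivative (j \<zeta>) (at x0) v" for \<zeta> v
      using momentum_derivative[of m \<zeta> v] unfolding infg md j_def .
  qed blast
  have x0form: "form_in_chart A \<omega> c x0 = \<omega> m"
    unfolding fun_eq_iff x0_def form_in_chart_eq[OF c(3,2)] c_def[symmetric] dtrans_self[OF c(4,2)] by simp
  have evnd: "\<forall>\<^sub>F x in nhds x0. \<forall>u. frechet_derivative \<Phi> (at x) u \<in> W \<longrightarrow>
      (\<forall>u'. frechet_derivative \<Phi> (at x) u' \<in> W \<longrightarrow> form_in_chart A \<omega> c x u u' = 0) \<longrightarrow> u = 0"
  proof (rule nondegenerate_near[OF fdA])
    show "\<forall>\<^sub>F x in nhds x0. bilinear (form_in_chart A \<omega> c x)"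
      using im by eventually_elim (use bilinear_form_in_chart[OF c(1)] in blast)
    show "smooth_at (\<lambda>x. form_in_chart A \<omega> c x v w) x0" for v w
      by (rule smooth_at_smooth_on[OF smooth_\<omega>[OF c(1)] chart_open_image[OF c(3)] x0])
    show "\<forall>\<^sub>F x in nhds x0. linear (frechet_derivative \<Phi> (at x))"
      using smooth_at_eventually[OF \<Phi>(1)] by eventually_elim (rule smooth_at_linear_derivative)
    show "smooth_at (\<lambda>x. frechet_derivative \<Phi> (at x) v) x0" for v by (rule smooth_at_frechet_derivative[OF \<Phi>(1)])
    show "nondegenerate_on W (form_in_chart A \<omega> c x0)" unfolding x0form by (rule W(3))
  qed (rule \<Phi>(2), rule W(1))
  obtain N where N: "open N" "x0 \<in> N" and Nim: "N \<subseteq> snd c ` fst c" and sN: "\<And>x. x \<in> N \<Longrightarrow> smooth_at \<Phi> x"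
    and critN: "\<And>x. x \<in> N \<Longrightarrow> \<Phi> x \<in> W \<Longrightarrow> \<exists>\<eta>. \<forall>v. frechet_derivative (\<lambda>x. f x - j \<eta> x) (at x) v = 0"
    and ndN: "\<And>x u. x \<in> N \<Longrightarrow> frechet_derivative \<Phi> (at x) u \<in> W \<Longrightarrow>
      (\<And>u'. frechet_derivative \<Phi> (at x) u' \<in> W \<Longrightarrow> form_in_chart A \<omega> c x u u' = 0) \<Longrightarrow> u = 0"
  proof -
    define G1 where "G1 x \<longleftrightarrow> (\<Phi> x \<in> W \<longrightarrow> (\<exists>\<eta>. \<forall>v. frechet_derivative (\<lambda>x. f x - j \<eta> x) (at x) v = 0))" for x
    define G2 where "G2 x \<longleftrightarrow> (\<forall>u. frechet_derivative \<Phi> (at x) u \<in> W \<longrightarrow>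
      (\<forall>u'. frechet_derivative \<Phi> (at x) u' \<in> W \<longrightarrow> form_in_chart A \<omega> c x u u' = 0) \<longrightarrow> u = 0)" for x
    have "\<forall>\<^sub>F x in nhds x0. x \<in> snd c ` fst c \<and> smooth_at \<Phi> x \<and> G1 x \<and> G2 x"
      by (intro eventually_conj im ev[folded G1_def] evnd[folded G2_def] smooth_at_eventually[OF \<Phi>(1)])
    then obtain N where N: "open N" "x0 \<in> N"
      and G: "\<forall>x\<in>N. x \<in> snd c ` fst c \<and> smooth_at \<Phi> x \<and> G1 x \<and> G2 x"
      unfolding eventually_nhds by (elim exE conjE)
    show thesis
    proof (rule that[OF N])
      show "N \<subseteq> snd c ` fst c" using G by (intro subsetI) (drule bspec, assumption, elim conjE)
      fix x assume x: "x \<in> N"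
      have Gx: "smooth_at \<Phi> x" "G1 x" "G2 x" using bspec[OF G x] by simp_all
      show "smooth_at \<Phi> x" by (rule Gx(1))
      show "\<exists>\<eta>. \<forall>v. frechet_derivative (\<lambda>x. f x - j \<eta> x) (at x) v = 0" if "\<Phi> x \<in> W"
        using Gx(2) that unfolding G1_def by (rule mp)
      show "u = 0" if "frechet_derivative \<Phi> (at x) u \<in> W"
        "\<And>u'. frechet_derivative \<Phi> (at x) u' \<in> W \<Longrightarrow> form_in_chart A \<omega> c x u u' = 0" for u
        using Gx(3) that unfolding G2_def by simp
    qed
  qed
  have smN: "smooth_on N \<Phi>" by (rule smooth_on_smooth_at[OF sN])
  obtain V g where V: "open V" "x0 \<in> V" "V \<subseteq> N" "open (\<Phi> ` V)" "homeomorphism V (\<Phi> ` V) \<Phi> g"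
    "smooth_on (\<Phi> ` V) g" "\<And>x. x \<in> V \<Longrightarrow> bij (frechet_derivative \<Phi> (at x))"
    using smooth_local_inverse[OF fdA N smN \<Phi>(2)] by blast
  define S where "S = {p \<in> fst c. snd c p \<in> V \<and> \<Phi> (snd c p) \<in> W}"
  note str = straightened_submanifold[OF c(4) V(1) subset_trans[OF V(3) Nim] V(4,5)
      smooth_on_subset[OF smN V(3)] V(6,7) W(1), folded S_def]
  have dim: "dim W = 2 * (model_dim B - submanifold_dim B (isotropy act m))"
    unfolding W(2) isotropy_codimension infg ..
  have mS: "m \<in> S" unfolding S_def using c(2) V(2) \<Phi>(3) by (simp add: x0_def)
  have re: "\<exists>\<eta>. relative_equilibrium B A \<omega> act h \<eta> p" if p: "p \<in> S" for p
  proof -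
    have pc: "p \<in> fst c" "snd c p \<in> N" "\<Phi> (snd c p) \<in> W" using p V(3) unfolding S_def by blast+
    obtain \<eta> where "\<forall>v. frechet_derivative (\<lambda>x. f x - j \<eta> x) (at (snd c p)) v = 0"
      using critN[OF pc(2,3)] by blast
    then have "critical (\<lambda>m. h m - blinfun_apply (J m) \<eta>) p"
      unfolding critical_in_chart[OF smooth_minus_J[OF h] c(4) pc(1)] f_def j_def .
    then show ?thesis using critical_imp_relative_equilibrium[OF h inv] by blast
  qed
  have nd: "nondegenerate_on (tangent_space A S p) (\<omega> p)" if p: "p \<in> S" for p
    unfolding nondegenerate_on_def
  proof (intro ballI impI)
    have pc: "p \<in> fst c" "snd c p \<in> N" using p V(3) unfolding S_def by blast+
    let ?T = "dtrans c (chart_at A p) p"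
    have TS: "tangent_space A S p = ?T ` {u. frechet_derivative \<Phi> (at (snd c p)) u \<in> W}"
      by (rule str(2)[OF _ p])
    fix v assume v: "v \<in> tangent_space A S p" "\<forall>w\<in>tangent_space A S p. \<omega> p v w = 0"
    obtain u where u: "v = ?T u" "frechet_derivative \<Phi> (at (snd c p)) u \<in> W" using v(1) unfolding TS by blast
    have "u = 0"
    proof (rule ndN[OF pc(2) u(2)])
      fix u' assume "frechet_derivative \<Phi> (at (snd c p)) u' \<in> W"
      then have "?T u' \<in> tangent_space A S p" unfolding TS by blast
      then show "form_in_chart A \<omega> c (snd c p) u u' = 0"
        unfolding form_in_chart_eq[OF c(3) pc(1)] u(1)[symmetric] using v(2) by blast
    qed
    then show "v = 0" unfolding u(1) using linear_0[OF dtrans_smooth(2)[OF c(4) at_in(4) pc(1) at_in(2)]] by simp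
  qed
  show ?thesis
    unfolding symplectic_submanifold_def dim[symmetric] using str(1) nd mS re by blast
qed

end

theorem corollary4p4:
  fixes A :: "('m::{t2_space, second_countable_topology}, 'e::real_normed_vector) chart set"
    and \<omega> :: "'m \<Rightarrow> 'e \<Rightarrow> 'e \<Rightarrow> real"
    and h :: "'m \<Rightarrow> real"
    and B :: "('g::{ab_group_add, t2_space, second_countable_topology},
               'f::real_normed_vector) chart set"
    and act :: "'g \<Rightarrow> 'm \<Rightarrow> 'm"
    and J :: "'m \<Rightarrow> 'f \<Rightarrow>\<^sub>L real"
    and m\<^sub>e :: 'm and \<xi> :: 'f and H :: "'g set"
  assumes "hamiltonian_system A \<omega> h"
    and "abelian_lie_group B"
    and "smooth_action B A act"
    and "proper_action act"
    and "globally_hamiltonian B A \<omega> act J"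
    and "\<forall>g m. h (act g m) = h m"
    and "nondegenerate_relative_equilibrium B A \<omega> act J h \<xi> m\<^sub>e"
    and "H = isotropy act m\<^sub>e"
  shows "\<exists>\<Sigma>. symplectic_submanifold A \<omega> (2 * (model_dim B - submanifold_dim B H)) \<Sigma> \<and>
           m\<^sub>e \<in> \<Sigma> \<and> (\<forall>p\<in>\<Sigma>. \<exists>\<eta>. relative_equilibrium B A \<omega> act h \<eta> p)"
proof -
  interpret hamiltonian_action A \<omega> B act J
  proof unfold_locales
    show "symplectic_manifold A \<omega>" using assms(1) unfolding hamiltonian_system_def by blast
    then show "smooth_manifold A" unfolding symplectic_manifold_def by blast
    show "abelian_lie_group B" by (rule assms(2))
    show "smooth_action B A act" by (rule assms(3))
    show "momentum_map B A \<omega> act J" using assms(5) unfolding globally_hamiltonian_def by blast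
    show "J (act g m) = J m" for g m using assms(5) unfolding globally_hamiltonian_def by blast
  qed
  have "smooth_map A vs_atlas h" using assms(1) unfolding hamiltonian_system_def by blast
  then show ?thesis
    unfolding assms(8) using symplectic_family_of_relative_equilibria assms(6,7) by blast
qed

end
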